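(* Let $\Omega\subset\mathbb{R}^d$ be a connected open set and $H$ an RKHS on $\Omega$ with kernel $k$, continuously included in $\mathfrak{E}(\Omega)$ and consisting of real analytic functions. Let $f:\Omega\to\Omega$ be of class $C^\infty$ such that $C_f$ is densely defined on $H$, and let $\Lambda=\{p_1,\dots,p_r\}\subset\Omega$ be a set of $r\ge 1$ distinct fixed points of $f$. For each $i$ let $\lambda_i=(\lambda_{i,1},\dots,\lambda_{i,d})$, where $\lambda_{i,1},\dots,\lambda_{i,d}$ are the eigenvalues (with multiplicity) of the Jacobian matrix $\mathrm{d}f_{p_i}$. Assume that $\iota'$ is injective on $\sum_{i=1}^r\mathfrak{D}_{p_i}$ and that, for each $i$, $\lambda_i^\alpha\ne\lambda_i^\beta$ for all $\alpha\ne\beta$ in $\mathbb{Z}_{\ge0}^d$. Then there exist families $\{w_{i,\alpha}\}\subset\Phi$ and $\{u_{i,\alpha}\}\subset\Phi^*$, indexed by $i\in\{1,\dots,r\}$, $\alpha\in\mathbb{Z}_{\ge0}^d$, such that for all $i,j,\alpha,\beta$ $$C_f^\times u_{i,\alpha}=\lambda_i^\alpha u_{i,\alpha},\qquad C_f^*w_{i,\alpha}=\overline{\lambda_i^\alpha}\,w_{i,\alpha},\qquad \langle w_{j,\beta},u_{i,\alpha}\rangle=\delta_{(i,\alpha),(j,\beta)},$$ and for all $u\in\Phi^*$ and $w\in\Phi$ $$C_f^\times u=\sum_{i,\alpha}\lambda_i^\alpha\,\overline{\langle w_{i,\alpha},u\rangle}\,u_{i,\alpha},\qquad C_f^*w=\sum_{i,\alpha}\overline{\lambda_i^\alpha}\,\langle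 w,u_{i,\alpha}\rangle\,w_{i,\alpha},$$ with convergence in $\Phi^*$ and $\Phi$, respectively.
   Context: $\mathfrak{E}(\Omega)$: $\mathbb{C}$-valued $C^\infty$ functions on $\Omega$ with uniform convergence of all derivatives on compact sets; $\iota:H\hookrightarrow\mathfrak{E}(\Omega)$ is the inclusion and $\iota':\mathfrak{E}(\Omega)'\to H'$ its dual. $\delta_p^{(\alpha)}(h):=\partial_x^\alpha h(p)$ and $\mathfrak{D}_p:=\mathrm{span}\{\delta_p^{(\alpha)}:\alpha\in\mathbb{Z}_{\ge0}^d\}\subset\mathfrak{E}(\Omega)'$. Conventions: $k_x:=k(x,\cdot)\in H$, $\langle h,k_x\rangle_H=h(x)$, inner product linear in the first variable. $C_fh:=h\circ f$ on $D(C_f)=\{h\in H:h\circ f\in H\}$; $C_f^*$ is its adjoint. $V_{p,n}:=\mathrm{span}\{\partial_x^\alpha k(x,\cdot)|_{x=p}:|\alpha|\le n\}\subset H$, $V_{\Lambda,n}:=\sum_{i=1}^rV_{p_i,n}$; since the $p_i$ are fixed points, $C_f^*(V_{\Lambda,n})\subset V_{\Lambda,n}$. $\Phi:=\bigcup_{n\ge0}V_{\Lambda,n}$ with the inductive limit topology of the finite-dimensional spaces $V_{\Lambda,n}$. With $\pi_{n+1,n}:V_{\Lambda,n+1}\to V_{\Lambda,n}$ the orthogonal projection, $\Phi^*:=\{(\mu_n)_n\in\prod_{n\ge0}V_{\Lambda,n}:\pi_{n+1,n}(\mu_{n+1})=\mu_n\ \forall n\}$ with the subspace topology of the product topology. The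 pairing $\Phi\times\Phi^*\to\mathbb{C}$, $\langle h,(g_n)_n\rangle:=\lim_{n\to\infty}\langle h,g_n\rangle_H$ (eventually constant) is linear in the first and conjugate-linear in the second variable. The extended Koopman operator $C_f^\times:\Phi^*\to\Phi^*$ is the unique (continuous) linear map with $\langle g,C_f^\times\mu\rangle=\langle C_f^*g,\mu\rangle$ for all $g\in\Phi$, $\mu\in\Phi^*$. *)

theory Defs
  imports
    "HOL-Analysis.Analysis"
    "HOL-Library.Function_Algebras"
    "HOL-Computational_Algebra.Polynomial"
begin

section \<open>Spaces of complex functions\<close>

text \<open>
  A function on a subset \<open>\<Omega>\<close> of the Euclidean space is represented by its extension by zero to the
  whole space. Spans are taken with \<^const>\<open>module.span\<close> for the following scalar multiplication,
  also for spaces of functionals.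
\<close>

definition cscale :: "complex \<Rightarrow> ('a \<Rightarrow> complex) \<Rightarrow> 'a \<Rightarrow> complex" where
  "cscale c h = (\<lambda>x. c * h x)"

lemma vector_space_cscale: "vector_space (cscale :: complex \<Rightarrow> ('a \<Rightarrow> complex) \<Rightarrow> _)"
  by unfold_locales (auto simp: cscale_def fun_eq_iff algebra_simps)

definition subspace_sum :: "'i set \<Rightarrow> ('i \<Rightarrow> 'b::comm_monoid_add set) \<Rightarrow> 'b set" where
  "subspace_sum I W = {\<Sum>i\<in>I. v i | v. \<forall>i\<in>I. v i \<in> W i}"


section \<open>Multi-indices, derivatives, smooth and real analytic functions\<close>

definition mpow :: "('d::finite \<Rightarrow> 'a::comm_semiring_1) \<Rightarrow> ('d \<Rightarrow> nat) \<Rightarrow> 'a" where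
  "mpow z \<alpha> = (\<Prod>j\<in>UNIV. z j ^ \<alpha> j)"

definition msize :: "('d::finite \<Rightarrow> nat) \<Rightarrow> nat" where
  "msize \<alpha> = (\<Sum>j\<in>UNIV. \<alpha> j)"

definition pd :: "'d::finite \<Rightarrow> (real^'d \<Rightarrow> 'b::real_normed_vector) \<Rightarrow> real^'d \<Rightarrow> 'b" where
  "pd j h = (\<lambda>x. frechet_derivative h (at x) (axis j 1))"

fun Ck_on :: "nat \<Rightarrow> (real^'d::finite) set \<Rightarrow> (real^'d \<Rightarrow> 'b::real_normed_vector) \<Rightarrow> bool" where
  "Ck_on 0 S h \<longleftrightarrow> continuous_on S h"
| "Ck_on (Suc m) S h \<longleftrightarrow> h differentiable_on S \<and> (\<forall>j. Ck_on m S (pd j h))"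

text \<open>Only used for open \<open>S\<close>.\<close>

definition smooth_on :: "(real^'d::finite) set \<Rightarrow> (real^'d \<Rightarrow> 'b::real_normed_vector) \<Rightarrow> bool" where
  "smooth_on S h \<longleftrightarrow> (\<forall>m. Ck_on m S h)"

text \<open>
  The operator \<open>\<partial>\<^sup>\<alpha>\<close>. The finite index type carries no order, so an enumeration of the coordinates is
  chosen once and for all; on smooth functions the choice is irrelevant, as partial derivatives commute.
\<close>

definition coords :: "'d::finite list" where
  "coords = (SOME js. distinct js \<and> set js = UNIV)"

definition mderiv ::
  "('d::finite \<Rightarrow> nat) \<Rightarrow> (real^'d \<Rightarrow> 'b::real_normed_vector) \<Rightarrow> real^'d \<Rightarrow> 'b" where
  "mderiv \<alpha> h = foldr (\<lambda>j. pd j ^^ \<alpha> j) coords h"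

definition real_analytic_on :: "(real^'d::finite) set \<Rightarrow> (real^'d \<Rightarrow> complex) \<Rightarrow> bool" where
  "real_analytic_on S h \<longleftrightarrow>
     (\<forall>q\<in>S. \<exists>c. \<exists>\<epsilon>>0. \<forall>x\<in>ball q \<epsilon> \<inter> S.
        ((\<lambda>\<alpha>. c \<alpha> * mpow (\<lambda>j. complex_of_real (x $ j - q $ j)) \<alpha>) has_sum h x) UNIV)"

definition smooth_functions :: "(real^'d::finite) set \<Rightarrow> (real^'d \<Rightarrow> complex) set" where
  "smooth_functions \<Omega> = {h. smooth_on \<Omega> h \<and> (\<forall>x. x \<notin> \<Omega> \<longrightarrow> h x = 0)}"

text \<open>Uniform convergence of all derivatives on compact sets.\<close>

definition smooth_topology :: "(real^'d::finite) set \<Rightarrow> (real^'d \<Rightarrow> complex) topology" where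
  "smooth_topology \<Omega> = topology_generated_by
     {{g \<in> smooth_functions \<Omega>. \<forall>x\<in>K. norm (mderiv \<alpha> g x - mderiv \<alpha> h x) < \<epsilon>} | h \<alpha> K \<epsilon>.
        h \<in> smooth_functions \<Omega> \<and> compact K \<and> K \<subseteq> \<Omega> \<and> \<epsilon> > 0}"

text \<open>
  The functionals \<open>\<delta>\<^sub>p\<^sup>\<alpha>\<close> on the space of smooth functions (set to zero off that space), and their span.
\<close>

definition delta ::
  "(real^'d::finite) set \<Rightarrow> real^'d \<Rightarrow> ('d \<Rightarrow> nat) \<Rightarrow> (real^'d \<Rightarrow> complex) \<Rightarrow> complex" where
  "delta \<Omega> q \<alpha> = (\<lambda>h. if h \<in> smooth_functions \<Omega> then mderiv \<alpha> h q else 0)"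

definition delta_space ::
  "(real^'d::finite) set \<Rightarrow> real^'d \<Rightarrow> ((real^'d \<Rightarrow> complex) \<Rightarrow> complex) set" where
  "delta_space \<Omega> q = module.span cscale (range (delta \<Omega> q))"

text \<open>The dual of the inclusion of \<open>H\<close>: composition with the inclusion, i.e. restriction to \<open>H\<close>.\<close>

definition dual_inclusion ::
  "('a \<Rightarrow> complex) set \<Rightarrow> (('a \<Rightarrow> complex) \<Rightarrow> complex) \<Rightarrow> ('a \<Rightarrow> complex) \<Rightarrow> complex" where
  "dual_inclusion H \<phi> = (\<lambda>h\<in>H. \<phi> h)"

definition charpoly :: "real^'d^'d::finite \<Rightarrow> complex poly" where
  "charpoly A = det (\<chi> i j. (if i = j then [:0, 1:] else 0) - [:complex_of_real (A $ i $ j):])"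

definition eigenvalues_with_mult :: "real^'d^'d::finite \<Rightarrow> ('d \<Rightarrow> complex) \<Rightarrow> bool" where
  "eigenvalues_with_mult A l \<longleftrightarrow> charpoly A = (\<Prod>j\<in>UNIV. [:- l j, 1:])"


section \<open>Reproducing kernel Hilbert spaces\<close>

definition inner_product_on ::
  "('a \<Rightarrow> complex) set \<Rightarrow> (('a \<Rightarrow> complex) \<Rightarrow> ('a \<Rightarrow> complex) \<Rightarrow> complex) \<Rightarrow> bool" where
  "inner_product_on H ip \<longleftrightarrow>
     module.subspace cscale H \<and>
     (\<forall>g\<in>H. \<forall>h\<in>H. \<forall>v\<in>H. ip (g + h) v = ip g v + ip h v) \<and>
     (\<forall>c. \<forall>h\<in>H. \<forall>v\<in>H. ip (cscale c h) v = c * ip h v) \<and>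
     (\<forall>g\<in>H. \<forall>h\<in>H. ip h g = cnj (ip g h)) \<and>
     (\<forall>h\<in>H. h \<noteq> 0 \<longrightarrow> Re (ip h h) > 0)"

text \<open>
  The distance is made trivial off \<open>H\<close>, since \<^locale>\<open>Metric_space\<close> demands nonnegativity and symmetry
  outside of the carrier, too.
\<close>

definition hdist ::
  "('a \<Rightarrow> complex) set \<Rightarrow> (('a \<Rightarrow> complex) \<Rightarrow> ('a \<Rightarrow> complex) \<Rightarrow> complex) \<Rightarrow>
   ('a \<Rightarrow> complex) \<Rightarrow> ('a \<Rightarrow> complex) \<Rightarrow> real" where
  "hdist H ip g h = (if g \<in> H \<and> h \<in> H then sqrt (Re (ip (g - h) (g - h))) else 0)"

definition hilbert_topology ::
  "('a \<Rightarrow> complex) set \<Rightarrow> (('a \<Rightarrow> complex) \<Rightarrow> ('a \<Rightarrow> complex) \<Rightarrow> complex) \<Rightarrow>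
   ('a \<Rightarrow> complex) topology" where
  "hilbert_topology H ip = Metric_space.mtopology H (hdist H ip)"

definition rkhs ::
  "'a set \<Rightarrow> ('a \<Rightarrow> complex) set \<Rightarrow> (('a \<Rightarrow> complex) \<Rightarrow> ('a \<Rightarrow> complex) \<Rightarrow> complex) \<Rightarrow>
   ('a \<Rightarrow> 'a \<Rightarrow> complex) \<Rightarrow> bool" where
  "rkhs \<Omega> H ip k \<longleftrightarrow>
     (\<forall>h\<in>H. \<forall>x. x \<notin> \<Omega> \<longrightarrow> h x = 0) \<and>
     inner_product_on H ip \<and>
     Metric_space.mcomplete H (hdist H ip) \<and>
     (\<forall>x\<in>\<Omega>. k x \<in> H \<and> (\<forall>h\<in>H. ip h (k x) = h x))"


section \<open>Composition operators and adjoints\<close>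

definition koopman :: "'a set \<Rightarrow> ('a \<Rightarrow> 'a) \<Rightarrow> ('a \<Rightarrow> complex) \<Rightarrow> 'a \<Rightarrow> complex" where
  "koopman \<Omega> f h = (\<lambda>x. if x \<in> \<Omega> then h (f x) else 0)"

definition koopman_dom ::
  "'a set \<Rightarrow> ('a \<Rightarrow> complex) set \<Rightarrow> ('a \<Rightarrow> 'a) \<Rightarrow> ('a \<Rightarrow> complex) set" where
  "koopman_dom \<Omega> H f = {h \<in> H. koopman \<Omega> f h \<in> H}"

text \<open>
  The domain and the values of the adjoint of the (possibly unbounded) operator \<open>T\<close> with domain \<open>D\<close>.
  The value is determined uniquely if \<open>D\<close> is dense.
\<close>

definition adjoint_dom ::
  "('a \<Rightarrow> complex) set \<Rightarrow> (('a \<Rightarrow> complex) \<Rightarrow> ('a \<Rightarrow> complex) \<Rightarrow> complex) \<Rightarrow>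
   ('a \<Rightarrow> complex) set \<Rightarrow> (('a \<Rightarrow> complex) \<Rightarrow> ('a \<Rightarrow> complex)) \<Rightarrow> ('a \<Rightarrow> complex) set" where
  "adjoint_dom H ip D T = {g \<in> H. \<exists>g'\<in>H. \<forall>h\<in>D. ip (T h) g = ip h g'}"

definition adjoint_op ::
  "('a \<Rightarrow> complex) set \<Rightarrow> (('a \<Rightarrow> complex) \<Rightarrow> ('a \<Rightarrow> complex) \<Rightarrow> complex) \<Rightarrow>
   ('a \<Rightarrow> complex) set \<Rightarrow> (('a \<Rightarrow> complex) \<Rightarrow> ('a \<Rightarrow> complex)) \<Rightarrow>
   ('a \<Rightarrow> complex) \<Rightarrow> 'a \<Rightarrow> complex" where
  "adjoint_op H ip D T g = (THE g'. g' \<in> H \<and> (\<forall>h\<in>D. ip (T h) g = ip h g'))"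

definition koopman_adj_dom ::
  "'a set \<Rightarrow> ('a \<Rightarrow> complex) set \<Rightarrow> (('a \<Rightarrow> complex) \<Rightarrow> ('a \<Rightarrow> complex) \<Rightarrow> complex) \<Rightarrow>
   ('a \<Rightarrow> 'a) \<Rightarrow> ('a \<Rightarrow> complex) set" where
  "koopman_adj_dom \<Omega> H ip f = adjoint_dom H ip (koopman_dom \<Omega> H f) (koopman \<Omega> f)"

definition koopman_adj ::
  "'a set \<Rightarrow> ('a \<Rightarrow> complex) set \<Rightarrow> (('a \<Rightarrow> complex) \<Rightarrow> ('a \<Rightarrow> complex) \<Rightarrow> complex) \<Rightarrow>
   ('a \<Rightarrow> 'a) \<Rightarrow> ('a \<Rightarrow> complex) \<Rightarrow> 'a \<Rightarrow> complex" where
  "koopman_adj \<Omega> H ip f = adjoint_op H ip (koopman_dom \<Omega> H f) (koopman \<Omega> f)"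


section \<open>The rigged space at finitely many points\<close>

text \<open>\<open>jet_space k q n\<close> is \<open>V\<^bsub>q,n\<^esub>\<close>; the derivatives are taken in the first argument of the kernel.\<close>

definition jet_space ::
  "(real^'d::finite \<Rightarrow> real^'d \<Rightarrow> complex) \<Rightarrow> real^'d \<Rightarrow> nat \<Rightarrow> (real^'d \<Rightarrow> complex) set" where
  "jet_space k q n =
     module.span cscale {(\<lambda>y. mderiv \<alpha> (\<lambda>x. k x y) q) | \<alpha>. msize \<alpha> \<le> n}"

definition jet_sum ::
  "(real^'d::finite \<Rightarrow> real^'d \<Rightarrow> complex) \<Rightarrow> (nat \<Rightarrow> real^'d) \<Rightarrow> nat \<Rightarrow>
   nat \<Rightarrow> (real^'d \<Rightarrow> complex) set" where
  "jet_sum k p r n = subspace_sum {1..r} (\<lambda>i. jet_space k (p i) n)"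

text \<open>
  The remaining constructions are stated for a sequence \<open>W\<close> of finite-dimensional subspaces of \<open>H\<close>
  with \<open>W n \<subseteq> W (Suc n)\<close>, and applied to \<open>W = jet_sum k p r\<close>.
\<close>

definition Phi :: "(nat \<Rightarrow> ('a \<Rightarrow> complex) set) \<Rightarrow> ('a \<Rightarrow> complex) set" where
  "Phi W = (\<Union>n. W n)"

lemma istopology_inductive_limit:
  "istopology (\<lambda>U. U \<subseteq> S \<and> (\<forall>n. openin (X n) (U \<inter> W n)))"
proof -
  have "openin (X n) (\<Union>\<K> \<inter> W n)" if "\<forall>U\<in>\<K>. \<forall>n. openin (X n) (U \<inter> W n)" for \<K> n
  proof -
    have "openin (X n) (\<Union>U\<in>\<K>. U \<inter> W n)"
      using that by blast
    moreover have "\<Union>\<K> \<inter> W n = (\<Union>U\<in>\<K>. U \<inter> W n)"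
      by blast
    ultimately show ?thesis
      by metis
  qed
  moreover have "openin (X n) (A \<inter> B \<inter> W n)"
    if "openin (X n) (A \<inter> W n)" "openin (X n) (B \<inter> W n)" for A B n
  proof -
    have "A \<inter> B \<inter> W n = (A \<inter> W n) \<inter> (B \<inter> W n)"
      by blast
    then show ?thesis
      using openin_Int[OF that] by metis
  qed
  ultimately show ?thesis
    unfolding istopology_def by (intro conjI allI impI) (simp_all add: le_infI1 Sup_le_iff)
qed

text \<open>
  The final topology of the inclusions \<open>W n \<subseteq> Phi W\<close>. For an increasing sequence of
  finite-dimensional spaces it is a locally convex vector space topology and hence agrees with the
  inductive limit in the category of locally convex spaces.
\<close>

definition Phi_topology ::
  "('a \<Rightarrow> complex) set \<Rightarrow> (('a \<Rightarrow> complex) \<Rightarrow> ('a \<Rightarrow> complex) \<Rightarrow> complex) \<Rightarrow>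
   (nat \<Rightarrow> ('a \<Rightarrow> complex) set) \<Rightarrow> ('a \<Rightarrow> complex) topology" where
  "Phi_topology H ip W = topology (\<lambda>U. U \<subseteq> Phi W \<and>
     (\<forall>n. openin (subtopology (hilbert_topology H ip) (W n)) (U \<inter> W n)))"

definition orth_proj ::
  "(('a \<Rightarrow> complex) \<Rightarrow> ('a \<Rightarrow> complex) \<Rightarrow> complex) \<Rightarrow> ('a \<Rightarrow> complex) set \<Rightarrow>
   ('a \<Rightarrow> complex) \<Rightarrow> 'a \<Rightarrow> complex" where
  "orth_proj ip V g = (THE v. v \<in> V \<and> (\<forall>u\<in>V. ip (g - v) u = 0))"

definition Phi_star ::
  "(('a \<Rightarrow> complex) \<Rightarrow> ('a \<Rightarrow> complex) \<Rightarrow> complex) \<Rightarrow>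
   (nat \<Rightarrow> ('a \<Rightarrow> complex) set) \<Rightarrow> (nat \<Rightarrow> 'a \<Rightarrow> complex) set" where
  "Phi_star ip W = {\<mu>. \<forall>n. \<mu> n \<in> W n \<and> orth_proj ip (W n) (\<mu> (Suc n)) = \<mu> n}"

definition Phi_star_topology ::
  "('a \<Rightarrow> complex) set \<Rightarrow> (('a \<Rightarrow> complex) \<Rightarrow> ('a \<Rightarrow> complex) \<Rightarrow> complex) \<Rightarrow>
   (nat \<Rightarrow> ('a \<Rightarrow> complex) set) \<Rightarrow> (nat \<Rightarrow> 'a \<Rightarrow> complex) topology" where
  "Phi_star_topology H ip W =
     subtopology
       (product_topology (\<lambda>n. subtopology (hilbert_topology H ip) (W n)) UNIV)
       (Phi_star ip W)"

definition pscale :: "complex \<Rightarrow> (nat \<Rightarrow> 'a \<Rightarrow> complex) \<Rightarrow> nat \<Rightarrow> 'a \<Rightarrow> complex" where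
  "pscale c \<mu> = (\<lambda>n. cscale c (\<mu> n))"

definition pairing ::
  "(('a \<Rightarrow> complex) \<Rightarrow> ('a \<Rightarrow> complex) \<Rightarrow> complex) \<Rightarrow>
   ('a \<Rightarrow> complex) \<Rightarrow> (nat \<Rightarrow> 'a \<Rightarrow> complex) \<Rightarrow> complex" where
  "pairing ip h \<mu> = lim (\<lambda>n. ip h (\<mu> n))"

text \<open>
  The continuous linear map on \<open>\<Phi>\<^sup>*\<close> that is dual to the adjoint of the composition operator.
\<close>

definition ext_koopman ::
  "'a set \<Rightarrow> ('a \<Rightarrow> complex) set \<Rightarrow> (('a \<Rightarrow> complex) \<Rightarrow> ('a \<Rightarrow> complex) \<Rightarrow> complex) \<Rightarrow>
   ('a \<Rightarrow> 'a) \<Rightarrow> (nat \<Rightarrow> ('a \<Rightarrow> complex) set) \<Rightarrow>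
   (nat \<Rightarrow> 'a \<Rightarrow> complex) \<Rightarrow> nat \<Rightarrow> 'a \<Rightarrow> complex" where
  "ext_koopman \<Omega> H ip f W =
     (THE T. T \<in> Phi_star ip W \<rightarrow>\<^sub>E Phi_star ip W \<and>
        (\<forall>\<mu>\<in>Phi_star ip W. \<forall>\<nu>\<in>Phi_star ip W. T (\<mu> + \<nu>) = T \<mu> + T \<nu>) \<and>
        (\<forall>c. \<forall>\<mu>\<in>Phi_star ip W. T (pscale c \<mu>) = pscale c (T \<mu>)) \<and>
        continuous_map (Phi_star_topology H ip W) (Phi_star_topology H ip W) T \<and>
        (\<forall>g\<in>Phi W. \<forall>\<mu>\<in>Phi_star ip W.
           pairing ip g (T \<mu>) = pairing ip (koopman_adj \<Omega> H ip f g) \<mu>))"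

end

theory Submission
  imports
    Defs
    "HOL-Library.Landau_Symbols"
    "HOL-Computational_Algebra.Primes"
begin

text \<open>
  Let \<open>\<ell>\<close> be linear coordinates at a fixed point \<open>p\<close> that are left eigenvectors of the Jacobian matrix.
  Then \<open>\<ell>\<^sup>\<beta> \<circ> f = \<lambda>\<^sup>\<beta> \<ell>\<^sup>\<beta>\<close> up to \<open>o(\<bar>x - p\<bar>\<^sup>n)\<close> with \<open>n = \<bar>\<beta>\<bar>\<close>. Hence, if \<open>a\<^sub>\<beta>(h)\<close> denotes the
  coefficient of \<open>\<ell>\<^sup>\<beta>\<close> in the Taylor expansion of \<open>h\<close> at \<open>p\<close>, comparing the expansions of \<open>h\<close> and \<open>h \<circ> f\<close>
  gives \<open>a\<^sub>\<gamma>(h \<circ> f) = \<lambda>\<^sup>\<gamma> a\<^sub>\<gamma>(h)\<close> plus a combination of the \<open>a\<^sub>\<beta>(h)\<close> with \<open>\<bar>\<beta>\<bar> < \<bar>\<gamma>\<bar>\<close>; no formula for the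
  higher derivatives of a composition is needed. So the adjoint acts triangularly on the Riesz
  representers of the \<open>a\<^sub>\<gamma>\<close>, with distinct diagonal entries at each point, and has an eigenbasis \<open>w\<close>.
  The \<open>w\<close> are linearly independent because the functionals \<open>a\<^sub>\<gamma>\<close> at all points are: this is seen by testing
  with \<open>\<ell>\<^sup>\<beta>\<close> times a polynomial that vanishes to high order at the other points. The family \<open>u\<close> is dual
  to \<open>w\<close>, and both expansions are eventually constant on every finite level.
\<close>

section \<open>Smooth functions\<close>

text \<open>Comparing powers of \<open>lam i\<close> at unit multi-indices shows that the
  eigenvalues at each point are distinct, which is what yields enough left eigenvectors for a
  coordinate system. They are complex in general although the Jacobian is real, so uniqueness of
  jets is needed for polynomials in complex linear forms that are known to be small at real points
  only. The test functions need not lie in \<open>H\<close>. Independence is therefore shown for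
  functionals on all smooth functions, and injectivity of the dual inclusion carries it over to the
  representers. The composition operator may be unbounded, so its adjoint is handled as a graph:
  pairs are shown to lie in the graph, and density serves to read off the value. Once the spaces
  \<open>W n\<close> are spanned by the eigenvectors of degree at most n, an element of the
  projective limit is the same as an arbitrary family of scalars, its pairings with the
  eigenvectors. The extended operator multiplies this family by the conjugated eigenvalues, so
  existence, uniqueness and continuity reduce to finite levels.\<close>

lemma vec_axis_expansion: "(\<Sum>j\<in>UNIV. v $ j *\<^sub>R axis j 1) = (v :: real^'d::finite)"
  by (simp add: vec_eq_iff axis_def if_distrib cong: if_cong)

lemma pd_eqI:
  assumes "(h has_derivative D) (at x)"
  shows "pd j h x = D (axis j 1)"
  using frechet_derivative_at[OF assms] by (simp add: pd_def)

lemma has_derivative_pd: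
  fixes h :: "real^'d::finite \<Rightarrow> 'b::real_normed_vector"
  assumes "h differentiable at x"
  shows "(h has_derivative (\<lambda>v. \<Sum>j\<in>UNIV. v $ j *\<^sub>R pd j h x)) (at x)"
proof -
  let ?D = "frechet_derivative h (at x)"
  have D: "(h has_derivative ?D) (at x)"
    using assms frechet_derivative_works by blast
  then have lin: "linear ?D"
    by (rule has_derivative_linear)
  have "?D v = (\<Sum>j\<in>UNIV. v $ j *\<^sub>R pd j h x)" for v
  proof -
    have "?D v = ?D (\<Sum>j\<in>UNIV. v $ j *\<^sub>R axis j 1)"
      by (simp add: vec_axis_expansion)
    also have "\<dots> = (\<Sum>j\<in>UNIV. v $ j *\<^sub>R ?D (axis j 1))"
      using lin by (simp add: linear_sum linear_scale)
    finally show ?thesis by (simp add: pd_def)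
  qed
  then have "?D = (\<lambda>v. \<Sum>j\<in>UNIV. v $ j *\<^sub>R pd j h x)" by blast
  with D show ?thesis by simp
qed

text \<open>\<open>frechet_derivative\<close> is a choice among candidate derivatives. The
  predicates that describe the candidates coincide for both functions, so the chosen values do too,
  even where neither function is differentiable.\<close>

lemma pd_cong:
  assumes "open S" "x \<in> S" and eq: "\<And>y. y \<in> S \<Longrightarrow> h y = g y"
  shows "pd j h x = pd j g x"
proof -
  have "(h has_derivative D) (at x) \<longleftrightarrow> (g has_derivative D) (at x)" for D
    using has_derivative_transform_within_open[OF _ assms(1,2)] eq by metis
  then show ?thesis
    by (simp add: pd_def frechet_derivative_def)
qed

text \<open>The calculus rules for \<open>pd\<close> hold only at points of S, while
  \<open>Ck_on\<close> speaks about the function \<open>pd j h\<close> as a whole. The closure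
  properties under linear maps, sums and products pass through this lemma to replace that function
  by a formula.\<close>

lemma Ck_on_cong:
  fixes h g :: "real^'d::finite \<Rightarrow> 'b::real_normed_vector"
  assumes "open S" "\<And>y. y \<in> S \<Longrightarrow> h y = g y" "Ck_on m S h"
  shows "Ck_on m S g"
  using assms(2,3)
proof (induction m arbitrary: h g)
  case 0
  then show ?case using continuous_on_cong by force
next
  case (Suc m)
  have "g differentiable_on S"
    using Suc.prems by (auto simp: differentiable_on_def intro: differentiable_transform_within[OF _ zero_less_one])
  moreover have "Ck_on m S (pd j g)" for j
    using Suc.IH[of "pd j h" "pd j g"] Suc.prems pd_cong[OF assms(1), of _ h g] by auto
  ultimately show ?case by simp
qed

lemma Ck_on_SucD: "Ck_on (Suc m) S h \<Longrightarrow> Ck_on m S h"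
proof (induction m arbitrary: h)
  case 0
  then show ?case by (simp add: differentiable_imp_continuous_on)
qed auto

lemma smooth_on_cong:
  assumes "open S" "smooth_on S h" "\<And>y. y \<in> S \<Longrightarrow> h y = g y"
  shows "smooth_on S g"
  using assms Ck_on_cong unfolding smooth_on_def by blast

lemma smooth_on_pd: "smooth_on S h \<Longrightarrow> smooth_on S (pd j h)"
  unfolding smooth_on_def by (metis Ck_on.simps(2))

lemma smooth_on_differentiable:
  "smooth_on S h \<Longrightarrow> open S \<Longrightarrow> x \<in> S \<Longrightarrow> h differentiable at x"
  unfolding smooth_on_def by (metis Ck_on.simps(2) differentiable_on_eq_differentiable_at)

lemma Ck_on_differentiable:
  "Ck_on (Suc m) S h \<Longrightarrow> open S \<Longrightarrow> x \<in> S \<Longrightarrow> h differentiable at x"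
  by (metis Ck_on.simps(2) differentiable_on_eq_differentiable_at)

section \<open>Closure properties of smooth functions\<close>

lemma pd_const: "pd j (\<lambda>x. c) = (\<lambda>x. 0)"
  by (auto simp: pd_def)

lemma smooth_on_const: "smooth_on S (\<lambda>x. c)"
proof -
  have "Ck_on m S (\<lambda>x. c)" for m
    by (induction m arbitrary: c) (auto simp: pd_const)
  then show ?thesis by (simp add: smooth_on_def)
qed

lemma pd_ident: "pd j (\<lambda>x. x) = (\<lambda>x. axis j 1)"
  by (auto simp: pd_def)

lemma smooth_on_ident: "smooth_on S (\<lambda>x. x)"
proof -
  have "Ck_on m S (\<lambda>x. x)" for m
    by (cases m) (auto simp: pd_ident smooth_on_const[unfolded smooth_on_def] differentiable_on_def)
  then show ?thesis by (simp add: smooth_on_def)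
qed

lemma pd_bounded_linear:
  assumes "bounded_linear L" "h differentiable at x"
  shows "pd j (\<lambda>x. L (h x)) x = L (pd j h x)"
  using pd_eqI[OF bounded_linear.has_derivative[OF assms(1) has_derivative_pd[OF assms(2)]], of j]
    pd_eqI[OF has_derivative_pd[OF assms(2)], of j] by simp

lemma pd_add:
  assumes "h differentiable at x" "g differentiable at x"
  shows "pd j (\<lambda>x. h x + g x) x = pd j h x + pd j g x"
  using pd_eqI[OF has_derivative_add[OF has_derivative_pd[OF assms(1)] has_derivative_pd[OF assms(2)]], of j]
    pd_eqI[OF has_derivative_pd[OF assms(1)], of j] pd_eqI[OF has_derivative_pd[OF assms(2)], of j] by simp

lemma pd_mult:
  fixes h g :: "real^'d::finite \<Rightarrow> 'b::real_normed_algebra"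
  assumes "h differentiable at x" "g differentiable at x"
  shows "pd j (\<lambda>x. h x * g x) x = h x * pd j g x + pd j h x * g x"
  using pd_eqI[OF has_derivative_mult[OF has_derivative_pd[OF assms(1)] has_derivative_pd[OF assms(2)]], of j]
    pd_eqI[OF has_derivative_pd[OF assms(1)], of j] pd_eqI[OF has_derivative_pd[OF assms(2)], of j] by simp

lemma Ck_on_bounded_linear:
  fixes h :: "real^'d::finite \<Rightarrow> 'b::real_normed_vector"
  assumes "open S" "bounded_linear L" "Ck_on m S h"
  shows "Ck_on m S (\<lambda>x. L (h x))"
  using assms(3)
proof (induction m arbitrary: h)
  case 0
  then show ?case using bounded_linear.continuous_on[OF assms(2)] by simp
next
  case (Suc m)
  have "(\<lambda>x. L (h x)) differentiable_on S"
    unfolding differentiable_on_def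
  proof
    fix x assume "x \<in> S"
    then have "h differentiable at x within S"
      using Suc.prems by (simp add: differentiable_on_def)
    then show "(\<lambda>x. L (h x)) differentiable at x within S"
      using bounded_linear.has_derivative[OF assms(2)] unfolding differentiable_def by fast
  qed
  moreover have "Ck_on m S (pd j (\<lambda>x. L (h x)))" for j
    using Ck_on_cong[OF assms(1) _ Suc.IH[of "pd j h"]] Suc.prems
      pd_bounded_linear[OF assms(2) Ck_on_differentiable[OF Suc.prems assms(1)]] by auto
  ultimately show ?case by simp
qed

lemma smooth_on_bounded_linear:
  "open S \<Longrightarrow> bounded_linear L \<Longrightarrow> smooth_on S h \<Longrightarrow> smooth_on S (\<lambda>x. L (h x))"
  unfolding smooth_on_def using Ck_on_bounded_linear by blast

lemma Ck_on_add:
  fixes h g :: "real^'d::finite \<Rightarrow> 'b::real_normed_vector"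
  assumes "open S" "Ck_on m S h" "Ck_on m S g"
  shows "Ck_on m S (\<lambda>x. h x + g x)"
  using assms(2,3)
proof (induction m arbitrary: h g)
  case 0
  then show ?case by (simp add: continuous_on_add)
next
  case (Suc m)
  have "Ck_on m S (pd j (\<lambda>x. h x + g x))" for j
    using Ck_on_cong[OF assms(1) _ Suc.IH[of "pd j h" "pd j g"]] Suc.prems
      pd_add[OF Ck_on_differentiable[OF Suc.prems(1) assms(1)] Ck_on_differentiable[OF Suc.prems(2) assms(1)]]
    by auto
  then show ?case using Suc.prems by (simp add: differentiable_on_add)
qed

lemma smooth_on_add:
  "open S \<Longrightarrow> smooth_on S h \<Longrightarrow> smooth_on S g \<Longrightarrow> smooth_on S (\<lambda>x. h x + g x)"
  unfolding smooth_on_def using Ck_on_add by blast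

lemma Ck_on_mult:
  fixes h g :: "real^'d::finite \<Rightarrow> 'b::real_normed_algebra"
  assumes "open S" "Ck_on m S h" "Ck_on m S g"
  shows "Ck_on m S (\<lambda>x. h x * g x)"
  using assms(2,3)
proof (induction m arbitrary: h g)
  case 0
  then show ?case by (simp add: continuous_on_mult)
next
  case (Suc m)
  have "Ck_on m S (pd j (\<lambda>x. h x * g x))" for j
  proof (rule Ck_on_cong[OF assms(1)])
    \<comment> \<open>In each summand of the product rule one factor is a derivative and has lost an
      order; the other factor is downgraded by \<open>Ck_on_SucD\<close>, so that the induction
      hypothesis applies to the product.\<close>
    have "Ck_on m S (pd j h)" "Ck_on m S (pd j g)"
      using Suc.prems unfolding Ck_on.simps by blast+
    then have "Ck_on m S (\<lambda>x. h x * pd j g x)" "Ck_on m S (\<lambda>x. pd j h x * g x)"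
      using Suc.IH[OF Ck_on_SucD[OF Suc.prems(1)], of "pd j g"] Suc.IH[OF _ Ck_on_SucD[OF Suc.prems(2)], of "pd j h"]
      by simp_all
    then show "Ck_on m S (\<lambda>x. h x * pd j g x + pd j h x * g x)"
      by (rule Ck_on_add[OF assms(1)])
    show "h y * pd j g y + pd j h y * g y = pd j (\<lambda>x. h x * g x) y" if "y \<in> S" for y
      using pd_mult[OF Ck_on_differentiable[OF Suc.prems(1) assms(1) that] Ck_on_differentiable[OF Suc.prems(2) assms(1) that], of j]
      by (rule sym)
  qed
  moreover have "(\<lambda>x. h x * g x) differentiable_on S"
    unfolding differentiable_on_def
  proof
    fix x assume "x \<in> S"
    then have "h differentiable at x within S" "g differentiable at x within S"
      using Suc.prems by (simp_all add: differentiable_on_def)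
    then show "(\<lambda>x. h x * g x) differentiable at x within S"
      by (rule differentiable_mult)
  qed
  ultimately show ?case unfolding Ck_on.simps by blast
qed

lemma smooth_on_mult:
  fixes h g :: "real^'d::finite \<Rightarrow> 'b::real_normed_algebra"
  shows "open S \<Longrightarrow> smooth_on S h \<Longrightarrow> smooth_on S g \<Longrightarrow> smooth_on S (\<lambda>x. h x * g x)"
  unfolding smooth_on_def using Ck_on_mult by blast

lemma smooth_on_sum:
  assumes "open S" "\<And>a. a \<in> A \<Longrightarrow> smooth_on S (h a)"
  shows "smooth_on S (\<lambda>x. \<Sum>a\<in>A. h a x)"
  using assms(2)
  by (induction A rule: infinite_finite_induct) (auto intro: smooth_on_const smooth_on_add[OF assms(1)])

lemma smooth_on_prod:
  fixes h :: "'i \<Rightarrow> real^'d::finite \<Rightarrow> 'b::real_normed_field"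
  assumes "open S" "\<And>a. a \<in> A \<Longrightarrow> smooth_on S (h a)"
  shows "smooth_on S (\<lambda>x. \<Prod>a\<in>A. h a x)"
  using assms(2)
  by (induction A rule: infinite_finite_induct) (auto intro: smooth_on_const smooth_on_mult[OF assms(1)])

lemma smooth_on_power:
  fixes h :: "real^'d::finite \<Rightarrow> 'b::real_normed_field"
  assumes "open S" "smooth_on S h"
  shows "smooth_on S (\<lambda>x. h x ^ n)"
  by (induction n) (auto intro: smooth_on_const smooth_on_mult assms)

lemma smooth_on_mpow:
  fixes z :: "real^'d::finite \<Rightarrow> 'j::finite \<Rightarrow> 'b::real_normed_field"
  assumes "open S" "\<And>j. smooth_on S (\<lambda>x. z x j)"
  shows "smooth_on S (\<lambda>x. mpow (z x) \<beta>)"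
  unfolding mpow_def by (intro smooth_on_prod smooth_on_power assms)

lemma smooth_on_component:
  fixes f :: "real^'d::finite \<Rightarrow> real^'d"
  assumes "open S" "smooth_on S f"
  shows "smooth_on S (\<lambda>x. complex_of_real (f x $ j))"
  by (rule smooth_on_bounded_linear[OF assms(1) bounded_linear_compose[OF bounded_linear_of_real bounded_linear_vec_nth] assms(2)])

lemma smooth_functions_restrict:
  assumes "open S" "smooth_on S h"
  shows "(\<lambda>x. if x \<in> S then h x else 0) \<in> smooth_functions S"
  using smooth_on_cong[OF assms] by (auto simp: smooth_functions_def)


subsection \<open>Iterated partial derivatives\<close>

lemma foldr_pd_smooth_on: "smooth_on S h \<Longrightarrow> smooth_on S (foldr pd J h)"
  by (induction J) (auto intro: smooth_on_pd)

lemma foldr_pd_cong: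
  assumes "open S" "\<And>y. y \<in> S \<Longrightarrow> h y = g y" "x \<in> S"
  shows "foldr pd J h x = foldr pd J g x"
  using assms(3)
proof (induction J arbitrary: x)
  case (Cons j J)
  then show ?case
    using pd_cong[OF assms(1) Cons.prems Cons.IH] by simp
qed (simp add: assms(2))

lemma foldr_pd_add:
  assumes "open S" "smooth_on S h" "smooth_on S g" "x \<in> S"
  shows "foldr pd J (\<lambda>x. h x + g x) x = foldr pd J h x + foldr pd J g x"
  using assms(4)
proof (induction J arbitrary: x)
  case (Cons j J)
  have "foldr pd (j # J) (\<lambda>x. h x + g x) x = pd j (\<lambda>x. foldr pd J h x + foldr pd J g x) x"
    using pd_cong[OF assms(1) Cons.prems Cons.IH] by simp
  also have "\<dots> = foldr pd (j # J) h x + foldr pd (j # J) g x"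
    using pd_add[OF smooth_on_differentiable[OF foldr_pd_smooth_on[OF assms(2)] assms(1) Cons.prems]
        smooth_on_differentiable[OF foldr_pd_smooth_on[OF assms(3)] assms(1) Cons.prems]] by simp
  finally show ?case .
qed simp

lemma foldr_pd_bounded_linear:
  assumes "open S" "bounded_linear L" "smooth_on S h" "x \<in> S"
  shows "foldr pd J (\<lambda>x. L (h x)) x = L (foldr pd J h x)"
  using assms(4)
proof (induction J arbitrary: x)
  case (Cons j J)
  have "foldr pd (j # J) (\<lambda>x. L (h x)) x = pd j (\<lambda>x. L (foldr pd J h x)) x"
    using pd_cong[OF assms(1) Cons.prems Cons.IH] by simp
  also have "\<dots> = L (foldr pd (j # J) h x)"
    using pd_bounded_linear[OF assms(2) smooth_on_differentiable[OF foldr_pd_smooth_on[OF assms(3)] assms(1) Cons.prems]]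
    by simp
  finally show ?case .
qed simp

text \<open>The symmetric second difference approximates t^2 times a mixed derivative. The mean
  value inequality in direction i reduces it to a difference of values of \<open>pd i h\<close>, for
  which differentiability at x is enough.\<close>

lemma mixed_difference_quotient:
  fixes h :: "real^'d::finite \<Rightarrow> 'b::real_normed_vector"
  assumes "open S" "x \<in> S" "\<And>y. y \<in> S \<Longrightarrow> h differentiable at y" "pd i h differentiable at x" "\<epsilon> > 0"
  obtains \<delta> where "\<delta> > 0"
    "\<And>t. 0 < t \<Longrightarrow> t < \<delta> \<Longrightarrow>
      norm (h (x + t *\<^sub>R axis i 1 + t *\<^sub>R axis j 1) - h (x + t *\<^sub>R axis i 1) - (h (x + t *\<^sub>R axis j 1) - h x)
        - (t * t) *\<^sub>R pd j (pd i h) x) \<le> \<epsilon> * (t * t)"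
proof -
  let ?D = "\<lambda>v. \<Sum>k\<in>UNIV. v $ k *\<^sub>R pd k (pd i h) x"
  let ?ei = "axis i 1 :: real^'d" and ?ej = "axis j 1 :: real^'d"
  have Dh: "(pd i h has_derivative ?D) (at x)"
    by (rule has_derivative_pd[OF assms(4)])
  then have linD: "linear ?D" by (rule has_derivative_linear)
  have Dej: "?D ?ej = pd j (pd i h) x"
    using pd_eqI[OF Dh, of j] by simp
  from Dh obtain \<delta>1 where \<delta>1: "\<delta>1 > 0"
    "\<And>y. norm (y - x) < \<delta>1 \<Longrightarrow> norm (pd i h y - pd i h x - ?D (y - x)) \<le> \<epsilon>/3 * norm (y - x)"
  proof -
    \<comment> \<open>The two points compared later lie at distance at most 2t and t from x, so the
      errors add up to 2/3 + 1/3 of \<epsilon> t.\<close>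
    have "\<epsilon> / 3 > 0" using assms(5) by simp
    with Dh show thesis
      unfolding has_derivative_at_alt using that by blast
  qed
  from assms(1,2) obtain \<delta>2 where \<delta>2: "\<delta>2 > 0" "ball x \<delta>2 \<subseteq> S"
    using openE by blast
  \<comment> \<open>Half the radius, because the corner point is displaced by up to 2t.\<close>
  define \<delta> where "\<delta> = min \<delta>1 \<delta>2 / 2"
  have "\<delta> > 0" using \<delta>1 \<delta>2 by (simp add: \<delta>_def)
  moreover have "norm (h (x + t *\<^sub>R ?ei + t *\<^sub>R ?ej) - h (x + t *\<^sub>R ?ei) - (h (x + t *\<^sub>R ?ej) - h x)
        - (t * t) *\<^sub>R pd j (pd i h) x) \<le> \<epsilon> * (t * t)" if t: "0 < t" "t < \<delta>" for t
  proof -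
    let ?c = "pd j (pd i h) x"
    let ?y = "\<lambda>s. x + s *\<^sub>R ?ei + t *\<^sub>R ?ej" and ?z = "\<lambda>s. x + s *\<^sub>R ?ei"
    \<comment> \<open>The increment in direction j as a function of the displacement s in direction
      i, minus the linear term expected from the mixed derivative; its change between 0 and t is the
      quantity to be estimated.\<close>
    define G where "G s = h (?y s) - h (?z s) - s *\<^sub>R (t *\<^sub>R ?c)" for s
    define G' where "G' s = pd i h (?y s) - pd i h (?z s) - t *\<^sub>R ?c" for s
    have n1: "norm (s *\<^sub>R ?ei + t *\<^sub>R ?ej) \<le> 2 * t" "norm (s *\<^sub>R ?ei) \<le> t" if "s \<in> {0..t}" for s
      using that norm_triangle_ineq[of "s *\<^sub>R ?ei" "t *\<^sub>R ?ej"] t by auto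
    have inS: "?y s \<in> S" "?z s \<in> S" if "s \<in> {0..t}" for s
    proof -
      have "?y s \<in> ball x \<delta>2" "?z s \<in> ball x \<delta>2"
        using n1[OF that] t by (auto simp: dist_norm \<delta>_def norm_minus_commute algebra_simps min_def split: if_splits)
      with \<delta>2 show "?y s \<in> S" "?z s \<in> S" by auto
    qed
    have comp: "((\<lambda>s. h (x + s *\<^sub>R ?ei + w)) has_derivative (\<lambda>r. r *\<^sub>R pd i h (x + s *\<^sub>R ?ei + w))) (at s within {0..t})"
      if "x + s *\<^sub>R ?ei + w \<in> S" for s w
    proof -
      have h: "(h has_derivative (\<lambda>v. \<Sum>k\<in>UNIV. v $ k *\<^sub>R pd k h (x + s *\<^sub>R ?ei + w))) (at (x + s *\<^sub>R ?ei + w))"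
        by (rule has_derivative_pd[OF assms(3)[OF that]])
      have "((\<lambda>s. x + s *\<^sub>R ?ei + w) has_derivative (\<lambda>r. r *\<^sub>R ?ei)) (at s within {0..t})"
        by (auto intro!: derivative_eq_intros)
      from has_derivative_compose[OF this h]
      have "((\<lambda>s. h (x + s *\<^sub>R ?ei + w)) has_derivative
        (\<lambda>r. \<Sum>k\<in>UNIV. (r *\<^sub>R ?ei) $ k *\<^sub>R pd k h (x + s *\<^sub>R ?ei + w))) (at s within {0..t})" .
      moreover have "(\<Sum>k\<in>UNIV. (r *\<^sub>R ?ei) $ k *\<^sub>R pd k h (x + s *\<^sub>R ?ei + w)) = r *\<^sub>R pd i h (x + s *\<^sub>R ?ei + w)" for r
        by (simp add: axis_def if_distrib[of "\<lambda>c. _ * c"] if_distrib[of "\<lambda>c. c *\<^sub>R _"] cong: if_cong)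
      ultimately show ?thesis by simp
    qed
    have der: "(G has_derivative (\<lambda>r. r *\<^sub>R G' s)) (at s within {0..t})" if "s \<in> {0..t}" for s
    proof -
      have "(G has_derivative (\<lambda>r. r *\<^sub>R pd i h (?y s) - r *\<^sub>R pd i h (?z s)
         - r *\<^sub>R (t *\<^sub>R ?c))) (at s within {0..t})"
        unfolding G_def
        using comp[of s "t *\<^sub>R ?ej"] comp[of s 0] inS[OF that]
        by (intro has_derivative_diff has_derivative_scaleR_left has_derivative_ident) auto
      then show ?thesis by (simp add: G'_def algebra_simps)
    qed
    have bd: "norm (G' s) \<le> \<epsilon> * t" if "s \<in> {0..t}" for s
    proof -
      have a: "norm (pd i h (?y s) - pd i h x - ?D (s *\<^sub>R ?ei + t *\<^sub>R ?ej)) \<le> \<epsilon>/3 * norm (s *\<^sub>R ?ei + t *\<^sub>R ?ej)"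
        using \<delta>1(2)[of "?y s"] n1[OF that] t by (simp add: \<delta>_def add.assoc)
      have b: "norm (pd i h (?z s) - pd i h x - ?D (s *\<^sub>R ?ei)) \<le> \<epsilon>/3 * norm (s *\<^sub>R ?ei)"
        using \<delta>1(2)[of "?z s"] n1[OF that] t by (simp add: \<delta>_def)
      have D: "?D (s *\<^sub>R ?ei + t *\<^sub>R ?ej) = ?D (s *\<^sub>R ?ei) + t *\<^sub>R ?c"
        using linear_add[OF linD] linear_scale[OF linD, of t ?ej] unfolding Dej by presburger
      have "G' s = (pd i h (?y s) - pd i h x - ?D (s *\<^sub>R ?ei + t *\<^sub>R ?ej))
          - (pd i h (?z s) - pd i h x - ?D (s *\<^sub>R ?ei))"
        unfolding G'_def D by (simp only: algebra_simps)
      then have "norm (G' s) \<le> \<epsilon>/3 * norm (s *\<^sub>R ?ei + t *\<^sub>R ?ej) + \<epsilon>/3 * norm (s *\<^sub>R ?ei)"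
        using order_trans[OF norm_triangle_ineq4 add_mono[OF a b]] by simp
      also have "\<dots> \<le> \<epsilon>/3 * (2 * t) + \<epsilon>/3 * t"
        using n1[OF that] assms(5) by (intro add_mono mult_left_mono) auto
      finally show ?thesis by simp
    qed
    have "norm (G t - G 0) \<le> (\<epsilon> * t) * norm (t - 0)"
      by (rule differentiable_bound[of "{0..t}" G "\<lambda>s r. r *\<^sub>R G' s"])
         (use der bd t in \<open>auto simp: mult.commute intro!: onorm_le mult_left_mono\<close>)
    moreover have "G t - G 0 = h (x + t *\<^sub>R ?ei + t *\<^sub>R ?ej) - h (x + t *\<^sub>R ?ei) - (h (x + t *\<^sub>R ?ej) - h x)
        - (t * t) *\<^sub>R ?c"
      by (simp add: G_def)
    ultimately show ?thesis using t by (simp add: mult.assoc)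
  qed
  ultimately show thesis by (rule that)
qed

text \<open>Both mixed derivatives approximate the same second difference, with errors of at most
  \<epsilon> t^2. With a quarter of their distance as \<epsilon>, that distance would be at most
  half of itself.\<close>

lemma pd_commute:
  fixes h :: "real^'d::finite \<Rightarrow> 'b::real_normed_vector"
  assumes "open S" "smooth_on S h" "x \<in> S"
  shows "pd i (pd j h) x = pd j (pd i h) x"
proof (rule ccontr)
  let ?a = "pd i (pd j h) x" and ?b = "pd j (pd i h) x"
  assume ne: "?a \<noteq> ?b"
  define \<epsilon> where "\<epsilon> = norm (?a - ?b) / 4"
  have \<epsilon>: "\<epsilon> > 0" using ne by (simp add: \<epsilon>_def)
  have diff: "\<And>y. y \<in> S \<Longrightarrow> h differentiable at y" "\<And>i. pd i h differentiable at x"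
    using assms smooth_on_differentiable smooth_on_pd by blast+
  obtain \<delta>1 where 1: "\<delta>1 > 0" "\<And>t. 0 < t \<Longrightarrow> t < \<delta>1 \<Longrightarrow>
      norm (h (x + t *\<^sub>R axis i 1 + t *\<^sub>R axis j 1) - h (x + t *\<^sub>R axis i 1) - (h (x + t *\<^sub>R axis j 1) - h x)
        - (t * t) *\<^sub>R ?b) \<le> \<epsilon> * (t * t)"
    using mixed_difference_quotient[OF assms(1,3) diff \<epsilon>, where i=i and j=j] by blast
  obtain \<delta>2 where 2: "\<delta>2 > 0" "\<And>t. 0 < t \<Longrightarrow> t < \<delta>2 \<Longrightarrow>
      norm (h (x + t *\<^sub>R axis j 1 + t *\<^sub>R axis i 1) - h (x + t *\<^sub>R axis j 1) - (h (x + t *\<^sub>R axis i 1) - h x)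
        - (t * t) *\<^sub>R ?a) \<le> \<epsilon> * (t * t)"
    using mixed_difference_quotient[OF assms(1,3) diff \<epsilon>, where i=j and j=i] by blast
  define t where "t = min \<delta>1 \<delta>2 / 2"
  have t: "0 < t" "t < \<delta>1" "t < \<delta>2" using 1(1) 2(1) by (auto simp: t_def)
  let ?X = "h (x + t *\<^sub>R axis i 1 + t *\<^sub>R axis j 1) - h (x + t *\<^sub>R axis i 1) - (h (x + t *\<^sub>R axis j 1) - h x)"
  have X: "h (x + t *\<^sub>R axis j 1 + t *\<^sub>R axis i 1) - h (x + t *\<^sub>R axis j 1) - (h (x + t *\<^sub>R axis i 1) - h x) = ?X"
    by (simp add: algebra_simps)
  have "norm ((t * t) *\<^sub>R (?a - ?b)) = norm ((?X - (t * t) *\<^sub>R ?b) - (?X - (t * t) *\<^sub>R ?a))"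
    by (simp add: algebra_simps)
  also have "\<dots> \<le> \<epsilon> * (t * t) + \<epsilon> * (t * t)"
    by (rule order_trans[OF norm_triangle_ineq4 add_mono[OF 1(2)[OF t(1,2)] 2(2)[OF t(1,3), unfolded X]]])
  also have "\<dots> < (t * t) * norm (?a - ?b)"
    using t ne by (simp add: \<epsilon>_def)
  finally show False using t by simp
qed

lemma foldr_pd_shift:
  assumes "open S" "smooth_on S h" "x \<in> S"
  shows "foldr pd J (pd j h) x = pd j (foldr pd J h) x"
  using assms(3)
proof (induction J arbitrary: x)
  case (Cons i J)
  have "foldr pd (i # J) (pd j h) x = pd i (pd j (foldr pd J h)) x"
    using pd_cong[OF assms(1) Cons.prems Cons.IH] by simp
  also have "\<dots> = pd j (foldr pd (i # J) h) x"
    using pd_commute[OF assms(1) foldr_pd_smooth_on[OF assms(2)] Cons.prems] by simp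
  finally show ?case .
qed simp

text \<open>A derivative taken innermost has to be moved to its place in the order prescribed by
  \<open>coords\<close>. Independence of the order is what lets multi-indices be incremented in
  \<open>mderiv_pd\<close>.\<close>

lemma foldr_pd_mset:
  fixes h :: "real^'d::finite \<Rightarrow> 'b::real_normed_vector"
  assumes "open S" "smooth_on S h" "x \<in> S" "mset J = mset J'"
  shows "foldr pd J h x = foldr pd J' h x"
  using assms(3,4)
proof (induction J arbitrary: J' x)
  case (Cons i J)
  then obtain A B where J': "J' = A @ i # B"
    by (metis in_set_conv_decomp list.set_intros(1) mset_eq_setD)
  with Cons.prems have "mset J = mset (A @ B)" by simp
  then have "foldr pd J h y = foldr pd A (foldr pd B h) y" if "y \<in> S" for y
    using Cons.IH[OF that, of "A @ B"] by simp
  from pd_cong[OF assms(1) Cons.prems(1) this]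
  have "foldr pd (i # J) h x = pd i (foldr pd A (foldr pd B h)) x"
    by simp
  then show ?case
    using foldr_pd_shift[OF assms(1) foldr_pd_smooth_on[OF assms(2)] Cons.prems(1), of A i B] by (simp add: J')
qed simp

section \<open>Multi-indices as lists of coordinates\<close>

definition multi_list :: "('d::finite \<Rightarrow> nat) \<Rightarrow> 'd list" where
  "multi_list \<alpha> = concat (map (\<lambda>j. replicate (\<alpha> j) j) coords)"

lemma coords: "distinct (coords :: 'd::finite list)" "set (coords :: 'd list) = UNIV"
proof -
  have "\<exists>js :: 'd list. distinct js \<and> set js = UNIV"
    using finite_distinct_list[of "UNIV :: 'd set"] by auto
  from someI_ex[OF this] show "distinct (coords :: 'd list)" "set (coords :: 'd list) = UNIV"
    by (auto simp: coords_def)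
qed

lemma mset_multi_list: "count (mset (multi_list \<alpha>)) j = \<alpha> j"
proof -
  have "count (mset (concat (map (\<lambda>j. replicate (\<alpha> j) j) js))) j = (if j \<in> set js then \<alpha> j else 0)"
    if "distinct js" for js
    using that by (induction js) auto
  from this[OF coords(1)] show ?thesis by (simp add: multi_list_def coords(2))
qed

lemma mderiv_eq_foldr: "mderiv \<alpha> h = foldr pd (multi_list \<alpha>) h"
proof -
  have "foldr pd (replicate n j) g = (pd j ^^ n) g" for n j and g :: "real^'a \<Rightarrow> 'b"
    by (induction n) auto
  then have "foldr (\<lambda>j. pd j ^^ \<alpha> j) js h = foldr pd (concat (map (\<lambda>j. replicate (\<alpha> j) j) js)) h" for js
    by (induction js) auto
  then show ?thesis by (simp add: mderiv_def multi_list_def)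
qed

lemma mderiv_pd:
  assumes "open S" "smooth_on S h" "x \<in> S"
  shows "mderiv \<alpha> (pd j h) x = mderiv (\<alpha>(j := Suc (\<alpha> j))) h x"
proof -
  have "mset (multi_list \<alpha> @ [j]) = mset (multi_list (\<alpha>(j := Suc (\<alpha> j))))"
    by (rule multiset_eqI) (simp add: mset_multi_list)
  from foldr_pd_mset[OF assms this] show ?thesis
    by (simp add: mderiv_eq_foldr)
qed

lemma mderiv_cong:
  assumes "open S" "\<And>y. y \<in> S \<Longrightarrow> h y = g y" "x \<in> S"
  shows "mderiv \<alpha> h x = mderiv \<alpha> g x"
  using foldr_pd_cong[OF assms] by (simp add: mderiv_eq_foldr)

lemma mderiv_add:
  assumes "open S" "smooth_on S h" "smooth_on S g" "x \<in> S"
  shows "mderiv \<alpha> (\<lambda>x. h x + g x) x = mderiv \<alpha> h x + mderiv \<alpha> g x"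
  using foldr_pd_add[OF assms] by (simp add: mderiv_eq_foldr)

lemma mderiv_bounded_linear:
  assumes "open S" "bounded_linear L" "smooth_on S h" "x \<in> S"
  shows "mderiv \<alpha> (\<lambda>x. L (h x)) x = L (mderiv \<alpha> h x)"
  using foldr_pd_bounded_linear[OF assms] by (simp add: mderiv_eq_foldr)

lemma mderiv_0: "mderiv (\<lambda>_. 0) h = h"
proof -
  have "foldr (\<lambda>j. pd j ^^ 0) js h = h" for js
    by (induction js) auto
  then show ?thesis by (simp add: mderiv_def)
qed

section \<open>Order of multi-indices\<close>

lemma msize_upd: "msize (\<alpha>(j := Suc (\<alpha> j))) = Suc (msize \<alpha>)"
  unfolding msize_def by (subst (1 2) sum.remove[of UNIV j]) simp_all

lemma finite_msize_le: "finite {\<alpha> :: 'd::finite \<Rightarrow> nat. msize \<alpha> \<le> n}"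
proof -
  have "{\<alpha> :: 'd \<Rightarrow> nat. msize \<alpha> \<le> n} \<subseteq> (UNIV :: 'd set) \<rightarrow>\<^sub>E {..n}"
  proof
    fix \<alpha> :: "'d \<Rightarrow> nat" assume "\<alpha> \<in> {\<alpha>. msize \<alpha> \<le> n}"
    then have "\<alpha> j \<le> n" for j
      using member_le_sum[of j UNIV \<alpha>] unfolding msize_def mem_Collect_eq
      by (meson UNIV_I finite order_trans zero_le)
    then show "\<alpha> \<in> UNIV \<rightarrow>\<^sub>E {..n}" by auto
  qed
  then show ?thesis by (rule finite_subset) (auto intro: finite_PiE)
qed

lemma finite_msize_eq: "finite {\<alpha> :: 'd::finite \<Rightarrow> nat. msize \<alpha> = n}"
  by (rule finite_subset[OF _ finite_msize_le[of n]]) auto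

lemma finite_msize_less: "finite {\<alpha> :: 'd::finite \<Rightarrow> nat. msize \<alpha> < n}"
  by (rule finite_subset[OF _ finite_msize_le[of n]]) auto


section \<open>Polynomials and jets\<close>

text \<open>Real displacements are read as complex vectors, because the linear coordinates at a
  fixed point have complex coefficients when the Jacobian has nonreal eigenvalues.\<close>

definition cvec :: "real^'d::finite \<Rightarrow> 'd \<Rightarrow> complex" where
  "cvec v = (\<lambda>j. complex_of_real (v $ j))"

definition lin_form :: "('d::finite \<Rightarrow> 'd \<Rightarrow> complex) \<Rightarrow> ('d \<Rightarrow> complex) \<Rightarrow> 'd \<Rightarrow> complex" where
  "lin_form \<omega> z = (\<lambda>j. \<Sum>k\<in>UNIV. \<omega> j k * z k)"

text \<open>Complex-valued, since the Landau symbols demand a common codomain. Remainders are taken along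
  \<^term>\<open>nhds p\<close> instead of \<^term>\<open>at p\<close>, because they get composed with \<open>f\<close>, which may take the value \<open>p\<close>
  away from \<open>p\<close>.\<close>

definition rad :: "real^'d::finite \<Rightarrow> real^'d \<Rightarrow> complex" where
  "rad p x = complex_of_real (norm (x - p))"

definition mfact :: "('d::finite \<Rightarrow> nat) \<Rightarrow> complex" where
  "mfact \<alpha> = (\<Prod>j\<in>UNIV. fact (\<alpha> j))"

definition taylor_coeff :: "('d::finite \<Rightarrow> nat) \<Rightarrow> (real^'d \<Rightarrow> complex) \<Rightarrow> real^'d \<Rightarrow> complex" where
  "taylor_coeff \<alpha> h p = mderiv \<alpha> h p / mfact \<alpha>"

lemma mfact_nonzero: "mfact \<alpha> \<noteq> 0"
  by (simp add: mfact_def)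

lemma mfact_Suc: "mfact (\<alpha>(j := Suc (\<alpha> j))) = of_nat (Suc (\<alpha> j)) * mfact \<alpha>"
proof -
  have "mfact (\<alpha>(j := Suc (\<alpha> j))) = fact (Suc (\<alpha> j)) * (\<Prod>i\<in>UNIV-{j}. fact (\<alpha> i))"
    unfolding mfact_def by (subst prod.remove[of UNIV j]) auto
  moreover have "mfact \<alpha> = fact (\<alpha> j) * (\<Prod>i\<in>UNIV-{j}. fact (\<alpha> i))"
    unfolding mfact_def by (subst prod.remove[of UNIV j]) auto
  ultimately show ?thesis by simp
qed

lemma mpow_Suc: "mpow z (\<alpha>(j := Suc (\<alpha> j))) = z j * mpow z \<alpha>"
proof -
  have "mpow z (\<alpha>(j := Suc (\<alpha> j))) = z j ^ Suc (\<alpha> j) * (\<Prod>i\<in>UNIV-{j}. z i ^ \<alpha> i)"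
    unfolding mpow_def by (subst prod.remove[of UNIV j]) auto
  moreover have "mpow z \<alpha> = z j ^ \<alpha> j * (\<Prod>i\<in>UNIV-{j}. z i ^ \<alpha> i)"
    unfolding mpow_def by (subst prod.remove[of UNIV j]) auto
  ultimately show ?thesis by (simp add: mult.assoc)
qed

lemma mpow_scale: "mpow (\<lambda>j. a * z j) \<beta> = a ^ msize \<beta> * mpow z \<beta>"
  by (simp add: mpow_def msize_def power_mult_distrib prod.distrib power_sum)

lemma mpow_power: "mpow (\<lambda>j. z j ^ s) \<beta> = mpow z \<beta> ^ s"
  by (simp add: mpow_def prod_power_distrib power_mult[symmetric] mult.commute)

lemma msize_eq_0: "msize \<alpha> = 0 \<longleftrightarrow> \<alpha> = (\<lambda>_. 0)"
  by (auto simp: msize_def)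

lemma mpow_at_0: "mpow (\<lambda>_. 0) \<alpha> = (if \<alpha> = (\<lambda>_. 0) then 1 else (0::complex))"
  by (auto simp: mpow_def fun_eq_iff power_0_left)

lemma has_derivative_mpow_cvec:
  "((\<lambda>x. mpow (cvec (x - p)) \<alpha>) has_derivative
    (\<lambda>v. \<Sum>j\<in>UNIV. complex_of_real (v $ j) * (of_nat (\<alpha> j) * mpow (cvec (x - p)) (\<alpha>(j := \<alpha> j - 1))))) (at x)"
proof -
  have c: "((\<lambda>x. cvec (x - p) j) has_derivative (\<lambda>v. complex_of_real (v $ j))) (at x)" for j
  proof -
    have bl: "bounded_linear (\<lambda>v :: real^'a. complex_of_real (v $ j))"
      by (rule bounded_linear_compose[OF bounded_linear_of_real bounded_linear_vec_nth])
    have "((\<lambda>x. x - p) has_derivative (\<lambda>v. v)) (at x)"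
      by (auto intro!: derivative_eq_intros)
    from bounded_linear.has_derivative[OF bl this] show ?thesis
      by (simp add: cvec_def)
  qed
  have "((\<lambda>x. \<Prod>j\<in>UNIV. cvec (x - p) j ^ \<alpha> j) has_derivative
     (\<lambda>v. \<Sum>j\<in>UNIV. of_nat (\<alpha> j) * complex_of_real (v $ j) * cvec (x - p) j ^ (\<alpha> j - 1)
        * (\<Prod>k\<in>UNIV-{j}. cvec (x - p) k ^ \<alpha> k))) (at x)"
    by (rule has_derivative_prod) (rule has_derivative_power[OF c])
  moreover have "mpow (cvec (x - p)) (\<alpha>(j := \<alpha> j - 1))
     = cvec (x - p) j ^ (\<alpha> j - 1) * (\<Prod>k\<in>UNIV-{j}. cvec (x - p) k ^ \<alpha> k)" for j
    unfolding mpow_def by (subst prod.remove[of UNIV j]) auto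
  ultimately show ?thesis
    by (simp add: mpow_def mult_ac)
qed

text \<open>Substitution of \<gamma> plus the j-th unit multi-index for \<alpha>. The first version
  serves the differentiation of a Taylor polynomial, the second one the multiplication of a
  homogeneous polynomial by a coordinate.\<close>

lemma sum_msize_shift:
  fixes F :: "('d::finite \<Rightarrow> nat) \<Rightarrow> 'b::comm_monoid_add"
  assumes "\<And>\<alpha>. \<alpha> j = 0 \<Longrightarrow> F \<alpha> = 0"
  shows "(\<Sum>\<alpha> | msize \<alpha> \<le> Suc n. F \<alpha>) = (\<Sum>\<gamma> | msize \<gamma> \<le> n. F (\<gamma>(j := Suc (\<gamma> j))))"
    and "(\<Sum>\<alpha> | msize \<alpha> = Suc n. F \<alpha>) = (\<Sum>\<gamma> | msize \<gamma> = n. F (\<gamma>(j := Suc (\<gamma> j))))"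
proof -
  have sz: "msize (\<alpha>(j := \<alpha> j - Suc 0)) = msize \<alpha> - Suc 0" if "0 < \<alpha> j" for \<alpha> :: "'d \<Rightarrow> nat"
    using msize_upd[of "\<alpha>(j := \<alpha> j - Suc 0)" j] that by simp
  have "(\<Sum>\<alpha> | msize \<alpha> \<le> Suc n. F \<alpha>) = (\<Sum>\<alpha> | msize \<alpha> \<le> Suc n \<and> \<alpha> j \<noteq> 0. F \<alpha>)"
    using assms by (intro sum.mono_neutral_right finite_msize_le) auto
  also have "\<dots> = (\<Sum>\<gamma> | msize \<gamma> \<le> n. F (\<gamma>(j := Suc (\<gamma> j))))"
    by (rule sum.reindex_bij_witness[where i = "\<lambda>\<gamma>. \<gamma>(j := Suc (\<gamma> j))" and j = "\<lambda>\<alpha>. \<alpha>(j := \<alpha> j - 1)"])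
       (auto simp: sz msize_upd)
  finally show "(\<Sum>\<alpha> | msize \<alpha> \<le> Suc n. F \<alpha>) = (\<Sum>\<gamma> | msize \<gamma> \<le> n. F (\<gamma>(j := Suc (\<gamma> j))))" .
  have "(\<Sum>\<alpha> | msize \<alpha> = Suc n. F \<alpha>) = (\<Sum>\<alpha> | msize \<alpha> = Suc n \<and> \<alpha> j \<noteq> 0. F \<alpha>)"
    using assms by (intro sum.mono_neutral_right finite_msize_eq) auto
  also have "\<dots> = (\<Sum>\<gamma> | msize \<gamma> = n. F (\<gamma>(j := Suc (\<gamma> j))))"
    by (rule sum.reindex_bij_witness[where i = "\<lambda>\<gamma>. \<gamma>(j := Suc (\<gamma> j))" and j = "\<lambda>\<alpha>. \<alpha>(j := \<alpha> j - 1)"])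
       (auto simp: sz msize_upd)
  finally show "(\<Sum>\<alpha> | msize \<alpha> = Suc n. F \<alpha>) = (\<Sum>\<gamma> | msize \<gamma> = n. F (\<gamma>(j := Suc (\<gamma> j))))" .
qed

text \<open>Induction on the order through the gradient: the partial derivatives of the remainder of
  order n + 1 of h are the remainders of order n of \<open>pd j h\<close>, and the mean value
  inequality adds one factor |x - p| to their bound.\<close>

theorem taylor_peano:
  fixes h :: "real^'d::finite \<Rightarrow> complex"
  assumes "open S" "p \<in> S" "smooth_on S h"
  shows "(\<lambda>x. h x - (\<Sum>\<alpha> | msize \<alpha> \<le> n. taylor_coeff \<alpha> h p * mpow (cvec (x - p)) \<alpha>))
    \<in> o[nhds p](\<lambda>x. rad p x ^ n)"
  using assms(3)
proof (induction n arbitrary: h)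
  case 0
  have "isCont h p"
    using smooth_on_differentiable[OF 0 assms(1,2)] differentiable_imp_continuous_within by blast
  then have "((\<lambda>x. h x - h p) \<longlongrightarrow> 0) (nhds p)"
    unfolding isCont_def by (auto simp: tendsto_at_iff_tendsto_nhds LIM_zero_iff intro: LIM_zero)
  then have "eventually (\<lambda>x. norm (h x - h p) \<le> c) (nhds p)" if "c > 0" for c
    using that by (auto simp: tendsto_iff elim!: allE[of _ c] eventually_mono)
  then show ?case
    by (intro landau_o.smallI) (simp add: msize_eq_0 taylor_coeff_def mderiv_0 mfact_def mpow_def)
next
  case (Suc n)
  let ?T = "\<lambda>m g x. \<Sum>\<alpha> | msize \<alpha> \<le> m. taylor_coeff \<alpha> g p * mpow (cvec (x - p)) \<alpha>"
  show ?case
  proof (rule landau_o.smallI)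
    fix c :: real assume c: "c > 0"
    let ?R = "\<lambda>j x. pd j h x - ?T n (pd j h) x"
    \<comment> \<open>One share of c for each of the partial derivatives that make up the
      differential.\<close>
    let ?e = "c / CARD('d)"
    have "?e > 0" using c by simp
    then have "eventually (\<lambda>x. norm (?R j x) \<le> ?e * norm (rad p x ^ n)) (nhds p)" for j
      using landau_o.smallD[OF Suc.IH[OF smooth_on_pd[OF Suc.prems, of j]]] by blast
    then have "eventually (\<lambda>x. \<forall>j. norm (?R j x) \<le> ?e * norm (rad p x ^ n)) (nhds p)"
      by (rule eventually_all_finite)
    moreover have "eventually (\<lambda>x. x \<in> S) (nhds p)"
      using assms(1,2) by (rule eventually_nhds_in_open)
    ultimately have "eventually (\<lambda>x. x \<in> S \<and> (\<forall>j. norm (?R j x) \<le> ?e * norm (x - p) ^ n)) (nhds p)"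
      by eventually_elim (simp add: rad_def norm_power)
    then obtain \<delta> where \<delta>: "\<delta> > 0"
      "\<And>x. dist x p < \<delta> \<Longrightarrow> x \<in> S \<and> (\<forall>j. norm (?R j x) \<le> ?e * norm (x - p) ^ n)"
      unfolding eventually_nhds_metric by blast
    have "norm (h x - ?T (Suc n) h x) \<le> c * norm (rad p x ^ Suc n)" if x: "dist x p < \<delta>" for x
    proof -
      let ?G = "\<lambda>x. h x - ?T (Suc n) h x"
      have T0: "?T (Suc n) h p = h p"
      proof -
        have "?T (Suc n) h p = (\<Sum>\<alpha> | msize (\<alpha> :: 'd \<Rightarrow> nat) \<le> Suc n. if \<alpha> = (\<lambda>_. 0) then h p else 0)"
          by (rule sum.cong) (auto simp: cvec_def mpow_at_0 taylor_coeff_def mderiv_0 mfact_def)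
        then show ?thesis by (simp add: finite_msize_le msize_eq_0[THEN iffD2])
      qed
      have der: "(?G has_derivative (\<lambda>v. \<Sum>j\<in>UNIV. v $ j *\<^sub>R ?R j y)) (at y)" if "y \<in> S" for y
      proof -
        let ?c = "\<lambda>\<alpha>. taylor_coeff \<alpha> h p"
        let ?d = "\<lambda>j \<alpha>. of_nat (\<alpha> j) * mpow (cvec (y - p)) (\<alpha>(j := \<alpha> j - 1))"
        have "((\<lambda>x. ?T (Suc n) h x) has_derivative
          (\<lambda>v. \<Sum>\<alpha> | msize \<alpha> \<le> Suc n. ?c \<alpha> * (\<Sum>j\<in>UNIV. complex_of_real (v $ j) * ?d j \<alpha>))) (at y)"
          by (intro has_derivative_sum has_derivative_mult_right has_derivative_mpow_cvec)
        moreover have "(\<Sum>\<alpha> | msize \<alpha> \<le> Suc n. ?c \<alpha> * (\<Sum>j\<in>UNIV. complex_of_real (v $ j) * ?d j \<alpha>))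
          = (\<Sum>j\<in>UNIV. v $ j *\<^sub>R ?T n (pd j h) y)" for v :: "real^'d"
        proof -
          \<comment> \<open>Differentiating a monomial brings down the exponent, which cancels one
            factor of the multi-index factorial; what remains is the Taylor coefficient of
            \<open>pd j h\<close>.\<close>
          have shift: "(\<Sum>\<alpha> | msize \<alpha> \<le> Suc n. ?c \<alpha> * ?d j \<alpha>) = ?T n (pd j h) y" for j
          proof -
            have "(\<Sum>\<alpha> | msize \<alpha> \<le> Suc n. ?c \<alpha> * ?d j \<alpha>)
              = (\<Sum>\<gamma> | msize \<gamma> \<le> n. taylor_coeff (\<gamma>(j := Suc (\<gamma> j))) h p
                   * (of_nat (Suc (\<gamma> j)) * mpow (cvec (y - p)) \<gamma>))"
              by (subst sum_msize_shift(1)[where j=j]) simp_all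
            also have "\<dots> = ?T n (pd j h) y"
            proof (rule sum.cong)
              fix \<gamma> :: "'d \<Rightarrow> nat"
              have "taylor_coeff (\<gamma>(j := Suc (\<gamma> j))) h p * of_nat (Suc (\<gamma> j)) = taylor_coeff \<gamma> (pd j h) p"
                using mfact_nonzero[of \<gamma>]
                by (simp add: taylor_coeff_def mfact_Suc mderiv_pd[OF assms(1) Suc.prems assms(2)] del: of_nat_Suc)
              then show "taylor_coeff (\<gamma>(j := Suc (\<gamma> j))) h p * (of_nat (Suc (\<gamma> j)) * mpow (cvec (y - p)) \<gamma>)
                = taylor_coeff \<gamma> (pd j h) p * mpow (cvec (y - p)) \<gamma>"
                by (metis mult.assoc)
            qed simp
            finally show ?thesis .
          qed
          have "(\<Sum>\<alpha> | msize \<alpha> \<le> Suc n. ?c \<alpha> * (\<Sum>j\<in>UNIV. complex_of_real (v $ j) * ?d j \<alpha>))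
            = (\<Sum>\<alpha> | msize \<alpha> \<le> Suc n. \<Sum>j\<in>UNIV. complex_of_real (v $ j) * (?c \<alpha> * ?d j \<alpha>))"
            by (simp add: sum_distrib_left mult_ac)
          also have "\<dots> = (\<Sum>j\<in>UNIV. \<Sum>\<alpha> | msize \<alpha> \<le> Suc n. complex_of_real (v $ j) * (?c \<alpha> * ?d j \<alpha>))"
            by (rule sum.swap)
          also have "\<dots> = (\<Sum>j\<in>UNIV. complex_of_real (v $ j) * ?T n (pd j h) y)"
            unfolding shift[symmetric] sum_distrib_left ..
          finally show ?thesis by (simp add: scaleR_conv_of_real)
        qed
        ultimately have "((\<lambda>x. ?T (Suc n) h x) has_derivative (\<lambda>v. \<Sum>j\<in>UNIV. v $ j *\<^sub>R ?T n (pd j h) y)) (at y)"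
          by simp
        from has_derivative_diff[OF has_derivative_pd[OF smooth_on_differentiable[OF Suc.prems assms(1) that]] this]
        show ?thesis by (simp only: scaleR_diff_right sum_subtractf)
      qed
      \<comment> \<open>On the closed ball around p through x every point is at least as close to p
        as x, so one constant bounds the differential everywhere.\<close>
      have "norm (?G x - ?G p) \<le> (c * norm (x - p) ^ n) * norm (x - p)"
      proof (rule differentiable_bound[of "cball p (norm (x - p))" ?G "\<lambda>y v. \<Sum>j\<in>UNIV. v $ j *\<^sub>R ?R j y"])
        fix y assume "y \<in> cball p (norm (x - p))"
        then have y: "norm (y - p) \<le> norm (x - p)" by (simp add: dist_norm norm_minus_commute)
        then have y': "dist y p < \<delta>" using x by (simp add: dist_norm)
        show "(?G has_derivative (\<lambda>v. \<Sum>j\<in>UNIV. v $ j *\<^sub>R ?R j y)) (at y within cball p (norm (x - p)))"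
          using der \<delta>(2)[OF y'] has_derivative_at_withinI by blast
        show "onorm (\<lambda>v. \<Sum>j\<in>UNIV. v $ j *\<^sub>R ?R j y) \<le> c * norm (x - p) ^ n"
        proof (rule onorm_le)
          fix v :: "real^'d"
          have "norm (\<Sum>j\<in>UNIV. v $ j *\<^sub>R ?R j y) \<le> (\<Sum>j\<in>(UNIV::'d set). norm v * (?e * norm (x - p) ^ n))"
          proof (rule sum_norm_le)
            fix j :: 'd
            have "norm (?R j y) \<le> ?e * norm (y - p) ^ n" using \<delta>(2)[OF y'] by blast
            also have "\<dots> \<le> ?e * norm (x - p) ^ n"
              using y c by (intro mult_left_mono power_mono) auto
            finally show "norm (v $ j *\<^sub>R ?R j y) \<le> norm v * (?e * norm (x - p) ^ n)"
              unfolding norm_scaleR using component_le_norm_cart[of v j] by (intro mult_mono) auto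
          qed
          also have "\<dots> = c * norm (x - p) ^ n * norm v" by simp
          finally show "norm (\<Sum>j\<in>UNIV. v $ j *\<^sub>R ?R j y) \<le> c * norm (x - p) ^ n * norm v" .
        qed
      qed (auto simp: dist_norm norm_minus_commute)
      moreover have "?G p = 0" using T0 by simp
      ultimately show ?thesis by (simp add: rad_def norm_power mult_ac norm_mult)
    qed
    then show "eventually (\<lambda>x. norm (h x - ?T (Suc n) h x) \<le> c * norm (rad p x ^ Suc n)) (nhds p)"
      using \<delta>(1) unfolding eventually_nhds_metric by blast
  qed
qed


subsection \<open>Uniqueness of jets\<close>

text \<open>Vandermonde argument: by linearity the weights annihilate every polynomial, in
  particular the Lagrange product \<open>q\<close> that vanishes at all nodes but one.\<close>

lemma power_sums_zero:
  fixes x c :: "'b \<Rightarrow> complex"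
  assumes "finite B" "inj_on x B" "\<And>s. (\<Sum>b\<in>B. c b * x b ^ s) = 0" "b \<in> B"
  shows "c b = 0"
proof -
  have *: "(\<Sum>b\<in>B. c b * poly q (x b)) = 0" for q
  proof -
    have "(\<Sum>b\<in>B. c b * poly q (x b)) = (\<Sum>b\<in>B. \<Sum>s\<le>degree q. coeff q s * (c b * x b ^ s))"
      by (simp add: poly_altdef sum_distrib_left mult_ac)
    also have "\<dots> = (\<Sum>s\<le>degree q. \<Sum>b\<in>B. coeff q s * (c b * x b ^ s))"
      by (rule sum.swap)
    finally show ?thesis by (simp add: sum_distrib_left[symmetric] assms(3))
  qed
  define q where "q = (\<Prod>b'\<in>B-{b}. [:- x b', 1:])"
  have 0: "poly q (x b') = 0" if "b' \<in> B - {b}" for b'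
    using that assms(1) by (auto simp: q_def poly_prod)
  have "(\<Sum>b\<in>B. c b * poly q (x b)) = c b * poly q (x b)"
    using assms(1,4) 0 by (subst sum.remove[of _ b]) auto
  moreover have "poly q (x b) \<noteq> 0"
    using assms(1,2,4) by (auto simp: q_def poly_prod inj_on_def)
  ultimately show ?thesis using *[of q] by simp
qed

text \<open>Distinct primes as coordinates: unique factorisation recovers each exponent as a
  multiplicity in the value of the monomial.\<close>

lemma separating_point: "\<exists>z :: 'd::finite \<Rightarrow> complex. inj (mpow z)"
proof -
  obtain P where P: "P \<subseteq> {p::nat. prime p}" "finite P" "card P = CARD('d)"
    using infinite_arbitrarily_large[OF primes_infinite, of "CARD('d)"] by metis
  then obtain e :: "'d \<Rightarrow> nat" where e: "bij_betw e UNIV P"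
    using finite_same_card_bij[of "UNIV :: 'd set" P] by auto
  then have inj: "inj e" and eP: "range e = P" by (auto simp: bij_betw_def)
  have mult: "multiplicity (e j) (mpow e \<alpha>) = \<alpha> j" for j \<alpha>
  proof -
    have "mpow e \<alpha> = (\<Prod>q\<in>P. q ^ \<alpha> (inv e q))"
      unfolding mpow_def using inj by (simp add: eP[symmetric] prod.reindex)
    then show ?thesis
      using multiplicity_prod_prime_powers[OF P(2), of "e j" "\<alpha> \<circ> inv e"] P(1) eP inj
      by (auto simp: subset_iff)
  qed
  have "inj (mpow (\<lambda>j. of_nat (e j) :: complex))"
  proof (rule injI)
    fix \<alpha> \<beta> assume "mpow (\<lambda>j. of_nat (e j) :: complex) \<alpha> = mpow (\<lambda>j. of_nat (e j)) \<beta>"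
    then have "of_nat (mpow e \<alpha>) = (of_nat (mpow e \<beta>) :: complex)"
      by (simp add: mpow_def)
    then have "mpow e \<alpha> = mpow e \<beta>" by (simp only: of_nat_eq_iff)
    then show "\<alpha> = \<beta>" using mult by (metis ext)
  qed
  then show ?thesis by blast
qed

text \<open>On the complex line y1 + s y2 through the real and imaginary parts of z, the expression
  is a polynomial in s that has all real numbers as roots. Hence it is zero, and s = \<i> gives the
  point z.\<close>

lemma polynomial_zero_on_reals:
  assumes "finite B" and zero: "\<And>y. (\<Sum>\<beta>\<in>B. c \<beta> * mpow (lin_form \<omega> (cvec y)) \<beta>) = 0"
  shows "(\<Sum>\<beta>\<in>B. c \<beta> * mpow (lin_form \<omega> z) \<beta>) = 0"
proof -
  define y1 y2 :: "real^'a" where "y1 = (\<chi> j. Re (z j))" and "y2 = (\<chi> j. Im (z j))"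
  define q where "q = (\<Sum>\<beta>\<in>B. [:c \<beta>:] * (\<Prod>j\<in>UNIV. [:lin_form \<omega> (cvec y1) j, lin_form \<omega> (cvec y2) j:] ^ \<beta> j))"
  have q: "poly q s = (\<Sum>\<beta>\<in>B. c \<beta> * mpow (lin_form \<omega> (\<lambda>j. cvec y1 j + s * cvec y2 j)) \<beta>)" for s
  proof -
    have "lin_form \<omega> (\<lambda>j. cvec y1 j + s * cvec y2 j) = (\<lambda>j. lin_form \<omega> (cvec y1) j + s * lin_form \<omega> (cvec y2) j)"
      by (simp add: lin_form_def fun_eq_iff algebra_simps sum.distrib sum_distrib_left)
    then show ?thesis by (simp add: q_def poly_sum poly_prod mpow_def)
  qed
  have "poly q (of_real t) = 0" for t
  proof -
    have "(\<lambda>j. cvec y1 j + of_real t * cvec y2 j) = cvec (y1 + t *\<^sub>R y2)"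
      by (simp add: cvec_def fun_eq_iff)
    then show ?thesis by (simp add: q zero)
  qed
  then have "range complex_of_real \<subseteq> {x. poly q x = 0}" by auto
  moreover have "infinite (range complex_of_real)"
    using infinite_UNIV_char_0[where 'a=real] by (simp add: finite_image_iff inj_of_real)
  ultimately have "q = 0" using poly_roots_finite finite_subset by blast
  moreover have "(\<lambda>j. cvec y1 j + \<i> * cvec y2 j) = z"
    by (simp add: cvec_def y1_def y2_def fun_eq_iff complex_eq[symmetric])
  ultimately show ?thesis using q[of \<i>] by simp
qed

text \<open>The constant coefficient is the limit at 0 and hence vanishes; division by t then lowers
  both the degree and the order of smallness by one.\<close>

lemma poly_smallo_imp_0:
  assumes "degree q \<le> n" "(\<lambda>t. poly q (complex_of_real t)) \<in> o[at_right 0](\<lambda>t. complex_of_real t ^ n)"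
  shows "q = 0"
  using assms
proof (induction n arbitrary: q)
  case 0
  then obtain a where q: "q = [:a:]" using degree_eq_zeroE by blast
  have "a = 0"
  proof (rule ccontr)
    assume "a \<noteq> 0"
    then have "norm a / 2 > 0" by simp
    from landau_o.smallD[OF 0(2) this] have "eventually (\<lambda>t::real. norm a \<le> norm a / 2) (at_right 0)"
      by (simp add: q)
    then show False using \<open>a \<noteq> 0\<close> by simp
  qed
  then show ?case by (simp add: q)
next
  case (Suc n)
  obtain a q' where q: "q = pCons a q'" by (cases q)
  have lim: "((\<lambda>t. poly q (complex_of_real t)) \<longlongrightarrow> poly q (of_real 0)) (at_right 0)"
    by (intro tendsto_intros)
  have "((\<lambda>t. poly q (complex_of_real t)) \<longlongrightarrow> 0) (at_right 0)"
  proof (rule tendsto_0_le[where K=1])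
    have "((\<lambda>t. complex_of_real t ^ Suc n) \<longlongrightarrow> of_real 0 ^ Suc n) (at_right 0)"
      by (intro tendsto_intros)
    then show "((\<lambda>t. complex_of_real t ^ Suc n) \<longlongrightarrow> 0) (at_right 0)" by simp
    show "eventually (\<lambda>t. norm (poly q (complex_of_real t)) \<le> norm (complex_of_real t ^ Suc n) * 1) (at_right 0)"
      using landau_o.smallD[OF Suc.prems(2), of 1] by simp
  qed
  from tendsto_unique[OF _ lim this] have a: "a = 0" by (simp add: q)
  have "(\<lambda>t. poly q' (complex_of_real t)) \<in> o[at_right 0](\<lambda>t. complex_of_real t ^ n)"
  proof (rule landau_o.smallI)
    fix c :: real assume "c > 0"
    have "eventually (\<lambda>t::real. t > 0) (at_right 0)" by (rule eventually_at_right_less)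
    with landau_o.smallD[OF Suc.prems(2) \<open>c > 0\<close>]
    show "eventually (\<lambda>t. norm (poly q' (complex_of_real t)) \<le> c * norm (complex_of_real t ^ n)) (at_right 0)"
      by eventually_elim (simp add: q a norm_mult mult.left_commute[of c])
  qed
  moreover have "degree q' \<le> n" using Suc.prems(1) by (auto simp: q degree_pCons_eq_if split: if_splits)
  ultimately have "q' = 0" by (rule Suc.IH[rotated])
  then show ?case by (simp add: q a)
qed

text \<open>On a real ray from p the expression is a polynomial in t of degree at most n whose
  coefficients are the homogeneous components, so each component vanishes at real points and then at
  complex ones. Evaluating where the linear forms take the values v_j^s turns this into vanishing
  power sums with the distinct nodes \<open>mpow v \<gamma>\<close>.\<close>

theorem jet_unique:
  fixes p :: "real^'d::finite"
  assumes inv: "\<And>z. lin_form \<omega> (lin_form \<nu> z) = z"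
    and small: "(\<lambda>x. \<Sum>\<beta> | msize \<beta> \<le> n. c \<beta> * mpow (lin_form \<omega> (cvec (x - p))) \<beta>) \<in> o[nhds p](\<lambda>x. rad p x ^ n)"
    and "msize \<beta> \<le> n"
  shows "c \<beta> = 0"
proof -
  let ?L = "\<lambda>y. lin_form \<omega> (cvec y)"
  have zero: "(\<Sum>\<beta> | msize \<beta> = m. c \<beta> * mpow (?L y) \<beta>) = 0" if "m \<le> n" for m and y :: "real^'d"
  proof -
    define q where "q = (\<Sum>\<beta> | msize \<beta> \<le> n. monom (c \<beta> * mpow (?L y) \<beta>) (msize \<beta>))"
    have "degree q \<le> n"
      unfolding q_def by (intro degree_sum_le finite_msize_le) (auto intro: order_trans[OF degree_monom_le])
    have lim: "filterlim (\<lambda>t. p + t *\<^sub>R y) (nhds p) (at_right 0)"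
    proof -
      have "((\<lambda>t. p + t *\<^sub>R y) \<longlongrightarrow> p + 0 *\<^sub>R y) (at_right 0)" by (intro tendsto_intros)
      then show ?thesis by simp
    qed
    have scale: "?L (t *\<^sub>R y) = (\<lambda>j. of_real t * ?L y j)" for t
      by (simp add: lin_form_def cvec_def fun_eq_iff sum_distrib_left mult_ac)
    have pq: "poly q (of_real t) = (\<Sum>\<beta> | msize \<beta> \<le> n. c \<beta> * mpow (?L (p + t *\<^sub>R y - p)) \<beta>)" for t
      by (simp add: q_def poly_sum poly_monom scale mpow_scale mult_ac)
    have "(\<lambda>t. poly q (complex_of_real t)) \<in> o[at_right 0](\<lambda>t. rad p (p + t *\<^sub>R y) ^ n)"
      using landau_o.small.compose[OF small lim] unfolding pq .
    \<comment> \<open>The summand 1 in the constant keeps it positive also for y = 0.\<close>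
    also have "(\<lambda>t. rad p (p + t *\<^sub>R y) ^ n) \<in> O[at_right 0](\<lambda>t. complex_of_real t ^ n)"
      by (rule landau_o.bigI[of "norm y ^ n + 1"])
         (auto simp: rad_def norm_power norm_mult power_mult_distrib algebra_simps add_pos_nonneg add_nonneg_pos intro!: always_eventually)
    finally have "q = 0" using poly_smallo_imp_0 \<open>degree q \<le> n\<close> by blast
    have "coeff q m = (\<Sum>\<beta> | msize \<beta> \<le> n. if msize \<beta> = m then c \<beta> * mpow (?L y) \<beta> else 0)"
      by (simp add: q_def coeff_sum coeff_monom)
    also have "\<dots> = (\<Sum>\<beta> | msize \<beta> = m. c \<beta> * mpow (?L y) \<beta>)"
      using that by (intro sum.mono_neutral_cong_right finite_msize_le) auto
    finally show ?thesis using \<open>q = 0\<close> by simp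
  qed
  obtain v :: "'d \<Rightarrow> complex" where v: "inj (mpow v)" using separating_point by blast
  have "(\<Sum>\<gamma> | msize \<gamma> = msize \<beta>. c \<gamma> * mpow v \<gamma> ^ s) = 0" for s
    using polynomial_zero_on_reals[OF finite_msize_eq zero[OF assms(3)], of "lin_form \<nu> (\<lambda>j. v j ^ s)"]
    by (simp add: inv mpow_power)
  from power_sums_zero[OF finite_msize_eq inj_on_subset[OF v] this] show ?thesis by simp
qed

text \<open>A linear substitution preserves homogeneity and degree: \<open>hom\<close> survives
  multiplication by a linear form with the degree raised by one, and the monomial is assembled
  factor by factor. The exact degree matters, since the coefficients of each order must be
  combinations of derivatives of that order alone.\<close>

lemma mpow_lin_form_expand:
  "\<exists>M. \<forall>y. mpow (lin_form \<nu> y) \<alpha> = (\<Sum>\<beta> | msize \<beta> = msize \<alpha>. M \<beta> * mpow y \<beta>)"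
proof -
  define hom :: "nat \<Rightarrow> (('a \<Rightarrow> complex) \<Rightarrow> complex) \<Rightarrow> bool" where
    "hom m F \<longleftrightarrow> (\<exists>c. \<forall>y. F y = (\<Sum>\<beta> | msize \<beta> = m. c \<beta> * mpow y \<beta>))" for m F
  have coord: "hom (Suc m) (\<lambda>y. y j * F y)" if F: "hom m F" for m F j
  proof -
    from F obtain c where c: "\<And>y. F y = (\<Sum>\<beta> | msize \<beta> = m. c \<beta> * mpow y \<beta>)" unfolding hom_def by blast
    \<comment> \<open>The value 0 for \<gamma> j = 0 is what \<open>sum_msize_shift\<close>
      requires; truncated subtraction would give back \<gamma> itself there.\<close>
    define c' where "c' \<gamma> = (if \<gamma> j = 0 then 0 else c (\<gamma>(j := \<gamma> j - 1)))" for \<gamma>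
    have "y j * F y = (\<Sum>\<beta> | msize \<beta> = Suc m. c' \<beta> * mpow y \<beta>)" for y
      by (subst sum_msize_shift(2)[where j=j])
         (simp_all add: c'_def c mpow_Suc sum_distrib_left mult_ac)
    then show ?thesis unfolding hom_def by blast
  qed
  have lin: "hom m (\<lambda>y. \<Sum>k\<in>UNIV. a k * F k y)" if F: "\<And>k. hom m (F k)" for m a and F :: "'a \<Rightarrow> _"
  proof -
    from F obtain c where c: "\<And>k y. F k y = (\<Sum>\<beta> | msize \<beta> = m. c k \<beta> * mpow y \<beta>)" unfolding hom_def by metis
    have "(\<Sum>k\<in>UNIV. a k * F k y) = (\<Sum>\<beta> | msize \<beta> = m. (\<Sum>k\<in>UNIV. a k * c k \<beta>) * mpow y \<beta>)" for y
      unfolding c sum_distrib_left sum_distrib_right by (subst sum.swap) (simp add: mult_ac)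
    then show ?thesis unfolding hom_def by (intro exI[of _ "\<lambda>\<beta>. \<Sum>k\<in>UNIV. a k * c k \<beta>"]) blast
  qed
  have form: "hom (Suc m) (\<lambda>y. lin_form \<nu> y j * F y)" if "hom m F" for m F j
    using lin[OF coord[OF that], of "\<nu> j"] by (simp add: lin_form_def sum_distrib_right mult.assoc)
  have pow: "hom (s + m) (\<lambda>y. lin_form \<nu> y j ^ s * F y)" if "hom m F" for m F j s
  proof (induction s)
    case (Suc s)
    from form[OF this] show ?case by (simp add: mult.assoc)
  qed (simp add: that)
  have "hom (\<Sum>j\<in>A. \<alpha> j) (\<lambda>y. \<Prod>j\<in>A. lin_form \<nu> y j ^ \<alpha> j)" if "finite A" for A
    using that
  proof (induction A)
    case empty
    have "{\<beta> :: 'a \<Rightarrow> nat. msize \<beta> = 0} = {\<lambda>_. 0}" by (auto simp: msize_eq_0)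
    then show ?case unfolding hom_def by (intro exI[of _ "\<lambda>_. 1"]) (simp add: mpow_def)
  next
    case (insert j A)
    then show ?case using pow[OF insert.IH, of "\<alpha> j" j] by simp
  qed
  from this[of UNIV] show ?thesis by (simp add: hom_def mpow_def msize_def)
qed


subsection \<open>Left eigenvectors of the Jacobian matrix\<close>

lemma poly_det:
  fixes M :: "complex poly^'d^'d::finite"
  shows "poly (det M) x = det (\<chi> i k. poly (M $ i $ k) x)"
  by (simp add: det_def poly_sum poly_prod)

text \<open>Eigenvectors of the transpose are wanted, because they act as linear forms on
  displacements. The determinant does not see the transposition, so a root of the characteristic
  polynomial yields a kernel vector.\<close>

lemma left_eigenvector:
  fixes A :: "real^'d^'d::finite"
  assumes "eigenvalues_with_mult A l"
  obtains v :: "'d \<Rightarrow> complex" where "v \<noteq> (\<lambda>_. 0)"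
    "\<And>m. (\<Sum>k\<in>UNIV. v k * complex_of_real (A $ k $ m)) = l j * v m"
proof -
  let ?B = "\<chi> i k. (if i = k then l j else 0) - complex_of_real (A $ i $ k) :: complex^'d^'d"
  have "poly (charpoly A) (l j) = 0"
    using assms by (auto simp: eigenvalues_with_mult_def poly_prod)
  moreover have "poly (charpoly A) (l j) = det ?B"
    unfolding charpoly_def poly_det by (simp add: if_distrib[of "\<lambda>q. poly q _"] cong: if_cong)
  ultimately have "\<not> invertible (transpose ?B)"
    by (simp add: invertible_det_nz)
  then have "\<not> (\<exists>C. C ** transpose ?B = mat 1)"
    unfolding invertible_def using matrix_left_right_inverse by blast
  then obtain x where x: "transpose ?B *v x = 0" "x \<noteq> 0"
    unfolding matrix_left_invertible_ker by blast
  have "(\<Sum>k\<in>UNIV. x $ k * complex_of_real (A $ k $ m)) = l j * x $ m" for m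
  proof -
    have "(transpose ?B *v x) $ m = 0"
      using x(1) by simp
    then have "(\<Sum>k\<in>UNIV. (if k = m then l j * x $ k else 0) - x $ k * complex_of_real (A $ k $ m)) = 0"
      unfolding matrix_vector_mult_def transpose_def
      by (simp add: algebra_simps if_distrib[of "\<lambda>q. _ * q"] cong: if_cong)
    then show ?thesis
      by (simp add: sum_subtractf)
  qed
  moreover have "($) x \<noteq> (\<lambda>_. 0)"
    using x(2) by (auto simp: vec_eq_iff fun_eq_iff)
  ultimately show thesis by (rule that[rotated])
qed

text \<open>Unit multi-indices pick out the individual eigenvalues, so distinct monomial values
  include a simple spectrum.\<close>

lemma inj_mpow_imp_inj:
  fixes l :: "'d::finite \<Rightarrow> complex"
  assumes "inj (mpow l)"
  shows "inj l"
proof (rule injI)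
  fix i j assume "l i = l j"
  moreover have "mpow l ((\<lambda>_. 0)(i := Suc 0)) = l i" for i
    using mpow_Suc[of l "\<lambda>_. 0" i] by (simp add: mpow_def)
  ultimately have "(\<lambda>_. 0)(i := Suc 0) = (\<lambda>_. 0)(j := Suc 0)"
    using injD[OF assms] by metis
  then have "((\<lambda>_. 0)(i := Suc 0)) i = ((\<lambda>_. 0)(j := Suc 0)) i" by simp
  then show "i = j" by (simp split: if_splits)
qed

text \<open>Applying A repeatedly to a linear relation among the eigenvectors multiplies its terms
  by powers of distinct eigenvalues, and \<open>power_sums_zero\<close> then kills every term.
  Trivial kernel of a square matrix gives an inverse on both sides.\<close>

lemma lin_form_inverse:
  fixes \<omega> :: "'d::finite \<Rightarrow> 'd \<Rightarrow> complex"
  assumes "inj l" and nz: "\<And>j. \<omega> j \<noteq> (\<lambda>_. 0)"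
    and eig: "\<And>j m. (\<Sum>k\<in>UNIV. \<omega> j k * complex_of_real (A $ k $ m)) = l j * \<omega> j m"
  obtains \<nu> where "\<And>z. lin_form \<omega> (lin_form \<nu> z) = z" "\<And>z. lin_form \<nu> (lin_form \<omega> z) = z"
proof -
  let ?W = "(\<chi> j k. \<omega> j k) :: complex^'d^'d"
  have "x = 0" if x: "transpose ?W *v x = 0" for x
  proof -
    have 0: "(\<Sum>j\<in>UNIV. (x $ j * \<omega> j k) * l j ^ s) = 0" for k s
    proof (induction s arbitrary: k)
      case 0
      then show ?case
        using x by (simp add: vec_eq_iff matrix_vector_mult_def transpose_def mult.commute)
    next
      case (Suc s)
      have "(\<Sum>j\<in>UNIV. (x $ j * \<omega> j k) * l j ^ Suc s)
        = (\<Sum>j\<in>UNIV. x $ j * l j ^ s * (\<Sum>i\<in>UNIV. \<omega> j i * complex_of_real (A $ i $ k)))"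
        unfolding eig by (simp add: mult_ac)
      also have "\<dots> = (\<Sum>i\<in>UNIV. complex_of_real (A $ i $ k) * (\<Sum>j\<in>UNIV. (x $ j * \<omega> j i) * l j ^ s))"
        unfolding sum_distrib_left by (subst sum.swap) (simp add: mult_ac)
      finally show ?case by (simp add: Suc.IH)
    qed
    have "x $ j = 0" for j
    proof -
      obtain k where "\<omega> j k \<noteq> 0" using nz by blast
      then show ?thesis
        using power_sums_zero[OF _ assms(1) 0, of j k] by simp
    qed
    then show ?thesis by (simp add: vec_eq_iff)
  qed
  then obtain C where C: "C ** transpose ?W = mat 1"
    using matrix_left_invertible_ker by blast
  let ?C = "transpose C"
  have 1: "?W ** ?C = mat 1"
    using arg_cong[OF C, of transpose] by (simp add: matrix_transpose_mul transpose_mat)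
  then have 2: "?C ** ?W = mat 1"
    using matrix_left_right_inverse by blast
  have app: "lin_form (\<lambda>j k. M $ j $ k) z = ($) (M *v (\<chi> k. z k))" for M :: "complex^'d^'d" and z
    by (simp add: lin_form_def matrix_vector_mult_def fun_eq_iff)
  have \<omega>: "\<omega> = (\<lambda>j k. ?W $ j $ k)" by simp
  have "lin_form \<omega> (lin_form (\<lambda>j k. ?C $ j $ k) z) = z" for z
    by (subst \<omega>, simp only: app vec_nth_inverse matrix_vector_mul_assoc 1 matrix_vector_mul_lid) (simp add: fun_eq_iff)
  moreover have "lin_form (\<lambda>j k. ?C $ j $ k) (lin_form \<omega> z) = z" for z
    by (subst \<omega>, simp only: app vec_nth_inverse matrix_vector_mul_assoc 2 matrix_vector_mul_lid) (simp add: fun_eq_iff)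
  ultimately show thesis by (rule that)
qed


subsection \<open>Leading parts\<close>

text \<open>Equality of the parts of order m of two functions that vanish to that order. The growth
  bound on b makes the relation stable under products; the bound on a follows from the two
  clauses.\<close>

definition same_jet :: "real^'d::finite \<Rightarrow> nat \<Rightarrow> (real^'d \<Rightarrow> complex) \<Rightarrow> (real^'d \<Rightarrow> complex) \<Rightarrow> bool" where
  "same_jet p m a b \<longleftrightarrow> (\<lambda>x. a x - b x) \<in> o[nhds p](\<lambda>x. rad p x ^ m) \<and> b \<in> O[nhds p](\<lambda>x. rad p x ^ m)"

lemma same_jet_mult:
  assumes "same_jet p m a a'" "same_jet p k b b'"
  shows "same_jet p (m + k) (\<lambda>x. a x * b x) (\<lambda>x. a' x * b' x)"
proof -
  let ?r = "\<lambda>n x. rad p x ^ n"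
  note A = assms[unfolded same_jet_def]
  \<comment> \<open>The difference of the products is split so that only growth bounds on a' and b'
    are needed; the product of the two differences is one of the three terms.\<close>
  have "(\<lambda>x. (a x - a' x) * (b x - b' x)) \<in> o[nhds p](\<lambda>x. ?r m x * ?r k x)"
    using A landau_o.small_imp_big by (intro landau_o.small_big_mult) auto
  moreover have "(\<lambda>x. (a x - a' x) * b' x) \<in> o[nhds p](\<lambda>x. ?r m x * ?r k x)"
    using A by (intro landau_o.small_big_mult) auto
  moreover have "(\<lambda>x. a' x * (b x - b' x)) \<in> o[nhds p](\<lambda>x. ?r m x * ?r k x)"
    using A by (intro landau_o.big_small_mult) auto
  ultimately have "(\<lambda>x. (a x - a' x) * (b x - b' x) + (a x - a' x) * b' x + a' x * (b x - b' x))
     \<in> o[nhds p](\<lambda>x. ?r m x * ?r k x)"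
    by (intro sum_in_smallo)
  moreover have "(\<lambda>x. (a x - a' x) * (b x - b' x) + (a x - a' x) * b' x + a' x * (b x - b' x))
     = (\<lambda>x. a x * b x - a' x * b' x)"
    by (simp add: fun_eq_iff algebra_simps)
  moreover have "(\<lambda>x. a' x * b' x) \<in> O[nhds p](\<lambda>x. ?r m x * ?r k x)"
    using A by (intro landau_o.big_mult) auto
  ultimately show ?thesis by (simp add: same_jet_def power_add)
qed

lemma same_jet_mpow:
  fixes a b :: "'j::finite \<Rightarrow> real^'d::finite \<Rightarrow> complex"
  assumes "\<And>j. same_jet p 1 (a j) (b j)"
  shows "same_jet p (msize \<beta>) (\<lambda>x. mpow (\<lambda>j. a j x) \<beta>) (\<lambda>x. mpow (\<lambda>j. b j x) \<beta>)"
proof -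
  have 1: "same_jet p 0 (\<lambda>x. 1) (\<lambda>x. 1)" by (simp add: same_jet_def)
  have pow: "same_jet p n (\<lambda>x. a j x ^ n) (\<lambda>x. b j x ^ n)" for j n
    by (induction n) (use 1 same_jet_mult[OF assms[of j]] in auto)
  have "same_jet p (\<Sum>j\<in>A. \<beta> j) (\<lambda>x. \<Prod>j\<in>A. a j x ^ \<beta> j) (\<lambda>x. \<Prod>j\<in>A. b j x ^ \<beta> j)" if "finite A" for A
    using that by induction (use 1 same_jet_mult[OF pow] in auto)
  then show ?thesis by (simp add: mpow_def msize_def)
qed

lemma lin_form_bigo:
  assumes "g \<in> O[F](\<lambda>x. s x)" "g = (\<lambda>x. complex_of_real (norm (G x :: real^'d::finite)))"
  shows "(\<lambda>x. lin_form \<omega> (cvec (G x)) j) \<in> O[F](s)"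
proof -
  have "(\<lambda>x. \<omega> j k * cvec (G x) k) \<in> O[F](s)" for k
  proof (rule landau_o.big_trans[OF _ assms(1)])
    show "(\<lambda>x. \<omega> j k * cvec (G x) k) \<in> O[F](g)"
      by (rule landau_o.big_trans[of _ _ "\<lambda>x. cvec (G x) k"])
         (auto simp: assms(2) cvec_def component_le_norm_cart intro!: landau_o.bigI[of 1] always_eventually)
  qed
  then show ?thesis unfolding lin_form_def by (intro big_sum_in_bigo)
qed

lemma lin_form_smallo:
  assumes "g \<in> o[F](\<lambda>x. s x)" "g = (\<lambda>x. complex_of_real (norm (G x :: real^'d::finite)))"
  shows "(\<lambda>x. lin_form \<omega> (cvec (G x)) j) \<in> o[F](s)"
  using lin_form_bigo[OF landau_o.big_refl assms(2)] assms(1) landau_o.big_small_trans by blast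

lemma lin_form_rad_bigo: "(\<lambda>x. lin_form \<omega> (cvec (x - p)) j) \<in> O[nhds p](\<lambda>x. rad p x ^ 1)"
  using lin_form_bigo[OF landau_o.big_refl refl, where G="\<lambda>x. x - p"] by (simp add: rad_def)

text \<open>Applied to the linear part of f, the form is multiplied by the Jacobian matrix from the
  right, which for a left eigenvector is multiplication by c. Only the remainder of the derivative
  is left, and it is o(|x - p|).\<close>

lemma same_jet_eigenform:
  fixes f :: "real^'d::finite \<Rightarrow> real^'d"
  assumes "f differentiable at p" "f p = p"
    and eig: "\<And>m. (\<Sum>k\<in>UNIV. \<omega> j k * complex_of_real (matrix (frechet_derivative f (at p)) $ k $ m)) = c * \<omega> j m"
  shows "same_jet p 1 (\<lambda>x. lin_form \<omega> (cvec (f x - p)) j) (\<lambda>x. c * lin_form \<omega> (cvec (x - p)) j)"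
proof -
  let ?D = "frechet_derivative f (at p)"
  let ?A = "matrix ?D"
  have D: "(f has_derivative ?D) (at p)" using assms(1) frechet_derivative_works by blast
  then have lin: "linear ?D" by (rule has_derivative_linear)
  define R where "R x = f x - p - ?D (x - p)" for x
  have "(\<lambda>x. complex_of_real (norm (R x))) \<in> o[nhds p](\<lambda>x. rad p x)"
  proof (rule landau_o.smallI)
    fix e :: real assume "e > 0"
    with D obtain d where "d > 0" "\<And>y. norm (y - p) < d \<Longrightarrow> norm (f y - f p - ?D (y - p)) \<le> e * norm (y - p)"
      unfolding has_derivative_at_alt by blast
    then show "eventually (\<lambda>x. norm (complex_of_real (norm (R x))) \<le> e * norm (rad p x)) (nhds p)"
      unfolding eventually_nhds_metric by (auto simp: R_def rad_def dist_norm assms(2))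
  qed
  from lin_form_smallo[OF this refl]
  have R: "(\<lambda>x. lin_form \<omega> (cvec (R x)) j) \<in> o[nhds p](\<lambda>x. rad p x)" .
  have "lin_form \<omega> (cvec (f x - p)) j - c * lin_form \<omega> (cvec (x - p)) j = lin_form \<omega> (cvec (R x)) j" for x
  proof -
    have "?D (x - p) $ k = (\<Sum>m\<in>UNIV. ?A $ k $ m * (x - p) $ m)" for k
    proof -
      have "?D (x - p) = ?D (\<Sum>m\<in>UNIV. (x - p) $ m *\<^sub>R axis m 1)"
        by (simp only: vec_axis_expansion)
      also have "\<dots> = (\<Sum>m\<in>UNIV. (x - p) $ m *\<^sub>R ?D (axis m 1))"
        using lin by (simp only: linear_sum linear_scale)
      finally show ?thesis by (simp add: matrix_def mult.commute)
    qed
    then have "lin_form \<omega> (cvec (?D (x - p))) j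
        = (\<Sum>k\<in>UNIV. \<Sum>m\<in>UNIV. \<omega> j k * (complex_of_real (?A $ k $ m) * complex_of_real ((x - p) $ m)))"
      by (simp add: lin_form_def cvec_def sum_distrib_left)
    also have "\<dots> = (\<Sum>m\<in>UNIV. complex_of_real ((x - p) $ m) * (\<Sum>k\<in>UNIV. \<omega> j k * complex_of_real (?A $ k $ m)))"
      by (subst sum.swap) (simp add: sum_distrib_left mult_ac)
    also have "\<dots> = c * lin_form \<omega> (cvec (x - p)) j"
      by (simp add: eig lin_form_def cvec_def sum_distrib_left mult_ac)
    finally have "c * lin_form \<omega> (cvec (x - p)) j = lin_form \<omega> (cvec (?D (x - p))) j" by simp
    then show ?thesis
      by (simp add: R_def lin_form_def cvec_def sum_subtractf sum.distrib algebra_simps)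
  qed
  then show ?thesis
    using R lin_form_rad_bigo[of \<omega> p j] by (simp add: same_jet_def)
qed

text \<open>Needed to substitute f into Taylor remainders: what is o(|f x - p|^n) becomes o(|x -
  p|^n).\<close>

lemma rad_compose_bigo:
  fixes f :: "real^'d::finite \<Rightarrow> real^'d"
  assumes "f differentiable at p" "f p = p"
  shows "(\<lambda>x. rad p (f x)) \<in> O[nhds p](\<lambda>x. rad p x)"
proof -
  let ?D = "frechet_derivative f (at p)"
  have D: "(f has_derivative ?D) (at p)" using assms(1) frechet_derivative_works by blast
  then obtain K where K: "\<And>v. norm (?D v) \<le> norm v * K" "K > 0"
    using bounded_linear.pos_bounded[OF has_derivative_bounded_linear] by blast
  from D obtain d where d: "d > 0" "\<And>y. norm (y - p) < d \<Longrightarrow> norm (f y - f p - ?D (y - p)) \<le> 1 * norm (y - p)"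
    unfolding has_derivative_at_alt using zero_less_one by blast
  have "norm (f y - p) \<le> (K + 1) * norm (y - p)" if "norm (y - p) < d" for y
    using d(2)[OF that] K(1)[of "y - p"] norm_triangle_sub[of "f y - p" "?D (y - p)"] assms(2)
    by (simp add: algebra_simps)
  then show ?thesis
    using d(1) K(2) by (intro landau_o.bigI[of "K + 1"])
      (auto simp: eventually_nhds_metric rad_def dist_norm intro!: exI[of _ d])
qed


subsection \<open>Jet functionals adapted to a fixed point\<close>

lemma sum_msize_swap:
  fixes F :: "('d::finite \<Rightarrow> nat) \<Rightarrow> ('d \<Rightarrow> nat) \<Rightarrow> 'b::comm_monoid_add"
  shows "(\<Sum>\<alpha> | msize \<alpha> \<le> n. \<Sum>\<beta> | msize \<beta> = msize \<alpha>. F \<alpha> \<beta>)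
    = (\<Sum>\<beta> | msize \<beta> \<le> n. \<Sum>\<alpha> | msize \<alpha> = msize \<beta>. F \<alpha> \<beta>)"
proof -
  have "(\<Sum>\<alpha> | msize \<alpha> \<le> n. \<Sum>\<beta> | msize \<beta> = msize \<alpha>. F \<alpha> \<beta>)
     = (\<Sum>\<alpha>\<in>{\<alpha>. msize \<alpha> \<le> n}. \<Sum>\<beta>\<in>{\<beta> \<in> {\<beta>. msize \<beta> \<le> n}. msize \<beta> = msize \<alpha>}. F \<alpha> \<beta>)"
    by (intro sum.cong) auto
  also have "\<dots> = (\<Sum>\<beta>\<in>{\<beta>. msize \<beta> \<le> n}. \<Sum>\<alpha>\<in>{\<alpha> \<in> {\<alpha>. msize \<alpha> \<le> n}. msize \<beta> = msize \<alpha>}. F \<alpha> \<beta>)"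
    by (rule sum.swap_restrict) (rule finite_msize_le)+
  also have "\<dots> = (\<Sum>\<beta> | msize \<beta> \<le> n. \<Sum>\<alpha> | msize \<alpha> = msize \<beta>. F \<alpha> \<beta>)"
    by (intro sum.cong) auto
  finally show ?thesis .
qed

lemma taylor_unique:
  fixes p :: "real^'d::finite"
  assumes "(\<lambda>x. \<Sum>\<beta> | msize \<beta> \<le> n. c \<beta> * mpow (cvec (x - p)) \<beta>) \<in> o[nhds p](\<lambda>x. rad p x ^ n)" "msize \<beta> \<le> n"
  shows "c \<beta> = 0"
  using jet_unique[where \<omega> = "\<lambda>j k. if j = k then 1 else 0" and \<nu> = "\<lambda>j k. if j = k then 1 else 0"] assms
  by (simp add: lin_form_def if_distrib[of "\<lambda>q. q * _"] cong: if_cong)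

lemma mderiv_eq_0_if_smallo:
  assumes "open S" "p \<in> S" "smooth_on S h" "h \<in> o[nhds p](\<lambda>x. rad p x ^ n)" "msize \<alpha> \<le> n"
  shows "mderiv \<alpha> h p = 0"
proof -
  have "(\<lambda>x. \<Sum>\<alpha> | msize \<alpha> \<le> n. taylor_coeff \<alpha> h p * mpow (cvec (x - p)) \<alpha>) \<in> o[nhds p](\<lambda>x. rad p x ^ n)"
    using sum_in_smallo(2)[OF assms(4) taylor_peano[OF assms(1-3), of n]] by simp
  from taylor_unique[OF this assms(5)] show ?thesis
    using mfact_nonzero[of \<alpha>] by (simp add: taylor_coeff_def)
qed

text \<open>Here \<open>a \<beta> h\<close> is the coefficient of the monomial
  \<open>e \<beta>\<close> in the expansion of h at p. N and P translate between these coefficients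
  and the derivatives of the same order, and B collects the contributions of lower order to
  composition with f. The smooth factor q in the last property leaves room to suppress the test
  function at other points.\<close>

theorem adapted_jets:
  fixes f :: "real^'d::finite \<Rightarrow> real^'d"
  assumes "open \<Omega>" "p \<in> \<Omega>" "f p = p" "smooth_on \<Omega> f"
    and "eigenvalues_with_mult (matrix (frechet_derivative f (at p))) l" "inj (mpow l)"
  obtains N P B :: "('d \<Rightarrow> nat) \<Rightarrow> ('d \<Rightarrow> nat) \<Rightarrow> complex" and e :: "('d \<Rightarrow> nat) \<Rightarrow> real^'d \<Rightarrow> complex"
    and a :: "('d \<Rightarrow> nat) \<Rightarrow> (real^'d \<Rightarrow> complex) \<Rightarrow> complex"
  where "\<And>\<beta> h. a \<beta> h = (\<Sum>\<alpha> | msize \<alpha> = msize \<beta>. N \<beta> \<alpha> * mderiv \<alpha> h p)"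
    and "\<And>\<alpha> h. smooth_on \<Omega> h \<Longrightarrow> mderiv \<alpha> h p = (\<Sum>\<beta> | msize \<beta> = msize \<alpha>. P \<alpha> \<beta> * a \<beta> h)"
    and "\<And>\<gamma> h g. smooth_on \<Omega> h \<Longrightarrow> smooth_on \<Omega> g \<Longrightarrow> (\<And>x. x \<in> \<Omega> \<Longrightarrow> g x = h (f x)) \<Longrightarrow>
      a \<gamma> g = mpow l \<gamma> * a \<gamma> h + (\<Sum>\<beta> | msize \<beta> < msize \<gamma>. B \<gamma> \<beta> * a \<beta> h)"
    and "\<And>\<beta>. smooth_on \<Omega> (e \<beta>)"
    and "\<And>\<alpha> \<beta> q. smooth_on \<Omega> q \<Longrightarrow> msize \<alpha> \<le> msize \<beta> \<Longrightarrow>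
      a \<alpha> (\<lambda>x. e \<beta> x * q x) = (if \<alpha> = \<beta> then q p else 0)"
proof -
  let ?A = "matrix (frechet_derivative f (at p))"
  have "\<exists>v. v \<noteq> (\<lambda>_. 0) \<and> (\<forall>m. (\<Sum>k\<in>UNIV. v k * complex_of_real (?A $ k $ m)) = l j * v m)" for j
    by (rule left_eigenvector[OF assms(5), of j]) blast
  then have "\<exists>\<omega>. \<forall>j. \<omega> j \<noteq> (\<lambda>_. 0) \<and> (\<forall>m. (\<Sum>k\<in>UNIV. \<omega> j k * complex_of_real (?A $ k $ m)) = l j * \<omega> j m)"
    by (intro choice) blast
  then obtain \<omega> where \<omega>: "\<And>j. \<omega> j \<noteq> (\<lambda>_. 0)"
    "\<And>j m. (\<Sum>k\<in>UNIV. \<omega> j k * complex_of_real (?A $ k $ m)) = l j * \<omega> j m" by blast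
  obtain \<nu> where inv: "\<And>z. lin_form \<omega> (lin_form \<nu> z) = z" "\<And>z. lin_form \<nu> (lin_form \<omega> z) = z"
    using lin_form_inverse[OF inj_mpow_imp_inj[OF assms(6)] \<omega>] by blast
  \<comment> \<open>M rewrites ordinary monomials in the adapted coordinates; Q, obtained below,
    goes back.\<close>
  obtain M where M': "\<forall>\<alpha> y. mpow (lin_form \<nu> y) \<alpha> = (\<Sum>\<beta> | msize \<beta> = msize \<alpha>. M \<alpha> \<beta> * mpow y \<beta>)"
    using choice[OF allI[OF mpow_lin_form_expand[of \<nu>]], of "\<lambda>\<alpha>. \<alpha>"] by blast
  have M: "mpow z \<alpha> = (\<Sum>\<beta> | msize \<beta> = msize \<alpha>. M \<alpha> \<beta> * mpow (lin_form \<omega> z) \<beta>)" for z \<alpha>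
    using M'[rule_format, of "lin_form \<omega> z" \<alpha>] by (simp add: inv)
  obtain Q where "\<forall>\<beta> y. mpow (lin_form \<omega> y) \<beta> = (\<Sum>\<alpha> | msize \<alpha> = msize \<beta>. Q \<beta> \<alpha> * mpow y \<alpha>)"
    using choice[OF allI[OF mpow_lin_form_expand[of \<omega>]], of "\<lambda>\<alpha>. \<alpha>"] by blast
  then have Q: "mpow (lin_form \<omega> y) \<beta> = (\<Sum>\<alpha> | msize \<alpha> = msize \<beta>. Q \<beta> \<alpha> * mpow y \<alpha>)" for \<beta> y
    by blast
  \<comment> \<open>The Taylor coefficient of \<alpha> is distributed over the adapted monomials
    according to M, including the factorial.\<close>
  define N where "N \<beta> \<alpha> = M \<alpha> \<beta> / mfact \<alpha>" for \<alpha> \<beta>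
  define P where "P \<alpha> \<beta> = mfact \<alpha> * Q \<beta> \<alpha>" for \<alpha> \<beta>
  define a where "a \<beta> h = (\<Sum>\<alpha> | msize \<alpha> = msize \<beta>. N \<beta> \<alpha> * mderiv \<alpha> h p)" for \<beta> h
  define e where "e \<beta> x = mpow (lin_form \<omega> (cvec (x - p))) \<beta>" for \<beta> x
  let ?o = "\<lambda>n. o[nhds p](\<lambda>x. rad p x ^ n)"
  have fdiff: "f differentiable at p"
    using smooth_on_differentiable[OF assms(4,1,2)] .
  have smooth_form: "smooth_on \<Omega> (\<lambda>x. lin_form \<omega> (cvec (g x - p)) j)" if g: "smooth_on \<Omega> g" for g :: "real^'d \<Rightarrow> real^'d" and j
  proof -
    have "smooth_on \<Omega> (\<lambda>x. \<omega> j k * (complex_of_real (g x $ k) + (- complex_of_real (p $ k))))" for k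
      by (intro smooth_on_mult smooth_on_add smooth_on_const smooth_on_component assms(1) g)
    from smooth_on_sum[where A=UNIV, OF assms(1) this] show ?thesis
      by (simp add: lin_form_def cvec_def)
  qed
  have smooth_e: "smooth_on \<Omega> (e \<beta>)" for \<beta>
    unfolding e_def by (intro smooth_on_mpow smooth_form smooth_on_ident assms(1))
  have smooth_ef: "smooth_on \<Omega> (\<lambda>x. e \<beta> (f x))" for \<beta>
    unfolding e_def by (intro smooth_on_mpow smooth_form assms)
  have expand: "(\<lambda>x. h x - (\<Sum>\<beta> | msize \<beta> \<le> n. a \<beta> h * e \<beta> x)) \<in> ?o n" if "smooth_on \<Omega> h" for h n
  proof -
    have "(\<Sum>\<alpha> | msize \<alpha> \<le> n. taylor_coeff \<alpha> h p * mpow (cvec (x - p)) \<alpha>) = (\<Sum>\<beta> | msize \<beta> \<le> n. a \<beta> h * e \<beta> x)" for x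
    proof -
      have "(\<Sum>\<alpha> | msize \<alpha> \<le> n. taylor_coeff \<alpha> h p * mpow (cvec (x - p)) \<alpha>)
        = (\<Sum>\<alpha> | msize \<alpha> \<le> n. \<Sum>\<beta> | msize \<beta> = msize \<alpha>. taylor_coeff \<alpha> h p * (M \<alpha> \<beta> * e \<beta> x))"
        by (subst M) (simp add: e_def sum_distrib_left)
      also have "\<dots> = (\<Sum>\<beta> | msize \<beta> \<le> n. \<Sum>\<alpha> | msize \<alpha> = msize \<beta>. taylor_coeff \<alpha> h p * (M \<alpha> \<beta> * e \<beta> x))"
        by (rule sum_msize_swap)
      also have "\<dots> = (\<Sum>\<beta> | msize \<beta> \<le> n. a \<beta> h * e \<beta> x)"
        unfolding a_def N_def taylor_coeff_def sum_distrib_right by (simp add: mult_ac)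
      finally show ?thesis .
    qed
    with taylor_peano[OF assms(1,2) that, of n] show ?thesis by simp
  qed
  have unique: "c \<beta> = 0" if "(\<lambda>x. \<Sum>\<beta> | msize \<beta> \<le> n. c \<beta> * e \<beta> x) \<in> ?o n" "msize \<beta> \<le> n" for c n \<beta>
    using jet_unique[OF inv(1) that(1)[unfolded e_def] that(2)] .
  have R1: "a \<beta> h = (\<Sum>\<alpha> | msize \<alpha> = msize \<beta>. N \<beta> \<alpha> * mderiv \<alpha> h p)" for \<beta> h
    by (rule a_def)
  have R2: "mderiv \<alpha> h p = (\<Sum>\<beta> | msize \<beta> = msize \<alpha>. P \<alpha> \<beta> * a \<beta> h)" if h: "smooth_on \<Omega> h" for \<alpha> h
  proof -
    let ?n = "msize \<alpha>"
    \<comment> \<open>The defect between the Taylor coefficient and the coefficient obtained by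
      expanding the adapted monomials again; both polynomials approximate h to the same
      order.\<close>
    define c where "c \<alpha> = taylor_coeff \<alpha> h p - (\<Sum>\<beta> | msize \<beta> = msize \<alpha>. a \<beta> h * Q \<beta> \<alpha>)" for \<alpha>
    have "(\<Sum>\<beta> | msize \<beta> \<le> ?n. a \<beta> h * e \<beta> x)
      = (\<Sum>\<alpha> | msize \<alpha> \<le> ?n. (\<Sum>\<beta> | msize \<beta> = msize \<alpha>. a \<beta> h * Q \<beta> \<alpha>) * mpow (cvec (x - p)) \<alpha>)" for x
      unfolding e_def Q sum_distrib_left sum_distrib_right
      by (subst sum_msize_swap) (simp add: mult_ac)
    then have "(\<lambda>x. \<Sum>\<alpha> | msize \<alpha> \<le> ?n. c \<alpha> * mpow (cvec (x - p)) \<alpha>)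
      = (\<lambda>x. (h x - (\<Sum>\<beta> | msize \<beta> \<le> ?n. a \<beta> h * e \<beta> x))
         - (h x - (\<Sum>\<alpha> | msize \<alpha> \<le> ?n. taylor_coeff \<alpha> h p * mpow (cvec (x - p)) \<alpha>)))"
      by (simp add: c_def left_diff_distrib sum_subtractf)
    also have "\<dots> \<in> ?o ?n"
      by (intro sum_in_smallo expand[OF h] taylor_peano[OF assms(1,2) h])
    finally have "c \<alpha> = 0" by (rule taylor_unique) simp
    then show ?thesis
      using mfact_nonzero[of \<alpha>] by (simp add: c_def P_def taylor_coeff_def sum_distrib_left field_simps)
  qed
  have R4: "a \<alpha> (\<lambda>x. e \<beta> x * q x) = (if \<alpha> = \<beta> then q p else 0)"
    if q: "smooth_on \<Omega> q" and \<alpha>\<beta>: "msize \<alpha> \<le> msize \<beta>" for \<alpha> \<beta> q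
  proof -
    let ?n = "msize \<beta>"
    have "e \<beta> \<in> O[nhds p](\<lambda>x. rad p x ^ ?n)"
      using same_jet_mpow[of p "\<lambda>j x. lin_form \<omega> (cvec (x - p)) j" "\<lambda>j x. lin_form \<omega> (cvec (x - p)) j" \<beta>]
        lin_form_rad_bigo[of \<omega> p] by (simp add: same_jet_def e_def[abs_def])
    \<comment> \<open>Continuity of q at p, written as its expansion of order 0; hence only q(p)
      enters the coefficients up to the order of \<beta>.\<close>
    moreover have "(\<lambda>x. q x - q p) \<in> ?o 0"
      using taylor_peano[OF assms(1,2) q, of 0]
      by (simp add: msize_eq_0 taylor_coeff_def mderiv_0 mfact_def mpow_def)
    ultimately have "(\<lambda>x. e \<beta> x * (q x - q p)) \<in> o[nhds p](\<lambda>x. rad p x ^ ?n * rad p x ^ 0)"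
      by (rule landau_o.big_small_mult)
    then have 1: "(\<lambda>x. e \<beta> x * (q x - q p)) \<in> ?o ?n" by simp
    have 2: "(\<lambda>x. e \<beta> x * q x - (\<Sum>\<gamma> | msize \<gamma> \<le> ?n. a \<gamma> (\<lambda>x. e \<beta> x * q x) * e \<gamma> x)) \<in> ?o ?n"
      by (intro expand smooth_on_mult smooth_e q assms(1))
    have sel: "(\<Sum>\<gamma> | msize \<gamma> \<le> ?n. (if \<gamma> = \<beta> then q p else 0) * e \<gamma> x) = e \<beta> x * q p" for x
      by (simp add: if_distrib[of "\<lambda>c. c * _"] finite_msize_le cong: if_cong)
    have "(\<lambda>x. \<Sum>\<gamma> | msize \<gamma> \<le> ?n. (a \<gamma> (\<lambda>x. e \<beta> x * q x) - (if \<gamma> = \<beta> then q p else 0)) * e \<gamma> x)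
      = (\<lambda>x. e \<beta> x * (q x - q p) - (e \<beta> x * q x - (\<Sum>\<gamma> | msize \<gamma> \<le> ?n. a \<gamma> (\<lambda>x. e \<beta> x * q x) * e \<gamma> x)))"
      unfolding left_diff_distrib sum_subtractf right_diff_distrib sel by simp
    also have "\<dots> \<in> ?o ?n" using 1 2 by (rule sum_in_smallo)
    finally have "a \<alpha> (\<lambda>x. e \<beta> x * q x) - (if \<alpha> = \<beta> then q p else 0) = 0"
      using unique[of "\<lambda>\<gamma>. a \<gamma> (\<lambda>x. e \<beta> x * q x) - (if \<gamma> = \<beta> then q p else 0)", OF _ \<alpha>\<beta>] by blast
    then show ?thesis by simp
  qed
  have R3: "a \<gamma> g = mpow l \<gamma> * a \<gamma> h + (\<Sum>\<beta> | msize \<beta> < msize \<gamma>. a \<gamma> (\<lambda>x. e \<beta> (f x)) * a \<beta> h)"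
    if h: "smooth_on \<Omega> h" and g: "smooth_on \<Omega> g" and gh: "\<And>x. x \<in> \<Omega> \<Longrightarrow> g x = h (f x)" for \<gamma> h g
  proof -
    let ?n = "msize \<gamma>"
    let ?E = "\<lambda>h x. \<Sum>\<beta> | msize \<beta> \<le> ?n. a \<beta> h * e \<beta> x"
    let ?ef = "\<lambda>\<beta> x. e \<beta> (f x)"
    have flim: "filterlim f (nhds p) (nhds p)"
    proof -
      have "isCont f p" using fdiff differentiable_imp_continuous_within by blast
      then have "(f \<longlongrightarrow> f p) (nhds p)" by (simp add: isCont_def tendsto_at_iff_tendsto_nhds)
      then show ?thesis by (simp add: assms(3))
    qed
    have 1: "(\<lambda>x. h (f x) - ?E h (f x)) \<in> ?o ?n"
      by (rule landau_o.small_big_trans[OF landau_o.small.compose[OF expand[OF h] flim]])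
         (rule landau_o.big_power[OF rad_compose_bigo[OF fdiff assms(3)]])
    have 2: "(\<lambda>x. h (f x) - ?E g x) \<in> ?o ?n"
    proof (rule landau_o.small.ev_eq_trans2)
      show "eventually (\<lambda>x. h (f x) - ?E g x = g x - ?E g x) (nhds p)"
        using eventually_nhds_in_open[OF assms(1,2)] by eventually_elim (simp add: gh)
    qed (rule expand[OF g])
    \<comment> \<open>Monomials of lower order composed with f are expanded up to the full order n
      and produce the entries below the diagonal. For those of order n the leading part is enough,
      and it is a multiple of the monomial itself.\<close>
    have 3: "(\<lambda>x. \<Sum>\<beta> | msize \<beta> < ?n. a \<beta> h * (?ef \<beta> x - ?E (?ef \<beta>) x)) \<in> ?o ?n"
      using expand[OF smooth_ef] by (intro big_sum_in_smallo) simp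
    have 4: "(\<lambda>x. \<Sum>\<beta> | msize \<beta> = ?n. a \<beta> h * (?ef \<beta> x - mpow l \<beta> * e \<beta> x)) \<in> ?o ?n"
    proof (rule big_sum_in_smallo)
      fix \<beta> :: "'d \<Rightarrow> nat" assume "\<beta> \<in> {\<beta>. msize \<beta> = ?n}"
      then have n: "?n = msize \<beta>" by simp
      have "same_jet p ?n (\<lambda>x. mpow (lin_form \<omega> (cvec (f x - p))) \<beta>)
          (\<lambda>x. mpow (\<lambda>j. l j * lin_form \<omega> (cvec (x - p)) j) \<beta>)"
        unfolding n by (rule same_jet_mpow) (rule same_jet_eigenform[OF fdiff assms(3) \<omega>(2)])
      then have "(\<lambda>x. ?ef \<beta> x - mpow l \<beta> * e \<beta> x) \<in> ?o ?n"
        by (simp add: same_jet_def e_def mpow_def power_mult_distrib prod.distrib)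
      then show "(\<lambda>x. a \<beta> h * (?ef \<beta> x - mpow l \<beta> * e \<beta> x)) \<in> ?o ?n" by simp
    qed
    \<comment> \<open>Coefficients of the polynomial by which the two expansions of the composition
      differ, in all orders up to n; uniqueness of jets kills them, in particular the one at
      \<gamma>.\<close>
    define c where "c \<delta> = a \<delta> g - (\<Sum>\<beta> | msize \<beta> < ?n. a \<beta> h * a \<delta> (?ef \<beta>))
       - (if msize \<delta> = ?n then mpow l \<delta> * a \<delta> h else 0)" for \<delta>
    have split: "?E h (f x) = (\<Sum>\<beta> | msize \<beta> < ?n. a \<beta> h * ?ef \<beta> x) + (\<Sum>\<beta> | msize \<beta> = ?n. a \<beta> h * ?ef \<beta> x)" for x
    proof -
      have "{\<beta> :: 'd \<Rightarrow> nat. msize \<beta> \<le> ?n} = {\<beta>. msize \<beta> < ?n} \<union> {\<beta>. msize \<beta> = ?n}" by auto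
      then show ?thesis
        by (simp only:) (rule sum.union_disjoint, auto simp: finite_msize_less finite_msize_eq)
    qed
    have "(\<lambda>x. \<Sum>\<delta> | msize \<delta> \<le> ?n. c \<delta> * e \<delta> x)
      = (\<lambda>x. (h (f x) - ?E h (f x)) - (h (f x) - ?E g x)
           + (\<Sum>\<beta> | msize \<beta> < ?n. a \<beta> h * (?ef \<beta> x - ?E (?ef \<beta>) x))
           + (\<Sum>\<beta> | msize \<beta> = ?n. a \<beta> h * (?ef \<beta> x - mpow l \<beta> * e \<beta> x)))" (is "_ = ?R")
    proof
      fix x
      have i: "(\<Sum>\<beta> | msize \<beta> < ?n. a \<beta> h * ?E (?ef \<beta>) x)
         = (\<Sum>\<delta> | msize \<delta> \<le> ?n. (\<Sum>\<beta> | msize \<beta> < ?n. a \<beta> h * a \<delta> (?ef \<beta>)) * e \<delta> x)"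
        unfolding sum_distrib_left sum_distrib_right by (subst sum.swap) (simp add: mult_ac)
      have ii: "(\<Sum>\<beta> | msize \<beta> = ?n. a \<beta> h * (mpow l \<beta> * e \<beta> x))
         = (\<Sum>\<delta> | msize \<delta> \<le> ?n. (if msize \<delta> = ?n then mpow l \<delta> * a \<delta> h else 0) * e \<delta> x)"
        by (intro sum.mono_neutral_cong_left finite_msize_le) auto
      have "?R x = ?E g x - (\<Sum>\<beta> | msize \<beta> < ?n. a \<beta> h * ?E (?ef \<beta>) x)
          - (\<Sum>\<beta> | msize \<beta> = ?n. a \<beta> h * (mpow l \<beta> * e \<beta> x))"
        by (simp only: split right_diff_distrib sum_subtractf) simp
      also have "\<dots> = (\<Sum>\<delta> | msize \<delta> \<le> ?n. c \<delta> * e \<delta> x)"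
        unfolding i ii c_def left_diff_distrib sum_subtractf ..
      finally show "(\<Sum>\<delta> | msize \<delta> \<le> ?n. c \<delta> * e \<delta> x) = ?R x" by simp
    qed
    also have "\<dots> \<in> ?o ?n"
      by (rule sum_in_smallo(1)[OF sum_in_smallo(1)[OF sum_in_smallo(2)[OF 1 2] 3] 4])
    finally have "c \<gamma> = 0" by (rule unique) simp
    then show ?thesis by (simp add: c_def mult.commute algebra_simps)
  qed
  show thesis
    by (rule that[OF R1 R2 R3 smooth_e R4])
qed


section \<open>Hilbert spaces of functions\<close>

interpretation fs: vector_space "cscale :: complex \<Rightarrow> ('a \<Rightarrow> complex) \<Rightarrow> _"
  by (rule vector_space_cscale)

lemma sum_fun_apply: "(\<Sum>a\<in>A. F a) x = (\<Sum>a\<in>A. F a x :: 'b::comm_monoid_add)"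
  by (induction A rule: infinite_finite_induct) auto

text \<open>Coefficients are attached to indices rather than to vectors, so that the family need not
  be injective.\<close>

lemma span_image_family:
  assumes "finite A"
  shows "x \<in> fs.span (b ` A) \<longleftrightarrow> (\<exists>c. x = (\<Sum>a\<in>A. cscale (c a) (b a)))"
proof
  assume "x \<in> fs.span (b ` A)"
  then show "\<exists>c. x = (\<Sum>a\<in>A. cscale (c a) (b a))"
  proof (induction rule: fs.span_induct_alt)
    case base
    show ?case by (rule exI[of _ "\<lambda>_. 0"]) simp
  next
    case (step k y z)
    then obtain a c where a: "a \<in> A" "y = b a" and c: "z = (\<Sum>a\<in>A. cscale (c a) (b a))" by blast
    have "cscale k y + z = (\<Sum>a'\<in>A. cscale ((if a' = a then k else 0) + c a') (b a'))"
      using assms a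
      by (simp add: c fs.scale_left_distrib sum.distrib if_distrib[of "\<lambda>k. cscale k _"] cong: if_cong)
    then show ?case by (intro exI)
  qed
next
  assume "\<exists>c. x = (\<Sum>a\<in>A. cscale (c a) (b a))"
  then show "x \<in> fs.span (b ` A)"
    by clarify (intro fs.span_sum fs.span_scale fs.span_base imageI)
qed

text \<open>The test value t = - a / (b + 1) makes the expression negative if a is not 0; the
  summand 1 covers b = 0.\<close>

lemma quadratic_nonneg_imp_0:
  fixes a b :: real
  assumes "\<And>t. 0 \<le> 2 * t * a + t\<^sup>2 * b" "b \<ge> 0"
  shows "a = 0"
proof (rule ccontr)
  assume "a \<noteq> 0"
  define t where "t = - a / (b + 1)"
  have t: "t * (b + 1) = - a" using assms(2) by (simp add: t_def)
  have "(b + 1)\<^sup>2 * (2 * t * a + t\<^sup>2 * b) = 2 * a * (b + 1) * (t * (b + 1)) + b * (t * (b + 1))\<^sup>2"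
    by (simp add: power2_eq_square algebra_simps)
  also have "\<dots> = - a\<^sup>2 * (b + 2)"
    unfolding t by (simp add: power2_eq_square algebra_simps)
  finally have "(b + 1)\<^sup>2 * (2 * t * a + t\<^sup>2 * b) = - a\<^sup>2 * (b + 2)" .
  moreover have "- a\<^sup>2 * (b + 2) < 0"
    using \<open>a \<noteq> 0\<close> assms(2) by (simp add: mult_pos_pos)
  moreover have "0 \<le> (b + 1)\<^sup>2 * (2 * t * a + t\<^sup>2 * b)"
    using assms(1)[of t] by simp
  ultimately show False by linarith
qed

locale ip_space =
  fixes H :: "('a \<Rightarrow> complex) set" and ip
  assumes ip_on: "inner_product_on H ip"
begin

lemma subspace_H: "fs.subspace H"
  using ip_on by (simp add: inner_product_on_def)

lemmas H_zero = fs.subspace_0[OF subspace_H]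
  and H_add = fs.subspace_add[OF subspace_H]
  and H_diff = fs.subspace_diff[OF subspace_H]
  and H_scale = fs.subspace_scale[OF subspace_H]
  and H_sum = fs.subspace_sum[OF subspace_H]

lemma ip_add_left: "g \<in> H \<Longrightarrow> h \<in> H \<Longrightarrow> v \<in> H \<Longrightarrow> ip (g + h) v = ip g v + ip h v"
  by (rule ip_on[unfolded inner_product_on_def, THEN conjunct2, THEN conjunct1, rule_format])

lemma ip_scale_left: "h \<in> H \<Longrightarrow> v \<in> H \<Longrightarrow> ip (cscale c h) v = c * ip h v"
  by (rule ip_on[unfolded inner_product_on_def, THEN conjunct2, THEN conjunct2, THEN conjunct1, rule_format])

lemma ip_cnj: "g \<in> H \<Longrightarrow> h \<in> H \<Longrightarrow> cnj (ip g h) = ip h g"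
  by (rule ip_on[unfolded inner_product_on_def, THEN conjunct2, THEN conjunct2, THEN conjunct2,
        THEN conjunct1, rule_format, symmetric])

lemma ip_pos: "h \<in> H \<Longrightarrow> h \<noteq> 0 \<Longrightarrow> Re (ip h h) > 0"
  by (rule ip_on[unfolded inner_product_on_def, THEN conjunct2, THEN conjunct2, THEN conjunct2,
        THEN conjunct2, rule_format])

lemma ip_add_right: "g \<in> H \<Longrightarrow> h \<in> H \<Longrightarrow> v \<in> H \<Longrightarrow> ip v (g + h) = ip v g + ip v h"
  using arg_cong[OF ip_add_left[of g h v], of cnj] by (simp add: ip_cnj H_add)

lemma ip_scale_right: "h \<in> H \<Longrightarrow> v \<in> H \<Longrightarrow> ip v (cscale c h) = cnj c * ip v h"
  using arg_cong[OF ip_scale_left[of h v c], of cnj] by (simp add: ip_cnj H_scale)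

lemma ip_zero_left [simp]: "v \<in> H \<Longrightarrow> ip 0 v = 0"
  using ip_scale_left[OF H_zero, of v 0] by simp

lemma ip_zero_right [simp]: "v \<in> H \<Longrightarrow> ip v 0 = 0"
  using ip_scale_right[OF H_zero, of v 0] by simp

lemma ip_diff_left: "g \<in> H \<Longrightarrow> h \<in> H \<Longrightarrow> v \<in> H \<Longrightarrow> ip (g - h) v = ip g v - ip h v"
  using ip_add_left[of "g - h" h v] H_diff by simp

lemma ip_diff_right: "g \<in> H \<Longrightarrow> h \<in> H \<Longrightarrow> v \<in> H \<Longrightarrow> ip v (g - h) = ip v g - ip v h"
  using ip_add_right[of "g - h" h v] H_diff by simp

lemma ip_sum_left: "(\<And>a. a \<in> A \<Longrightarrow> F a \<in> H) \<Longrightarrow> v \<in> H \<Longrightarrow> ip (\<Sum>a\<in>A. F a) v = (\<Sum>a\<in>A. ip (F a) v)"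
  by (induction A rule: infinite_finite_induct) (simp_all add: ip_add_left H_sum)

lemma ip_sum_right: "(\<And>a. a \<in> A \<Longrightarrow> F a \<in> H) \<Longrightarrow> v \<in> H \<Longrightarrow> ip v (\<Sum>a\<in>A. F a) = (\<Sum>a\<in>A. ip v (F a))"
  by (induction A rule: infinite_finite_induct) (simp_all add: ip_add_right H_sum)

lemma ip_eq_0D: "h \<in> H \<Longrightarrow> ip h h = 0 \<Longrightarrow> h = 0"
  using ip_pos by fastforce

lemma Re_ip_nonneg: "h \<in> H \<Longrightarrow> 0 \<le> Re (ip h h)"
  using ip_pos[of h] by (cases "h = 0") auto

lemma ip_self_of_real: "h \<in> H \<Longrightarrow> ip h h = complex_of_real (Re (ip h h))"
  using ip_cnj[of h h] by (simp add: complex_eq_iff)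

section \<open>Norm and metric\<close>

definition nrm :: "('a \<Rightarrow> complex) \<Rightarrow> real" where
  "nrm h = sqrt (Re (ip h h))"

lemma nrm_nonneg: "h \<in> H \<Longrightarrow> 0 \<le> nrm h"
  by (simp add: nrm_def Re_ip_nonneg)

lemma nrm_power2: "h \<in> H \<Longrightarrow> (nrm h)\<^sup>2 = Re (ip h h)"
  by (simp add: nrm_def Re_ip_nonneg)

lemma nrm_zero: "nrm 0 = 0"
  by (simp add: nrm_def H_zero)

lemma nrm_eq_0: "h \<in> H \<Longrightarrow> nrm h = 0 \<longleftrightarrow> h = 0"
  using ip_pos[of h] nrm_zero by (cases "h = 0") (auto simp: nrm_def)

lemma Re_ip_add:
  assumes "g \<in> H" "h \<in> H"
  shows "Re (ip (g + h) (g + h)) = Re (ip g g) + 2 * Re (ip g h) + Re (ip h h)"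
  using assms ip_cnj[of g h] by (simp add: ip_add_left ip_add_right H_add complex_eq_iff)

lemma cauchy_schwarz:
  assumes "g \<in> H" "h \<in> H"
  shows "norm (ip g h) \<le> nrm g * nrm h"
proof (cases "h = 0")
  case True
  then show ?thesis using assms by (simp add: nrm_zero)
next
  case False
  define q where "q = Re (ip h h)"
  have q: "q > 0" "ip h h = of_real q" using ip_pos[OF assms(2) False] ip_self_of_real[OF assms(2)] by (simp_all add: q_def)
  \<comment> \<open>The scalar for which g + c h is orthogonal to h.\<close>
  define c where "c = - ip g h / of_real q"
  have c1: "cnj c * ip g h = of_real (- ((norm (ip g h))\<^sup>2 / q))"
    using complex_norm_square[of "ip g h"] by (simp add: c_def mult.commute)
  have c2: "cnj c * (c * ip h h) = of_real ((norm (ip g h))\<^sup>2 / q)"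
    using complex_norm_square[of "ip g h"] q by (simp add: c_def field_simps)
  have "0 \<le> Re (ip (g + cscale c h) (g + cscale c h))"
    using assms by (intro Re_ip_nonneg H_add H_scale)
  also have "\<dots> = Re (ip g g) + 2 * Re (cnj c * ip g h) + Re (cnj c * (c * ip h h))"
    using assms by (simp only: Re_ip_add H_scale ip_scale_left ip_scale_right)
  also have "\<dots> = Re (ip g g) - (norm (ip g h))\<^sup>2 / q"
    by (simp only: c1 c2 Re_complex_of_real)
  finally have "(norm (ip g h))\<^sup>2 / q \<le> Re (ip g g)" by linarith
  then have "(norm (ip g h))\<^sup>2 \<le> Re (ip g g) * q"
    using q(1) by (simp only: pos_divide_le_eq)
  also have "\<dots> = (nrm g * nrm h)\<^sup>2"
    using assms by (simp only: power_mult_distrib nrm_power2 q_def)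
  finally show ?thesis
    by (rule power2_le_imp_le) (use assms nrm_nonneg in auto)
qed

lemma nrm_triangle:
  assumes "g \<in> H" "h \<in> H"
  shows "nrm (g + h) \<le> nrm g + nrm h"
proof -
  have "(nrm (g + h))\<^sup>2 \<le> (nrm g + nrm h)\<^sup>2"
    using assms cauchy_schwarz[OF assms] complex_Re_le_cmod[of "ip g h"]
    by (simp add: nrm_power2 H_add Re_ip_add power2_sum)
  then show ?thesis
    by (rule power2_le_imp_le) (use assms nrm_nonneg in auto)
qed

lemma nrm_scale: "h \<in> H \<Longrightarrow> nrm (cscale c h) = norm c * nrm h"
proof -
  assume h: "h \<in> H"
  have "ip (cscale c h) (cscale c h) = (c * cnj c) * ip h h"
    using h by (simp add: ip_scale_left ip_scale_right H_scale)
  also have "\<dots> = of_real ((norm c)\<^sup>2 * Re (ip h h))"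
    by (subst ip_self_of_real[OF h]) (simp add: complex_norm_square[symmetric])
  finally show ?thesis by (simp add: nrm_def real_sqrt_mult)
qed

lemma nrm_minus_commute: "g \<in> H \<Longrightarrow> h \<in> H \<Longrightarrow> nrm (g - h) = nrm (h - g)"
  using nrm_scale[of "h - g" "-1"] by (simp add: H_diff fs.scale_minus_left)

lemma nrm_sum: "(\<And>a. a \<in> A \<Longrightarrow> F a \<in> H) \<Longrightarrow> nrm (\<Sum>a\<in>A. F a) \<le> (\<Sum>a\<in>A. nrm (F a))"
proof (induction A rule: infinite_finite_induct)
  case (insert a A)
  then have "nrm (F a + (\<Sum>a\<in>A. F a)) \<le> nrm (F a) + (\<Sum>a\<in>A. nrm (F a))"
    by (intro order_trans[OF nrm_triangle add_left_mono]) (auto intro: H_sum)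
  then show ?case by (simp only: sum.insert[OF insert.hyps])
qed (simp_all add: nrm_zero)

lemma hdist_eq: "g \<in> H \<Longrightarrow> h \<in> H \<Longrightarrow> hdist H ip g h = nrm (g - h)"
  by (simp add: hdist_def nrm_def)

sublocale ms: Metric_space H "hdist H ip"
proof
  show "0 \<le> hdist H ip g h" for g h
    by (simp add: hdist_def Re_ip_nonneg H_diff)
  show "hdist H ip g h = hdist H ip h g" for g h
    using nrm_minus_commute[of g h] by (simp add: hdist_def nrm_def)
  show "hdist H ip g h = 0 \<longleftrightarrow> g = h" if "g \<in> H" "h \<in> H" for g h
    using that by (simp add: hdist_eq nrm_eq_0 H_diff)
  show "hdist H ip g v \<le> hdist H ip g h + hdist H ip h v" if "g \<in> H" "h \<in> H" "v \<in> H" for g h v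
    using that nrm_triangle[of "g - h" "h - v"] by (simp add: hdist_eq H_diff)
qed

lemma hilbert_topology_eq: "hilbert_topology H ip = ms.mtopology"
  by (simp add: hilbert_topology_def)

lemma topspace_hilbert [simp]: "topspace (hilbert_topology H ip) = H"
  by (simp add: hilbert_topology_eq)

text \<open>The representer minimises \<open>\<parallel>h\<parallel>\<^sup>2 - 2 Re \<phi>(h)\<close>; the parallelogram law makes minimising sequences
  Cauchy.\<close>

theorem riesz_representation:
  assumes complete: "ms.mcomplete"
    and add: "\<And>g h. g \<in> H \<Longrightarrow> h \<in> H \<Longrightarrow> \<phi> (g + h) = \<phi> g + \<phi> h"
    and scale: "\<And>c h. h \<in> H \<Longrightarrow> \<phi> (cscale c h) = c * \<phi> h"
    and bounded: "\<And>h. h \<in> H \<Longrightarrow> norm (\<phi> h) \<le> C * nrm h"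
  obtains g where "g \<in> H" "\<And>h. h \<in> H \<Longrightarrow> \<phi> h = ip h g"
proof -
  define J where "J h = Re (ip h h) - 2 * Re (\<phi> h)" for h
  \<comment> \<open>Completing the square in the norm of h, with the bound C on the
    functional.\<close>
  have lower: "- (C\<^sup>2) \<le> J h" if "h \<in> H" for h
  proof -
    have "Re (\<phi> h) \<le> C * nrm h"
      using bounded[OF that] complex_Re_le_cmod[of "\<phi> h"] by linarith
    moreover have "0 \<le> (nrm h - C)\<^sup>2" by simp
    ultimately show ?thesis
      using nrm_power2[OF that] by (simp add: J_def power2_diff mult.commute)
  qed
  define m where "m = Inf (J ` H)"
  have bdd: "bdd_below (J ` H)" using lower by (rule bdd_belowI2)
  have m_le: "m \<le> J h" if "h \<in> H" for h
    unfolding m_def using that bdd by (intro cInf_lower) auto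
  have "\<exists>h\<in>H. J h < m + 1 / Suc n" for n
  proof -
    have "Inf (J ` H) < m + 1 / Suc n" by (simp add: m_def)
    then show ?thesis using cInf_lessD[of "J ` H"] H_zero by blast
  qed
  then have "\<forall>n. \<exists>h. h \<in> H \<and> J h < m + 1 / Suc n" by blast
  from choice[OF this] obtain s where s: "\<And>n. s n \<in> H" "\<And>n. J (s n) < m + 1 / Suc n" by blast
  \<comment> \<open>The value of J at the midpoint is at least m, so the excess of J over m at the
    end points controls their distance.\<close>
  have par: "(nrm (a - b))\<^sup>2 \<le> 2 * J a + 2 * J b - 4 * m" if ab: "a \<in> H" "b \<in> H" for a b
  proof -
    let ?v = "cscale (1/2) (a + b)"
    have "2 * Re (\<phi> ?v) = Re (\<phi> a) + Re (\<phi> b)" using ab by (simp add: scale add H_add)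
    moreover have "4 * Re (ip ?v ?v) = Re (ip (a + b) (a + b))"
      using ab by (simp add: ip_scale_left ip_scale_right H_add H_scale)
    ultimately have 1: "4 * m \<le> Re (ip (a + b) (a + b)) - 4 * Re (\<phi> a) - 4 * Re (\<phi> b)"
      using m_le[OF H_scale[OF H_add[OF ab]], of "1/2"] unfolding J_def by linarith
    have "Re (ip (a - b) (a - b)) = Re (ip a a) - 2 * Re (ip a b) + Re (ip b b)"
      using ab ip_cnj[of a b] by (simp add: ip_diff_left ip_diff_right H_diff complex_eq_iff)
    with 1 show ?thesis using ab by (simp add: nrm_power2 H_diff J_def Re_ip_add)
  qed
  have "ms.MCauchy s"
    unfolding ms.MCauchy_def
  proof (intro conjI allI impI)
    show "range s \<subseteq> H" using s by auto
    fix \<epsilon> :: real assume \<epsilon>: "\<epsilon> > 0"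
    obtain N where N: "4 / real (Suc N) < \<epsilon>\<^sup>2"
      using reals_Archimedean[of "\<epsilon>\<^sup>2 / 4"] \<epsilon> by (auto simp: field_simps)
    have "hdist H ip (s n) (s n') < \<epsilon>" if n: "N \<le> n" "N \<le> n'" for n n'
    proof -
      have le: "1 / real (Suc n) \<le> 1 / real (Suc N)" if "N \<le> n" for n
        using that by (simp add: frac_le)
      have "(nrm (s n - s n'))\<^sup>2 \<le> 4 / real (Suc N)"
        using par[OF s(1) s(1), of n n'] s(2)[of n] s(2)[of n'] le[OF n(1)] le[OF n(2)] by linarith
      then have "(nrm (s n - s n'))\<^sup>2 < \<epsilon>\<^sup>2" using N by linarith
      then show ?thesis using \<epsilon> s(1) by (simp add: hdist_eq power2_less_imp_less)
    qed
    then show "\<exists>N. \<forall>n n'. N \<le> n \<longrightarrow> N \<le> n' \<longrightarrow> hdist H ip (s n) (s n') < \<epsilon>" by blast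
  qed
  then obtain g where g: "limitin ms.mtopology s g sequentially"
    using complete unfolding ms.mcomplete_def by blast
  then have gH: "g \<in> H" and lim: "(\<lambda>n. hdist H ip (s n) g) \<longlonglongrightarrow> 0"
    by (auto simp: ms.limitin_metric_dist_null)
  have ip_lim: "(\<lambda>n. ip v (s n)) \<longlonglongrightarrow> ip v g" if v: "v \<in> H" for v
  proof -
    have "(\<lambda>n. ip v (s n) - ip v g) \<longlonglongrightarrow> 0"
    proof (rule Lim_null_comparison)
      show "\<forall>\<^sub>F n in sequentially. norm (ip v (s n) - ip v g) \<le> nrm v * hdist H ip (s n) g"
        using v s(1) gH cauchy_schwarz[of v "s _ - g"]
        by (intro always_eventually allI) (simp add: ip_diff_right[symmetric] hdist_eq H_diff)
      show "(\<lambda>n. nrm v * hdist H ip (s n) g) \<longlonglongrightarrow> 0"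
        using tendsto_mult_left[OF lim, of "nrm v"] by simp
    qed
    then show ?thesis by (simp add: LIM_zero_iff)
  qed
  \<comment> \<open>First variation of J in direction v. The s n are only approximate minimisers, so
    the inequality holds up to 1 / (n + 1) and is passed to the limit g.\<close>
  have re: "Re (ip v g) = Re (\<phi> v)" if v: "v \<in> H" for v
  proof -
    have "0 \<le> 2 * t * (Re (ip v g) - Re (\<phi> v)) + t\<^sup>2 * Re (ip v v)" (is "0 \<le> ?q t g") for t :: real
    proof (rule tendsto_le[OF sequentially_bot])
      show "(\<lambda>n. 1 / real (Suc n) + ?q t (s n))
        \<longlonglongrightarrow> ?q t g"
      proof -
        have "(\<lambda>n. 1 / real (Suc n)) \<longlonglongrightarrow> 0"
          using LIMSEQ_inverse_real_of_nat by (simp only: inverse_eq_divide)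
        moreover have "(\<lambda>n. ?q t (s n))
          \<longlonglongrightarrow> ?q t g"
          by (intro tendsto_intros ip_lim v)
        ultimately have "(\<lambda>n. 1 / real (Suc n) + ?q t (s n))
          \<longlonglongrightarrow> 0 + ?q t g"
          by (rule tendsto_add)
        then show ?thesis by (simp only: add_0_left)
      qed
      show "(\<lambda>n. 0) \<longlonglongrightarrow> (0::real)" by simp
      show "\<forall>\<^sub>F n in sequentially. 0 \<le> 1 / real (Suc n) + ?q t (s n)"
      proof (intro always_eventually allI)
        fix n
        let ?v = "cscale (of_real t) v"
        have "J (s n + ?v) = J (s n) + ?q t (s n)"
        proof -
          have "Re (ip (s n) v) = Re (ip v (s n))" using arg_cong[OF ip_cnj[OF v s(1), of n], of Re] by simp
          then show ?thesis
            using v s(1)[of n]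
            by (simp add: J_def Re_ip_add H_scale ip_scale_left ip_scale_right add scale power2_eq_square algebra_simps)
        qed
        moreover have "m \<le> J (s n + ?v)" using v s(1) by (intro m_le H_add H_scale)
        ultimately show "0 \<le> 1 / real (Suc n) + ?q t (s n)"
          using s(2)[of n] by linarith
      qed
    qed
    from quadratic_nonneg_imp_0[OF this Re_ip_nonneg[OF v]] show ?thesis by simp
  qed
  \<comment> \<open>The identity of real parts, applied to \<i> h, gives the imaginary
    parts.\<close>
  have "\<phi> h = ip h g" if h: "h \<in> H" for h
    using re[OF h] re[OF H_scale[OF h, of \<i>]] h gH by (simp add: ip_scale_left scale complex_eq_iff)
  with gH show thesis by (rule that)
qed

text \<open>By homogeneity a bound near 0 is a global linear bound: a nonzero h is rescaled to norm
  \<delta> / 2, inside the given neighbourhood.\<close>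

lemma bounded_on_neighbourhood:
  assumes "openin (hilbert_topology H ip) U" "0 \<in> U" "\<And>h. h \<in> U \<Longrightarrow> norm (\<phi> h) < 1"
    and scale: "\<And>c h. h \<in> H \<Longrightarrow> \<phi> (cscale c h) = c * \<phi> h"
  obtains C where "\<And>h. h \<in> H \<Longrightarrow> norm (\<phi> h) \<le> C * nrm h"
proof -
  obtain \<delta> where \<delta>: "\<delta> > 0" "ms.mball 0 \<delta> \<subseteq> U"
    using assms(1,2) unfolding hilbert_topology_eq ms.openin_mtopology by blast
  have "norm (\<phi> h) \<le> (2 / \<delta>) * nrm h" if h: "h \<in> H" for h
  proof (cases "h = 0")
    case True
    then show ?thesis using scale[OF h, of 0] by (simp add: nrm_zero)
  next
    case False
    then have pos: "nrm h > 0" using nrm_nonneg[OF h] nrm_eq_0[OF h] by linarith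
    let ?c = "complex_of_real (\<delta> / (2 * nrm h))"
    have nc: "norm ?c = \<delta> / (2 * nrm h)" using pos \<delta>(1) by (simp add: norm_divide norm_mult)
    have "nrm (cscale ?c h) < \<delta>"
      unfolding nrm_scale[OF h] nc using pos \<delta>(1) by simp
    moreover have xH: "cscale ?c h \<in> H" using h by (rule H_scale)
    ultimately have "hdist H ip 0 (cscale ?c h) < \<delta>"
      using nrm_minus_commute[OF H_zero xH] by (simp only: hdist_eq H_zero diff_zero)
    then have "cscale ?c h \<in> U"
      using \<delta>(2) xH H_zero unfolding subset_iff ms.in_mball by blast
    then have "norm ?c * norm (\<phi> h) < 1"
      using assms(3)[of "cscale ?c h"] by (simp only: scale[OF h] norm_mult)
    then show ?thesis unfolding nc using pos \<delta>(1) by (simp add: field_simps)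
  qed
  then show thesis by (rule that)
qed

text \<open>Gram-Schmidt within the induction: the new vector b is replaced by its part e orthogonal
  to the old vectors, so that a multiple of e corrects the old projection without disturbing
  it.\<close>

lemma orthogonal_decomposition:
  assumes "finite B" "B \<subseteq> H" "g \<in> H"
  shows "\<exists>v\<in>fs.span B. \<forall>b\<in>B. ip b (g - v) = 0"
  using assms
proof (induction B arbitrary: g)
  case empty
  then show ?case using fs.span_zero by blast
next
  case (insert b B)
  have span_H: "fs.span B \<subseteq> H" using insert.prems by (intro fs.span_minimal subspace_H) auto
  have ip_span: "ip x y = 0" if x: "x \<in> fs.span B" and y: "y \<in> H" "\<forall>b\<in>B. ip b y = 0" for x y
  proof -
    have "fs.subspace {x \<in> H. ip x y = 0}"
      using y(1) by (intro fs.subspaceI) (simp_all add: H_zero H_add H_scale ip_add_left ip_scale_left)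
    moreover have "B \<subseteq> {x \<in> H. ip x y = 0}"
      using y insert.prems(1) by auto
    ultimately show ?thesis using fs.span_minimal x by blast
  qed
  obtain v0 where v0: "v0 \<in> fs.span B" "\<forall>x\<in>B. ip x (g - v0) = 0"
    using insert.IH[of g] insert.prems by blast
  obtain b0 where b0: "b0 \<in> fs.span B" "\<forall>x\<in>B. ip x (b - b0) = 0"
    using insert.IH[of b] insert.prems by blast
  define e where "e = b - b0"
  have bH: "b \<in> H" and BH: "B \<subseteq> H" using insert.prems by auto
  have H: "v0 \<in> H" "b0 \<in> H" "e \<in> H" "g - v0 \<in> H"
    using v0 b0 span_H insert.prems by (auto simp: e_def intro: H_diff)
  \<comment> \<open>If e = 0, then b lies in the old span and needs no correction. The conjugate is
    due to c entering the second argument of \<open>ip\<close>.\<close>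
  define c where "c = (if e = 0 then 0 else cnj (ip e (g - v0)) / ip e e)"
  define v where "v = v0 + cscale c e"
  have "b \<in> fs.span (insert b B)" by (simp add: fs.span_base)
  moreover have "fs.span B \<subseteq> fs.span (insert b B)" by (rule fs.span_mono) auto
  ultimately have "v \<in> fs.span (insert b B)"
    using v0(1) b0(1) by (auto simp: v_def e_def intro!: fs.span_add fs.span_scale fs.span_diff)
  moreover have eq: "g - v = (g - v0) - cscale c e" by (simp add: v_def)
  have B: "ip x (g - v) = 0" if "x \<in> B" for x
    unfolding eq using that v0(2) b0(2) BH H
    by (simp add: ip_diff_right H_scale ip_scale_right e_def[symmetric] subset_iff)
  have "ip e (g - v) = 0"
  proof (cases "e = 0")
    case False
    then have "ip e e \<noteq> 0" using ip_eq_0D H(3) by blast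
    moreover have "cnj (ip e e) = ip e e" using H by (simp add: ip_cnj)
    ultimately show ?thesis unfolding eq using H False
      by (simp add: ip_diff_right H_scale ip_scale_right c_def)
  qed (use H in \<open>simp add: v_def insert.prems H_diff\<close>)
  moreover have "ip b0 (g - v) = 0"
    using ip_span[OF b0(1)] B H by (simp add: eq H_diff H_scale)
  moreover have "b = e + b0" by (simp add: e_def)
  ultimately have "ip b (g - v) = 0"
    using ip_add_left[of e b0 "g - v"] H by (simp add: eq H_diff H_scale)
  with B \<open>v \<in> fs.span (insert b B)\<close> show ?case by blast
qed

end


section \<open>Rigged spaces with an eigenbasis\<close>

text \<open>Isolates the linear algebra: an independent family graded by \<open>deg\<close> with
  finitely many members per level, \<open>W n\<close> its span up to level n, and an operator
  \<open>K\<close> known only on finite combinations, which it multiplies termwise. \<open>K\<close>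
  stands for the adjoint, whence the conjugated eigenvalues.\<close>

locale rigged_eigenbasis = ip_space H ip
  for H :: "('a \<Rightarrow> complex) set" and ip +
  fixes I :: "'i set" and deg :: "'i \<Rightarrow> nat" and w :: "'i \<Rightarrow> 'a \<Rightarrow> complex"
    and lam :: "'i \<Rightarrow> complex" and W :: "nat \<Rightarrow> ('a \<Rightarrow> complex) set"
    and K :: "('a \<Rightarrow> complex) \<Rightarrow> 'a \<Rightarrow> complex"
  assumes finite_level: "\<And>n. finite {\<iota> \<in> I. deg \<iota> \<le> n}"
    and w_H: "\<And>\<iota>. \<iota> \<in> I \<Longrightarrow> w \<iota> \<in> H"
    and w_independent: "\<And>F c \<iota>. finite F \<Longrightarrow> F \<subseteq> I \<Longrightarrow> (\<Sum>\<iota>\<in>F. cscale (c \<iota>) (w \<iota>)) = 0 \<Longrightarrow> \<iota> \<in> F \<Longrightarrow> c \<iota> = 0"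
    and W_eq: "\<And>n. W n = fs.span (w ` {\<iota> \<in> I. deg \<iota> \<le> n})"
    and K_eq: "\<And>F c. finite F \<Longrightarrow> F \<subseteq> I \<Longrightarrow>
      K (\<Sum>\<iota>\<in>F. cscale (c \<iota>) (w \<iota>)) = (\<Sum>\<iota>\<in>F. cscale (cnj (lam \<iota>) * c \<iota>) (w \<iota>))"
begin

section \<open>Levels and dual basis vectors\<close>

definition level :: "nat \<Rightarrow> 'i set" where
  "level n = {\<iota> \<in> I. deg \<iota> \<le> n}"

lemma level: "finite (level n)" "level n \<subseteq> I"
  using finite_level by (auto simp: level_def)

lemma level_mono: "n \<le> m \<Longrightarrow> level n \<subseteq> level m"
  by (auto simp: level_def)

lemma in_level: "\<iota> \<in> I \<Longrightarrow> \<iota> \<in> level (deg \<iota>)"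
  by (simp add: level_def)

lemma w_H': "\<iota> \<in> level n \<Longrightarrow> w \<iota> \<in> H"
  using w_H level by blast

lemma W_iff: "v \<in> W n \<longleftrightarrow> (\<exists>c. v = (\<Sum>\<iota>\<in>level n. cscale (c \<iota>) (w \<iota>)))"
  unfolding W_eq level_def[symmetric] by (rule span_image_family[OF level(1)])

lemma W_subspace: "fs.subspace (W n)"
  unfolding W_eq by (rule fs.subspace_span)

lemma W_H: "v \<in> W n \<Longrightarrow> v \<in> H"
  unfolding W_iff by (auto intro!: H_sum H_scale w_H')

lemma w_in_W: "\<iota> \<in> level n \<Longrightarrow> w \<iota> \<in> W n"
  unfolding W_eq level_def by (intro fs.span_base imageI)

lemma ip_W:
  assumes "v \<in> W n" "x \<in> H" "y \<in> H" "\<And>\<kappa>. \<kappa> \<in> level n \<Longrightarrow> ip (w \<kappa>) x = ip (w \<kappa>) y"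
  shows "ip v x = ip v y"
proof -
  obtain c where v: "v = (\<Sum>\<iota>\<in>level n. cscale (c \<iota>) (w \<iota>))" using assms(1) W_iff by blast
  have e: "ip v z = (\<Sum>\<iota>\<in>level n. c \<iota> * ip (w \<iota>) z)" if "z \<in> H" for z
    unfolding v using that w_H' by (subst ip_sum_left) (auto intro: H_scale simp: ip_scale_left)
  show ?thesis using assms by (simp add: e)
qed

lemma W_eqI:
  assumes "x \<in> W n" "y \<in> W n" "\<And>\<kappa>. \<kappa> \<in> level n \<Longrightarrow> ip (w \<kappa>) x = ip (w \<kappa>) y"
  shows "x = y"
proof -
  have xy: "x \<in> H" "y \<in> H" using assms W_H by auto
  have "x - y \<in> W n" using assms(1,2) by (rule fs.subspace_diff[OF W_subspace])
  from ip_W[OF this xy assms(3)] have "ip (x - y) (x - y) = 0"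
    using xy by (simp add: ip_diff_right H_diff)
  from ip_eq_0D[OF H_diff[OF xy] this] show ?thesis by simp
qed

text \<open>The part e of \<open>w \<iota>\<close> orthogonal to the other basis vectors of the
  level is nonzero by independence. Its product with \<open>w \<iota>\<close> equals its squared
  norm, which serves to normalise it.\<close>

lemma dual_vector:
  assumes \<iota>: "\<iota> \<in> level n"
  shows "\<exists>u\<in>W n. \<forall>\<kappa>\<in>level n. ip (w \<kappa>) u = (if \<kappa> = \<iota> then 1 else 0)"
proof -
  let ?L = "level n - {\<iota>}"
  have L: "finite ?L" using level by simp
  have wH: "w \<iota> \<in> H" "w ` ?L \<subseteq> H" using w_H' \<iota> by auto
  obtain v where v: "v \<in> fs.span (w ` ?L)" "\<forall>b\<in>w ` ?L. ip b (w \<iota> - v) = 0"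
    using orthogonal_decomposition[OF finite_imageI[OF L] wH(2,1)] by blast
  obtain c where c: "v = (\<Sum>\<kappa>\<in>?L. cscale (c \<kappa>) (w \<kappa>))"
    using v(1) span_image_family[OF L] by blast
  have vW: "v \<in> W n"
    unfolding c using w_in_W
    by (intro fs.subspace_sum[OF W_subspace] fs.subspace_scale[OF W_subspace]) blast
  define e where "e = w \<iota> - v"
  have eW: "e \<in> W n"
    unfolding e_def using w_in_W[OF \<iota>] vW by (rule fs.subspace_diff[OF W_subspace])
  have eH: "e \<in> H" and vH: "v \<in> H" using W_H eW vW by auto
  have orth: "ip (w \<kappa>) e = 0" if "\<kappa> \<in> ?L" for \<kappa>
    using v(2) that by (simp add: e_def)
  have "e \<noteq> 0"
  proof
    assume "e = 0"
    have "(\<Sum>\<kappa>\<in>level n. cscale (if \<kappa> = \<iota> then 1 else - c \<kappa>) (w \<kappa>))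
      = cscale 1 (w \<iota>) + (\<Sum>\<kappa>\<in>?L. cscale (- c \<kappa>) (w \<kappa>))"
    proof -
      have "(\<Sum>\<kappa>\<in>?L. cscale (if \<kappa> = \<iota> then 1 else - c \<kappa>) (w \<kappa>)) = (\<Sum>\<kappa>\<in>?L. cscale (- c \<kappa>) (w \<kappa>))"
        by (intro sum.cong) auto
      then show ?thesis by (simp only: sum.remove[OF level(1) \<iota>] simp_thms if_True)
    qed
    also have "\<dots> = 0"
      using \<open>e = 0\<close> by (simp only: fs.scale_one fs.scale_minus_left sum_negf c[symmetric]) (simp add: e_def)
    finally show False
      using w_independent[OF level, of "\<lambda>\<kappa>. if \<kappa> = \<iota> then 1 else - c \<kappa>" n \<iota>] \<iota> by simp
  qed
  define q where "q = ip e e"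
  have q: "q \<noteq> 0" using ip_eq_0D[OF eH] \<open>e \<noteq> 0\<close> by (auto simp: q_def)
  have q': "cnj q = q" unfolding q_def using eH by (rule ip_cnj[OF eH])
  have LH: "w \<kappa> \<in> H" if "\<kappa> \<in> ?L" for \<kappa>
    using w_H' that by blast
  have "ip v e = (\<Sum>\<kappa>\<in>?L. ip (cscale (c \<kappa>) (w \<kappa>)) e)"
    unfolding c by (rule ip_sum_left[OF H_scale[OF LH] eH])
  also have "\<dots> = 0"
  proof (rule sum.neutral, rule ballI)
    fix \<kappa> assume \<kappa>: "\<kappa> \<in> ?L"
    show "ip (cscale (c \<kappa>) (w \<kappa>)) e = 0"
      by (simp only: ip_scale_left[OF LH[OF \<kappa>] eH] orth[OF \<kappa>] mult_zero_right)
  qed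
  finally have "ip v e = 0" .
  moreover have "w \<iota> = e + v" by (simp add: e_def)
  ultimately have we: "ip (w \<iota>) e = q" using eH vH by (simp only: ip_add_left q_def add_0_right)
  let ?u = "cscale (1 / q) e"
  have "?u \<in> W n" using eW by (rule fs.subspace_scale[OF W_subspace])
  moreover have "ip (w \<kappa>) ?u = (if \<kappa> = \<iota> then 1 else 0)" if "\<kappa> \<in> level n" for \<kappa>
    using that orth[of \<kappa>] we q q' eH w_H'[OF that] by (simp add: ip_scale_right)
  ultimately show ?thesis by blast
qed

text \<open>On each level the dual basis vector of \<open>w \<iota>\<close>. The value 0 on levels
  without \<iota> is forced: the projection of a dual vector to such a level is orthogonal to
  everything in it.\<close>

definition u :: "'i \<Rightarrow> nat \<Rightarrow> 'a \<Rightarrow> complex" where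
  "u \<iota> n = (if \<iota> \<in> level n
     then SOME x. x \<in> W n \<and> (\<forall>\<kappa>\<in>level n. ip (w \<kappa>) x = (if \<kappa> = \<iota> then 1 else 0)) else 0)"

lemma u: "u \<iota> n \<in> W n" "\<kappa> \<in> level n \<Longrightarrow> ip (w \<kappa>) (u \<iota> n) = (if \<kappa> = \<iota> then 1 else 0)"
proof -
  have "u \<iota> n \<in> W n \<and> (\<forall>\<kappa>\<in>level n. ip (w \<kappa>) (u \<iota> n) = (if \<kappa> = \<iota> then 1 else 0))"
  proof (cases "\<iota> \<in> level n")
    case True
    have "\<exists>x. x \<in> W n \<and> (\<forall>\<kappa>\<in>level n. ip (w \<kappa>) x = (if \<kappa> = \<iota> then 1 else 0))"
      using dual_vector[OF True] by blast
    from someI_ex[OF this] show ?thesis using True by (simp add: u_def)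
  next
    case False
    have "ip (w \<kappa>) 0 = 0" if "\<kappa> \<in> level n" for \<kappa>
      using w_H'[OF that] by (rule ip_zero_right)
    then show ?thesis using False fs.subspace_0[OF W_subspace] by (auto simp: u_def)
  qed
  then show "u \<iota> n \<in> W n" "\<kappa> \<in> level n \<Longrightarrow> ip (w \<kappa>) (u \<iota> n) = (if \<kappa> = \<iota> then 1 else 0)" by blast+
qed

lemma u_H: "u \<iota> n \<in> H"
  using u(1) by (rule W_H)

lemma u_eq_0: "\<iota> \<notin> level n \<Longrightarrow> u \<iota> n = 0"
  by (simp add: u_def)

text \<open>The vector of \<open>W n\<close> with prescribed products with the basis, up to a
  conjugation caused by the second argument of \<open>ip\<close>.\<close>

definition combine :: "nat \<Rightarrow> ('i \<Rightarrow> complex) \<Rightarrow> 'a \<Rightarrow> complex" where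
  "combine n a = (\<Sum>\<iota>\<in>level n. cscale (a \<iota>) (u \<iota> n))"

lemma combine_W: "combine n a \<in> W n"
  unfolding combine_def by (intro fs.subspace_sum[OF W_subspace] fs.subspace_scale[OF W_subspace] u)

lemma ip_combine:
  assumes "\<kappa> \<in> level n"
  shows "ip (w \<kappa>) (combine n a) = cnj (a \<kappa>)"
proof -
  have "ip (w \<kappa>) (combine n a) = (\<Sum>\<iota>\<in>level n. cnj (a \<iota>) * ip (w \<kappa>) (u \<iota> n))"
    unfolding combine_def using assms w_H' u_H
    by (subst ip_sum_right) (auto intro: H_scale simp: ip_scale_right)
  also have "\<dots> = (\<Sum>\<iota>\<in>level n. if \<kappa> = \<iota> then cnj (a \<iota>) else 0)"
    using u(2)[OF assms] by (intro sum.cong) auto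
  also have "\<dots> = cnj (a \<kappa>)" using assms level(1) by simp
  finally show ?thesis .
qed

text \<open>Since the basis spans \<open>W n\<close>, orthogonality to the space is a condition on
  finitely many products. \<open>combine\<close> supplies the existence that the definite
  description needs.\<close>

lemma orth_proj_iff:
  assumes g: "g \<in> H" and v: "v \<in> W n"
  shows "orth_proj ip (W n) g = v \<longleftrightarrow> (\<forall>\<kappa>\<in>level n. ip (w \<kappa>) g = ip (w \<kappa>) v)"
proof -
  have char: "x \<in> W n \<and> (\<forall>y\<in>W n. ip (g - x) y = 0) \<longleftrightarrow> x \<in> W n \<and> (\<forall>\<kappa>\<in>level n. ip (w \<kappa>) g = ip (w \<kappa>) x)" for x
  proof (intro conj_cong refl iffI ballI)
    fix \<kappa> assume x: "x \<in> W n" and "\<forall>y\<in>W n. ip (g - x) y = 0" and \<kappa>: "\<kappa> \<in> level n"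
    then have "ip (g - x) (w \<kappa>) = 0" using w_in_W by blast
    then have "ip (w \<kappa>) (g - x) = 0"
      using ip_cnj[of "g - x" "w \<kappa>"] g W_H[OF x] w_H'[OF \<kappa>] by (simp add: H_diff)
    then show "ip (w \<kappa>) g = ip (w \<kappa>) x"
      using g W_H[OF x] w_H'[OF \<kappa>] by (simp add: ip_diff_right)
  next
    fix y assume x: "x \<in> W n" and eq: "\<forall>\<kappa>\<in>level n. ip (w \<kappa>) g = ip (w \<kappa>) x" and y: "y \<in> W n"
    have "ip y g = ip y x" using ip_W[OF y g W_H[OF x]] eq by blast
    then have "ip y (g - x) = 0" using g W_H[OF x] W_H[OF y] by (simp add: ip_diff_right)
    then show "ip (g - x) y = 0"
      using ip_cnj[of y "g - x"] g W_H[OF x] W_H[OF y] by (simp add: H_diff)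
  qed
  have "\<exists>!x. x \<in> W n \<and> (\<forall>\<kappa>\<in>level n. ip (w \<kappa>) g = ip (w \<kappa>) x)"
  proof (rule ex1I)
    show "combine n (\<lambda>\<kappa>. cnj (ip (w \<kappa>) g)) \<in> W n \<and>
      (\<forall>\<kappa>\<in>level n. ip (w \<kappa>) g = ip (w \<kappa>) (combine n (\<lambda>\<kappa>. cnj (ip (w \<kappa>) g))))"
      by (simp add: combine_W ip_combine)
  next
    fix x assume "x \<in> W n \<and> (\<forall>\<kappa>\<in>level n. ip (w \<kappa>) g = ip (w \<kappa>) x)"
    then show "x = combine n (\<lambda>\<kappa>. cnj (ip (w \<kappa>) g))"
      by (intro W_eqI[OF _ combine_W]) (simp_all add: ip_combine)
  qed
  from the1_equality[OF this] theI'[OF this] show ?thesis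
    unfolding orth_proj_def char using v by blast
qed

section \<open>The projective limit in coordinates\<close>

lemma Phi_star_iff:
  "\<mu> \<in> Phi_star ip W \<longleftrightarrow> (\<forall>n. \<mu> n \<in> W n \<and> (\<forall>\<kappa>\<in>level n. ip (w \<kappa>) (\<mu> (Suc n)) = ip (w \<kappa>) (\<mu> n)))"
proof -
  have "(\<forall>n. \<mu> n \<in> W n \<and> orth_proj ip (W n) (\<mu> (Suc n)) = \<mu> n) \<longleftrightarrow>
    (\<forall>n. \<mu> n \<in> W n \<and> (\<forall>\<kappa>\<in>level n. ip (w \<kappa>) (\<mu> (Suc n)) = ip (w \<kappa>) (\<mu> n)))"
    using orth_proj_iff[OF W_H] by blast
  then show ?thesis by (simp add: Phi_star_def)
qed

text \<open>Compatibility under the projections means that the product with each basis vector no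
  longer changes once its index has entered the level.\<close>

lemma Phi_starI:
  assumes "\<And>n. \<mu> n \<in> W n" "\<And>n \<kappa>. \<kappa> \<in> level n \<Longrightarrow> ip (w \<kappa>) (\<mu> n) = a \<kappa>"
  shows "\<mu> \<in> Phi_star ip W"
  using assms level_mono[of n "Suc n" for n] by (fastforce simp: Phi_star_iff)

lemma Phi_star_W: "\<mu> \<in> Phi_star ip W \<Longrightarrow> \<mu> n \<in> W n"
  by (simp add: Phi_star_iff)

lemma Phi_star_const:
  assumes "\<mu> \<in> Phi_star ip W" "\<kappa> \<in> level n" "n \<le> m"
  shows "ip (w \<kappa>) (\<mu> m) = ip (w \<kappa>) (\<mu> n)"
  using assms(3)
proof (induction m rule: dec_induct)
  case (step m)
  then have "\<kappa> \<in> level m" using assms(2) level_mono by blast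
  then show ?case using step.IH assms(1) by (simp add: Phi_star_iff)
qed simp

lemma pairing_eq:
  assumes "\<mu> \<in> Phi_star ip W" "v \<in> W n"
  shows "pairing ip v \<mu> = ip v (\<mu> n)"
proof -
  have "ip v (\<mu> m) = ip v (\<mu> n)" if "n \<le> m" for m
    using Phi_star_const[OF assms(1) _ that] W_H Phi_star_W[OF assms(1)]
    by (intro ip_W[OF assms(2)]) auto
  then have "eventually (\<lambda>m. ip v (\<mu> m) = ip v (\<mu> n)) sequentially"
    by (rule eventually_sequentiallyI)
  then have "(\<lambda>m. ip v (\<mu> m)) \<longlonglongrightarrow> ip v (\<mu> n)"
    by (rule tendsto_eventually)
  then show ?thesis unfolding pairing_def by (rule limI)
qed

lemma pairing_w: "\<mu> \<in> Phi_star ip W \<Longrightarrow> \<kappa> \<in> level n \<Longrightarrow> pairing ip (w \<kappa>) \<mu> = ip (w \<kappa>) (\<mu> n)"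
  by (rule pairing_eq[OF _ w_in_W])

lemma Phi_star_eqI:
  assumes "\<mu> \<in> Phi_star ip W" "\<nu> \<in> Phi_star ip W"
    and "\<And>\<kappa>. \<kappa> \<in> I \<Longrightarrow> pairing ip (w \<kappa>) \<mu> = pairing ip (w \<kappa>) \<nu>"
  shows "\<mu> = \<nu>"
proof
  fix n
  show "\<mu> n = \<nu> n"
  proof (rule W_eqI[OF Phi_star_W[OF assms(1)] Phi_star_W[OF assms(2)]])
    fix \<kappa> assume \<kappa>: "\<kappa> \<in> level n"
    then show "ip (w \<kappa>) (\<mu> n) = ip (w \<kappa>) (\<nu> n)"
      using assms(3)[of \<kappa>] level(2) pairing_w[OF assms(1) \<kappa>] pairing_w[OF assms(2) \<kappa>] by auto
  qed
qed

text \<open>No growth condition on the coefficients: the projective limit is the full product of one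
  copy of the scalars per index.\<close>

lemma combine_Phi_star: "(\<lambda>n. combine n a) \<in> Phi_star ip W"
  by (rule Phi_starI[OF combine_W ip_combine])

lemma pairing_combine: "\<kappa> \<in> I \<Longrightarrow> pairing ip (w \<kappa>) (\<lambda>n. combine n a) = cnj (a \<kappa>)"
  using pairing_w[OF combine_Phi_star in_level] ip_combine[OF in_level] by simp

lemma u_Phi_star: "u \<iota> \<in> Phi_star ip W"
  by (rule Phi_starI[OF u])

lemma pairing_w_u: "\<kappa> \<in> I \<Longrightarrow> pairing ip (w \<kappa>) (u \<iota>) = (if \<kappa> = \<iota> then 1 else 0)"
  using pairing_w[OF u_Phi_star in_level] u(2)[OF in_level] by simp

lemma Phi_star_add:
  assumes "\<mu> \<in> Phi_star ip W" "\<nu> \<in> Phi_star ip W"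
  shows "\<mu> + \<nu> \<in> Phi_star ip W" "\<And>\<kappa>. \<kappa> \<in> I \<Longrightarrow> pairing ip (w \<kappa>) (\<mu> + \<nu>) = pairing ip (w \<kappa>) \<mu> + pairing ip (w \<kappa>) \<nu>"
proof -
  have app: "(\<mu> + \<nu>) n = \<mu> n + \<nu> n" for n by (rule plus_fun_apply)
  have ip: "ip (w \<kappa>) ((\<mu> + \<nu>) n) = pairing ip (w \<kappa>) \<mu> + pairing ip (w \<kappa>) \<nu>" if \<kappa>: "\<kappa> \<in> level n" for \<kappa> n
    using W_H[OF Phi_star_W[OF assms(1)]] W_H[OF Phi_star_W[OF assms(2)]] w_H'[OF \<kappa>]
    by (simp only: app ip_add_right pairing_w[OF assms(1) \<kappa>] pairing_w[OF assms(2) \<kappa>])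
  have "(\<mu> + \<nu>) n \<in> W n" for n
    unfolding app using Phi_star_W[OF assms(1)] Phi_star_W[OF assms(2)]
    by (rule fs.subspace_add[OF W_subspace])
  from Phi_starI[OF this ip] show star: "\<mu> + \<nu> \<in> Phi_star ip W" .
  show "pairing ip (w \<kappa>) (\<mu> + \<nu>) = pairing ip (w \<kappa>) \<mu> + pairing ip (w \<kappa>) \<nu>" if "\<kappa> \<in> I" for \<kappa>
    using pairing_w[OF star in_level[OF that]] ip[OF in_level[OF that]] by simp
qed

lemma Phi_star_pscale:
  assumes "\<mu> \<in> Phi_star ip W"
  shows "pscale c \<mu> \<in> Phi_star ip W" "\<And>\<kappa>. \<kappa> \<in> I \<Longrightarrow> pairing ip (w \<kappa>) (pscale c \<mu>) = cnj c * pairing ip (w \<kappa>) \<mu>"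
proof -
  have ip: "ip (w \<kappa>) (pscale c \<mu> n) = cnj c * pairing ip (w \<kappa>) \<mu>" if \<kappa>: "\<kappa> \<in> level n" for \<kappa> n
    using W_H[OF Phi_star_W[OF assms(1)]] w_H'[OF \<kappa>]
    by (simp only: pscale_def ip_scale_right pairing_w[OF assms(1) \<kappa>])
  have "pscale c \<mu> n \<in> W n" for n
    unfolding pscale_def using Phi_star_W[OF assms(1)] by (rule fs.subspace_scale[OF W_subspace])
  from Phi_starI[OF this ip] show star: "pscale c \<mu> \<in> Phi_star ip W" .
  show "pairing ip (w \<kappa>) (pscale c \<mu>) = cnj c * pairing ip (w \<kappa>) \<mu>" if "\<kappa> \<in> I" for \<kappa>
    using pairing_w[OF star in_level[OF that]] ip[OF in_level[OF that]] by simp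
qed

lemma pairing_sum:
  assumes "\<mu> \<in> Phi_star ip W"
  shows "pairing ip (\<Sum>\<iota>\<in>level n. cscale (c \<iota>) (w \<iota>)) \<mu> = (\<Sum>\<iota>\<in>level n. c \<iota> * pairing ip (w \<iota>) \<mu>)"
proof -
  have "(\<Sum>\<iota>\<in>level n. cscale (c \<iota>) (w \<iota>)) \<in> W n" unfolding W_iff by (rule exI, rule refl)
  from pairing_eq[OF assms this] show ?thesis
    using w_H' W_H[OF Phi_star_W[OF assms]] pairing_w[OF assms]
    by (simp add: ip_sum_left H_scale ip_scale_left)
qed

lemma PhiE:
  assumes "v \<in> Phi W"
  obtains n c where "v = (\<Sum>\<iota>\<in>level n. cscale (c \<iota>) (w \<iota>))"
  using assms W_iff by (auto simp: Phi_def)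

text \<open>In coordinates, multiplication of the pairings by \<open>cnj (lam \<iota>)\<close>;
  \<open>combine\<close> conjugates, hence \<open>lam\<close> is plain and the pairing conjugated
  here. The restriction to \<open>Phi_star\<close> makes the map extensional, as the definition of
  the extended operator demands.\<close>

definition ext_op :: "(nat \<Rightarrow> 'a \<Rightarrow> complex) \<Rightarrow> nat \<Rightarrow> 'a \<Rightarrow> complex" where
  "ext_op = (\<lambda>\<mu>\<in>Phi_star ip W. \<lambda>n. combine n (\<lambda>\<iota>. lam \<iota> * cnj (pairing ip (w \<iota>) \<mu>)))"

lemma ext_op: "\<mu> \<in> Phi_star ip W \<Longrightarrow> ext_op \<mu> \<in> Phi_star ip W"
  by (simp add: ext_op_def combine_Phi_star)

lemma pairing_ext_op:
  "\<mu> \<in> Phi_star ip W \<Longrightarrow> \<kappa> \<in> I \<Longrightarrow> pairing ip (w \<kappa>) (ext_op \<mu>) = cnj (lam \<kappa>) * pairing ip (w \<kappa>) \<mu>"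
  by (simp add: ext_op_def pairing_combine)

lemma K_level:
  "K (\<Sum>\<iota>\<in>level n. cscale (c \<iota>) (w \<iota>)) = (\<Sum>\<iota>\<in>level n. cscale (cnj (lam \<iota>) * c \<iota>) (w \<iota>))"
  by (rule K_eq[OF level])

lemma K_w: "\<iota> \<in> I \<Longrightarrow> K (w \<iota>) = cscale (cnj (lam \<iota>)) (w \<iota>)"
  using K_eq[of "{\<iota>}" "\<lambda>_. 1"] by simp

lemma K_Phi: "v \<in> Phi W \<Longrightarrow> K v \<in> Phi W"
proof -
  assume "v \<in> Phi W"
  then obtain n c where v: "v = (\<Sum>\<iota>\<in>level n. cscale (c \<iota>) (w \<iota>))" by (rule PhiE)
  have "K v \<in> W n" unfolding v K_level W_iff by (rule exI, rule refl)
  then show ?thesis by (auto simp: Phi_def)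
qed

lemma pairing_K:
  assumes "g \<in> Phi W" "\<mu> \<in> Phi_star ip W"
  shows "pairing ip g (ext_op \<mu>) = pairing ip (K g) \<mu>"
proof -
  obtain n c where g: "g = (\<Sum>\<iota>\<in>level n. cscale (c \<iota>) (w \<iota>))" using assms(1) by (rule PhiE)
  have "pairing ip g (ext_op \<mu>) = (\<Sum>\<iota>\<in>level n. c \<iota> * (cnj (lam \<iota>) * pairing ip (w \<iota>) \<mu>))"
    unfolding g pairing_sum[OF ext_op[OF assms(2)]]
    using pairing_ext_op[OF assms(2)] level(2) by (intro sum.cong) auto
  also have "\<dots> = pairing ip (K g) \<mu>"
    unfolding g K_level pairing_sum[OF assms(2)] by (simp add: mult_ac)
  finally show ?thesis .
qed

section \<open>Topologies and continuity\<close>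

lemma topspace_W: "topspace (subtopology (hilbert_topology H ip) (W n)) = W n"
  unfolding topspace_subtopology topspace_hilbert using W_H by (intro Int_absorb1 subsetI)

lemma topspace_product_W:
  "topspace (product_topology (\<lambda>n. subtopology (hilbert_topology H ip) (W n)) UNIV) = {\<mu>. \<forall>n. \<mu> n \<in> W n}"
  by (simp only: topspace_product_topology topspace_W) (simp add: PiE_UNIV_domain Pi_def)

lemma topspace_Phi_star: "topspace (Phi_star_topology H ip W) = Phi_star ip W"
  unfolding Phi_star_topology_def topspace_subtopology topspace_product_W
  using Phi_star_W by (intro Int_absorb1 subsetI CollectI allI)

text \<open>The map is Lipschitz: Cauchy-Schwarz bounds each of its finitely many
  coefficients.\<close>

lemma continuous_combine:
  "continuous_map (subtopology (hilbert_topology H ip) (W n)) (hilbert_topology H ip)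
     (\<lambda>x. combine n (\<lambda>\<iota>. a \<iota> * cnj (ip (w \<iota>) x)))"
  unfolding hilbert_topology_eq ms.continuous_map_to_metric
proof (intro ballI allI impI)
  fix x and \<epsilon> :: real
  assume "x \<in> topspace (subtopology ms.mtopology (W n))" and \<epsilon>: "\<epsilon> > 0"
  then have x: "x \<in> W n" "x \<in> H" by auto
  let ?L = "\<lambda>x. combine n (\<lambda>\<iota>. a \<iota> * cnj (ip (w \<iota>) x))"
  define C where "C = (\<Sum>\<iota>\<in>level n. norm (a \<iota>) * nrm (w \<iota>) * nrm (u \<iota> n))"
  have C: "C \<ge> 0"
    unfolding C_def using nrm_nonneg w_H' u_H by (intro sum_nonneg mult_nonneg_nonneg) auto
  have lip: "nrm (?L x - ?L y) \<le> C * nrm (x - y)" if y: "y \<in> H" for y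
  proof -
    let ?b = "\<lambda>y \<iota>. cscale (a \<iota> * cnj (ip (w \<iota>) (x - y))) (u \<iota> n)"
    have diff: "?L x - ?L y = (\<Sum>\<iota>\<in>level n. ?b y \<iota>)"
      unfolding combine_def sum_subtractf[symmetric] using x y w_H'
      by (intro sum.cong) (simp_all add: ip_diff_right right_diff_distrib fs.scale_left_diff_distrib)
    have "nrm (?L x - ?L y) \<le> (\<Sum>\<iota>\<in>level n. nrm (?b y \<iota>))"
      unfolding diff by (rule nrm_sum) (intro H_scale u_H)
    also have "\<dots> \<le> (\<Sum>\<iota>\<in>level n. norm (a \<iota>) * nrm (w \<iota>) * nrm (u \<iota> n) * nrm (x - y))"
    proof (rule sum_mono)
      fix \<iota> assume \<iota>: "\<iota> \<in> level n"
      have "nrm (?b y \<iota>) = norm (a \<iota>) * norm (ip (w \<iota>) (x - y)) * nrm (u \<iota> n)"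
        by (simp only: nrm_scale[OF u_H] norm_mult complex_mod_cnj)
      also have "\<dots> \<le> norm (a \<iota>) * (nrm (w \<iota>) * nrm (x - y)) * nrm (u \<iota> n)"
        using cauchy_schwarz[OF w_H'[OF \<iota>] H_diff[OF x(2) y]]
        by (intro mult_right_mono mult_left_mono nrm_nonneg u_H) auto
      finally show "nrm (?b y \<iota>) \<le> norm (a \<iota>) * nrm (w \<iota>) * nrm (u \<iota> n) * nrm (x - y)"
        by (simp only: mult_ac)
    qed
    finally show ?thesis by (simp only: C_def sum_distrib_right)
  qed
  \<comment> \<open>C may be 0, so the radius is divided by C + 1.\<close>
  let ?U = "ms.mball x (\<epsilon> / (C + 1)) \<inter> W n"
  have "openin (subtopology ms.mtopology (W n)) ?U"
    by (intro openin_subtopology_Int ms.openin_mball)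
  moreover have "x \<in> ?U" using x \<epsilon> C by simp
  moreover have "?L y \<in> ms.mball (?L x) \<epsilon>" if "y \<in> ?U" for y
  proof -
    have y: "y \<in> H" "nrm (x - y) < \<epsilon> / (C + 1)" using that x by (auto simp: hdist_eq)
    have "nrm (?L x - ?L y) \<le> C * nrm (x - y)" by (rule lip[OF y(1)])
    also have "\<dots> \<le> (C + 1) * nrm (x - y)"
      using nrm_nonneg[OF H_diff[OF x(2) y(1)]] by (intro mult_right_mono) auto
    also have "\<dots> < \<epsilon>" using y(2) C by (simp add: pos_less_divide_eq mult.commute)
    finally show ?thesis using W_H[OF combine_W] by (simp add: hdist_eq)
  qed
  ultimately show "\<exists>U. openin (subtopology ms.mtopology (W n)) U \<and> x \<in> U \<and> (\<forall>y\<in>U. ?L y \<in> ms.mball (?L x) \<epsilon>)"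
    by blast
qed

text \<open>The n-th component of the image depends only on the n-th component of the argument, so
  continuity into the product reduces to the maps on single levels.\<close>

lemma continuous_ext_op:
  "continuous_map (Phi_star_topology H ip W) (Phi_star_topology H ip W) ext_op"
proof -
  let ?T = "Phi_star_topology H ip W" and ?S = "\<lambda>n. subtopology (hilbert_topology H ip) (W n)"
  have "continuous_map ?T (?S n) (\<lambda>\<mu>. ext_op \<mu> n)" for n
  proof -
    have proj: "continuous_map ?T (?S n) (\<lambda>\<mu>. \<mu> n)"
      unfolding Phi_star_topology_def
      by (intro continuous_map_from_subtopology continuous_map_product_projection) simp
    have "continuous_map (?S n) (?S n) (\<lambda>x. combine n (\<lambda>\<iota>. lam \<iota> * cnj (ip (w \<iota>) x)))"
      by (intro continuous_map_into_subtopology continuous_combine) (simp add: combine_W)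
    from continuous_map_compose[OF proj this]
    have "continuous_map ?T (?S n) (\<lambda>\<mu>. combine n (\<lambda>\<iota>. lam \<iota> * cnj (ip (w \<iota>) (\<mu> n))))"
      by (simp add: o_def)
    then show ?thesis
    proof (rule continuous_map_eq)
      fix \<mu> assume "\<mu> \<in> topspace ?T"
      then have \<mu>: "\<mu> \<in> Phi_star ip W" by (simp only: topspace_Phi_star)
      then show "combine n (\<lambda>\<iota>. lam \<iota> * cnj (ip (w \<iota>) (\<mu> n))) = ext_op \<mu> n"
        unfolding ext_op_def combine_def using pairing_w[OF \<mu>] by (simp cong: sum.cong)
    qed
  qed
  then have "continuous_map ?T (product_topology ?S UNIV) ext_op"
    by (simp add: continuous_map_componentwise_UNIV)
  moreover have "ext_op \<in> topspace ?T \<rightarrow> Phi_star ip W"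
    unfolding topspace_Phi_star using ext_op by blast
  ultimately show ?thesis
    unfolding Phi_star_topology_def[of H ip W] by (intro continuous_map_into_subtopology) (simp_all only: Phi_star_topology_def)
qed

text \<open>The pairing identity with each \<open>w \<kappa>\<close> determines the values on
  \<open>Phi_star\<close>, and \<open>\<rightarrow>\<^sub>E\<close> those elsewhere. Additivity and
  homogeneity of \<open>ext_op\<close> are compared on coordinates.\<close>

theorem ext_op_unique:
  "(THE T. T \<in> Phi_star ip W \<rightarrow>\<^sub>E Phi_star ip W \<and>
      (\<forall>\<mu>\<in>Phi_star ip W. \<forall>\<nu>\<in>Phi_star ip W. T (\<mu> + \<nu>) = T \<mu> + T \<nu>) \<and>
      (\<forall>c. \<forall>\<mu>\<in>Phi_star ip W. T (pscale c \<mu>) = pscale c (T \<mu>)) \<and>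
      continuous_map (Phi_star_topology H ip W) (Phi_star_topology H ip W) T \<and>
      (\<forall>g\<in>Phi W. \<forall>\<mu>\<in>Phi_star ip W. pairing ip g (T \<mu>) = pairing ip (K g) \<mu>)) = ext_op"
  (is "(THE T. ?P T) = _")
proof (rule the_equality)
  have "ext_op \<in> Phi_star ip W \<rightarrow>\<^sub>E Phi_star ip W"
    using ext_op by (auto simp: ext_op_def)
  moreover have "ext_op (\<mu> + \<nu>) = ext_op \<mu> + ext_op \<nu>" if "\<mu> \<in> Phi_star ip W" "\<nu> \<in> Phi_star ip W" for \<mu> \<nu>
    using that by (intro Phi_star_eqI) (simp_all add: ext_op Phi_star_add pairing_ext_op distrib_left)
  moreover have "ext_op (pscale c \<mu>) = pscale c (ext_op \<mu>)" if "\<mu> \<in> Phi_star ip W" for c \<mu>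
    using that by (intro Phi_star_eqI) (simp_all add: ext_op Phi_star_pscale pairing_ext_op)
  ultimately show "?P ext_op"
    using continuous_ext_op pairing_K by blast
next
  fix T
  assume T: "?P T"
  show "T = ext_op"
  proof
    fix \<mu>
    show "T \<mu> = ext_op \<mu>"
    proof (cases "\<mu> \<in> Phi_star ip W")
      case True
      show ?thesis
      proof (rule Phi_star_eqI[OF _ ext_op[OF True]])
        show "T \<mu> \<in> Phi_star ip W" using T True by blast
        fix \<kappa> assume "\<kappa> \<in> I"
        then have "w \<kappa> \<in> Phi W" using w_in_W[OF in_level] by (auto simp: Phi_def)
        with T True pairing_K[OF this True] show "pairing ip (w \<kappa>) (T \<mu>) = pairing ip (w \<kappa>) (ext_op \<mu>)"
          by metis
      qed
    next
      case False
      then show ?thesis using T by (auto simp: ext_op_def)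
    qed
  qed
qed

section \<open>Eigenvectors and expansions\<close>

lemma ext_op_u: "\<iota> \<in> I \<Longrightarrow> ext_op (u \<iota>) = pscale (lam \<iota>) (u \<iota>)"
  by (rule Phi_star_eqI) (simp_all add: ext_op Phi_star_pscale u_Phi_star pairing_ext_op pairing_w_u)

lemma sum_pscale_u_level:
  assumes "finite F" "level n \<subseteq> F"
  shows "(\<Sum>\<iota>\<in>F. pscale (a \<iota>) (u \<iota>)) n = combine n a"
proof -
  have "(\<Sum>\<iota>\<in>F. pscale (a \<iota>) (u \<iota>)) n = (\<Sum>\<iota>\<in>F. cscale (a \<iota>) (u \<iota> n))"
    by (simp add: sum_fun_apply pscale_def)
  also have "\<dots> = (\<Sum>\<iota>\<in>level n. cscale (a \<iota>) (u \<iota> n))"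
    using assms by (intro sum.mono_neutral_right) (auto simp: u_eq_0)
  finally show ?thesis by (simp add: combine_def)
qed

lemma sum_pscale_u_Phi_star: "(\<Sum>\<iota>\<in>F. pscale (a \<iota>) (u \<iota>)) \<in> Phi_star ip W"
proof (induction F rule: infinite_finite_induct)
  case (insert \<iota> F)
  show ?case
    unfolding sum.insert[OF insert.hyps] by (intro Phi_star_add Phi_star_pscale u_Phi_star insert.IH)
next
  \<comment> \<open>Covers both the empty set and infinite sets, where the sum is 0 by
    convention.\<close>
  have "(0 :: nat \<Rightarrow> 'a \<Rightarrow> complex) \<in> Phi_star ip W"
    using Phi_star_pscale(1)[OF combine_Phi_star, of 0] by (simp add: pscale_def zero_fun_def)
  then show "(\<Sum>\<iota>\<in>{}. pscale (a \<iota>) (u \<iota>)) \<in> Phi_star ip W"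
    "\<And>A. infinite A \<Longrightarrow> (\<Sum>\<iota>\<in>A. pscale (a \<iota>) (u \<iota>)) \<in> Phi_star ip W" by simp_all
qed

theorem limitin_ext_op:
  assumes v: "v \<in> Phi_star ip W"
  shows "limitin (Phi_star_topology H ip W)
    (\<lambda>F. \<Sum>\<iota>\<in>F. pscale (lam \<iota> * cnj (pairing ip (w \<iota>) v)) (u \<iota>)) (ext_op v) (finite_subsets_at_top I)"
proof -
  let ?a = "\<lambda>\<iota>. lam \<iota> * cnj (pairing ip (w \<iota>) v)"
  let ?S = "\<lambda>F. \<Sum>\<iota>\<in>F. pscale (?a \<iota>) (u \<iota>)"
  have in_W: "?S F n \<in> W n" "ext_op v n \<in> W n" for F n
    by (intro Phi_star_W sum_pscale_u_Phi_star ext_op[OF v])+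
  have "limitin (subtopology (hilbert_topology H ip) (W n)) (\<lambda>F. ?S F n) (ext_op v n) (finite_subsets_at_top I)" for n
  proof (rule limitin_eventually)
    show "ext_op v n \<in> topspace (subtopology (hilbert_topology H ip) (W n))"
      unfolding topspace_W by (rule in_W)
    have "?S F n = ext_op v n" if "finite F" "level n \<subseteq> F" for F
      using sum_pscale_u_level[OF that] v by (simp add: ext_op_def)
    then show "eventually (\<lambda>F. ?S F n = ext_op v n) (finite_subsets_at_top I)"
      unfolding eventually_finite_subsets_at_top
      by (intro exI[of _ "level n"] conjI level allI impI) (elim conjE)
  qed
  moreover have "?S F \<in> topspace (product_topology (\<lambda>n. subtopology (hilbert_topology H ip) (W n)) UNIV)" for F
    unfolding topspace_product_W by (intro CollectI allI in_W)
  ultimately have "limitin (product_topology (\<lambda>n. subtopology (hilbert_topology H ip) (W n)) UNIV)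
      ?S (ext_op v) (finite_subsets_at_top I)"
    unfolding limitin_componentwise extensional_UNIV by (intro conjI UNIV_I ballI always_eventually allI)
  then show ?thesis
    unfolding Phi_star_topology_def limitin_subtopology
    by (intro conjI ext_op[OF v] always_eventually allI sum_pscale_u_Phi_star)
qed

lemma topspace_Phi: "topspace (Phi_topology H ip W) = Phi W"
proof -
  let ?open = "\<lambda>U. U \<subseteq> Phi W \<and> (\<forall>n. openin (subtopology (hilbert_topology H ip) (W n)) (U \<inter> W n))"
  have "openin (Phi_topology H ip W) = ?open"
    unfolding Phi_topology_def by (rule topology_inverse'[OF istopology_inductive_limit])
  moreover have "openin (subtopology (hilbert_topology H ip) (W n)) (Phi W \<inter> W n)" for n
  proof -
    have "Phi W \<inter> W n = topspace (subtopology (hilbert_topology H ip) (W n))"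
      unfolding topspace_W by (auto simp: Phi_def)
    then show ?thesis by (simp only: openin_topspace)
  qed
  ultimately show ?thesis
    unfolding topspace_def by (intro equalityI Sup_least Sup_upper) auto
qed

theorem limitin_K:
  assumes "v \<in> Phi W"
  shows "limitin (Phi_topology H ip W)
    (\<lambda>F. \<Sum>\<iota>\<in>F. cscale (cnj (lam \<iota>) * pairing ip v (u \<iota>)) (w \<iota>)) (K v) (finite_subsets_at_top I)"
  (is "limitin _ ?S _ _")
proof (rule limitin_eventually)
  show "K v \<in> topspace (Phi_topology H ip W)"
    using K_Phi[OF assms] by (simp add: topspace_Phi)
  obtain n c where v: "v = (\<Sum>\<iota>\<in>level n. cscale (c \<iota>) (w \<iota>))" using assms by (rule PhiE)
  \<comment> \<open>The coefficients of v in the basis are its pairings with the dual family, and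
    they vanish outside the level of v.\<close>
  have pair: "pairing ip v (u \<iota>) = (if \<iota> \<in> level n then c \<iota> else 0)" for \<iota>
  proof -
    have "pairing ip v (u \<iota>) = (\<Sum>\<kappa>\<in>level n. c \<kappa> * (if \<kappa> = \<iota> then 1 else 0))"
      unfolding v pairing_sum[OF u_Phi_star] using pairing_w_u[OF level(2)[THEN subsetD]] by (intro sum.cong) auto
    then show ?thesis using level(1) by (simp add: if_distrib[of "\<lambda>q. _ * q"] cong: if_cong)
  qed
  have "?S F = K v" if "finite F" "level n \<subseteq> F" for F
  proof -
    have "?S F = (\<Sum>\<iota>\<in>level n. cscale (cnj (lam \<iota>) * c \<iota>) (w \<iota>))"
      using that by (intro sum.mono_neutral_cong_right) (auto simp: pair)
    then show ?thesis by (simp only: v K_level)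
  qed
  then show "eventually (\<lambda>F. ?S F = K v) (finite_subsets_at_top I)"
    unfolding eventually_finite_subsets_at_top
    by (intro exI[of _ "level n"] conjI level allI impI) (elim conjE)
qed

end


section \<open>Triangular families\<close>

text \<open>A unitriangular change of family: one inclusion is immediate, the other recovers each
  \<open>L \<gamma>\<close> from \<open>w \<gamma>\<close> by induction on the degree.\<close>

lemma triangular_span_eq:
  fixes L w :: "'i \<Rightarrow> 'a \<Rightarrow> complex" and deg :: "'i \<Rightarrow> nat"
  assumes tri: "\<And>\<gamma>. \<gamma> \<in> S \<Longrightarrow> w \<gamma> - L \<gamma> \<in> fs.span (L ` {\<beta> \<in> S. deg \<beta> < deg \<gamma>})"
  shows "fs.span (w ` S) = fs.span (L ` S)"
proof (rule fs.span_eq[THEN iffD2], rule conjI)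
  have sub: "fs.span (L ` {\<beta> \<in> S. deg \<beta> < n}) \<subseteq> fs.span (L ` S)" for n
    by (rule fs.span_mono) auto
  show "w ` S \<subseteq> fs.span (L ` S)"
  proof
    fix x assume "x \<in> w ` S"
    then obtain \<gamma> where \<gamma>: "\<gamma> \<in> S" "x = w \<gamma>" by blast
    have "(w \<gamma> - L \<gamma>) + L \<gamma> \<in> fs.span (L ` S)"
      by (rule fs.span_add[OF subsetD[OF sub tri[OF \<gamma>(1)]] fs.span_base[OF imageI[OF \<gamma>(1)]]])
    then show "x \<in> fs.span (L ` S)" by (simp add: \<gamma>(2))
  qed
  have "\<gamma> \<in> S \<Longrightarrow> L \<gamma> \<in> fs.span (w ` S)" for \<gamma>
  proof (induction "deg \<gamma>" arbitrary: \<gamma> rule: less_induct)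
    case less
    have "fs.span (L ` {\<beta> \<in> S. deg \<beta> < deg \<gamma>}) \<subseteq> fs.span (w ` S)"
      using less.hyps by (intro fs.span_minimal fs.subspace_span) auto
    from subsetD[OF this tri[OF less.prems]]
    have "w \<gamma> - (w \<gamma> - L \<gamma>) \<in> fs.span (w ` S)"
      by (rule fs.span_diff[OF fs.span_base[OF imageI[OF less.prems]]])
    then show ?case by simp
  qed
  then show "L ` S \<subseteq> fs.span (w ` S)" by blast
qed

text \<open>\<open>R\<close> is the graph of a linear operator whose values are not known to be
  unique at this stage. Terms besides the diagonal one have strictly smaller degree, so the divisors
  in the construction are differences of eigenvalues of different degrees.\<close>

lemma triangular_eigenvectors:
  fixes L :: "'i \<Rightarrow> 'a \<Rightarrow> complex" and deg :: "'i \<Rightarrow> nat"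
    and R :: "('a \<Rightarrow> complex) \<Rightarrow> ('a \<Rightarrow> complex) \<Rightarrow> bool"
  assumes fin: "\<And>n. finite {\<beta>. deg \<beta> < n}"
    and R_add: "\<And>x x' y y'. R x x' \<Longrightarrow> R y y' \<Longrightarrow> R (x + y) (x' + y')"
    and R_scale: "\<And>c x x'. R x x' \<Longrightarrow> R (cscale c x) (cscale c x')"
    and R_zero: "R 0 0"
    and R_L: "\<And>\<gamma>. R (L \<gamma>) (cscale (m \<gamma>) (L \<gamma>) + (\<Sum>\<beta> | deg \<beta> < deg \<gamma>. cscale (C \<gamma> \<beta>) (L \<beta>)))"
    and m: "\<And>\<beta> \<gamma>. deg \<beta> < deg \<gamma> \<Longrightarrow> m \<beta> \<noteq> m \<gamma>"
  shows "\<exists>x. R x (cscale (m \<gamma>) x) \<and> x - L \<gamma> \<in> fs.span (L ` {\<beta>. deg \<beta> < deg \<gamma>})"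
proof (induction "deg \<gamma>" arbitrary: \<gamma> rule: less_induct)
  case less
  let ?S = "{\<beta>. deg \<beta> < deg \<gamma>}"
  have "\<forall>\<beta>\<in>?S. \<exists>x. R x (cscale (m \<beta>) x) \<and> x - L \<beta> \<in> fs.span (L ` {\<beta>'. deg \<beta>' < deg \<beta>})"
    using less by blast
  from bchoice[OF this] obtain x where
    x: "\<And>\<beta>. \<beta> \<in> ?S \<Longrightarrow> R (x \<beta>) (cscale (m \<beta>) (x \<beta>))"
      "\<And>\<beta>. \<beta> \<in> ?S \<Longrightarrow> x \<beta> - L \<beta> \<in> fs.span (L ` {\<beta>'. deg \<beta>' < deg \<beta>})" by blast
  have "{\<beta>' \<in> ?S. deg \<beta>' < deg \<beta>} = {\<beta>'. deg \<beta>' < deg \<beta>}" if "\<beta> \<in> ?S" for \<beta>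
    using that by auto
  then have span: "fs.span (x ` ?S) = fs.span (L ` ?S)"
    using x(2) by (intro triangular_span_eq[where deg = deg]) simp
  \<comment> \<open>The lower part is rewritten in the eigenvectors already constructed, on which
    the operator acts diagonally.\<close>
  have "(\<Sum>\<beta>\<in>?S. cscale (C \<gamma> \<beta>) (L \<beta>)) \<in> fs.span (x ` ?S)"
    unfolding span by (intro fs.span_sum fs.span_scale fs.span_base imageI)
  then obtain d where d: "(\<Sum>\<beta>\<in>?S. cscale (C \<gamma> \<beta>) (L \<beta>)) = (\<Sum>\<beta>\<in>?S. cscale (d \<beta>) (x \<beta>))"
    using span_image_family[OF fin] by blast
  \<comment> \<open>Solves d + t m(\<beta>) = m(\<gamma>) t, the eigenvector equation in the
    component of \<open>x \<beta>\<close>.\<close>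
  define t where "t \<beta> = d \<beta> / (m \<gamma> - m \<beta>)" for \<beta>
  define y where "y = L \<gamma> + (\<Sum>\<beta>\<in>?S. cscale (t \<beta>) (x \<beta>))"
  have R_sum: "R (\<Sum>\<beta>\<in>T. cscale (t \<beta>) (x \<beta>)) (\<Sum>\<beta>\<in>T. cscale (t \<beta>) (cscale (m \<beta>) (x \<beta>)))"
    if "finite T" "T \<subseteq> ?S" for T
    using that
  proof (induction T)
    case (insert \<beta> T)
    then show ?case
      unfolding sum.insert[OF insert.hyps] by (intro R_add R_scale x(1)) auto
  qed (simp add: R_zero)
  have "R y ((cscale (m \<gamma>) (L \<gamma>) + (\<Sum>\<beta>\<in>?S. cscale (d \<beta>) (x \<beta>))) + (\<Sum>\<beta>\<in>?S. cscale (t \<beta>) (cscale (m \<beta>) (x \<beta>))))"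
    unfolding y_def d[symmetric] by (intro R_add R_L R_sum fin order_refl)
  also have "(cscale (m \<gamma>) (L \<gamma>) + (\<Sum>\<beta>\<in>?S. cscale (d \<beta>) (x \<beta>))) + (\<Sum>\<beta>\<in>?S. cscale (t \<beta>) (cscale (m \<beta>) (x \<beta>)))
    = cscale (m \<gamma>) y"
  proof -
    have "(\<Sum>\<beta>\<in>?S. cscale (d \<beta>) (x \<beta>)) + (\<Sum>\<beta>\<in>?S. cscale (t \<beta>) (cscale (m \<beta>) (x \<beta>)))
      = (\<Sum>\<beta>\<in>?S. cscale (m \<gamma>) (cscale (t \<beta>) (x \<beta>)))"
      unfolding sum.distrib[symmetric]
    proof (rule sum.cong[OF refl])
      fix \<beta> assume "\<beta> \<in> ?S"
      then have "m \<gamma> - m \<beta> \<noteq> 0" using m[of \<beta> \<gamma>] by simp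
      then have "d \<beta> + t \<beta> * m \<beta> = m \<gamma> * t \<beta>" by (simp add: t_def field_simps)
      then show "cscale (d \<beta>) (x \<beta>) + cscale (t \<beta>) (cscale (m \<beta>) (x \<beta>)) = cscale (m \<gamma>) (cscale (t \<beta>) (x \<beta>))"
        by (simp only: fs.scale_scale fs.scale_left_distrib[symmetric])
    qed
    then show ?thesis
      by (simp only: y_def fs.scale_right_distrib fs.scale_sum_right add.assoc)
  qed
  finally have "R y (cscale (m \<gamma>) y)" .
  moreover have "y - L \<gamma> \<in> fs.span (L ` ?S)"
    unfolding y_def add_diff_cancel_left' span[symmetric]
    by (intro fs.span_sum fs.span_scale fs.span_base imageI)
  ultimately show ?case by blast
qed

text \<open>At an index \<iota>0 of highest degree with nonzero coefficient, the relation puts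
  \<open>w \<iota>0\<close>, and with it \<open>L \<iota>0\<close>, into the span of the other
  \<open>L \<kappa>\<close> of degree at most that of \<iota>0.\<close>

lemma triangular_independent:
  fixes L w :: "'i \<Rightarrow> 'a \<Rightarrow> complex" and deg :: "'i \<Rightarrow> nat"
  assumes fin: "\<And>n. finite {\<iota> \<in> I. deg \<iota> \<le> n}"
    and indep: "\<And>F c \<iota>. finite F \<Longrightarrow> F \<subseteq> I \<Longrightarrow> (\<Sum>\<iota>\<in>F. cscale (c \<iota>) (L \<iota>)) = 0 \<Longrightarrow> \<iota> \<in> F \<Longrightarrow> c \<iota> = 0"
    and tri: "\<And>\<iota>. \<iota> \<in> I \<Longrightarrow> w \<iota> - L \<iota> \<in> fs.span (L ` {\<kappa> \<in> I. deg \<kappa> < deg \<iota>})"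
    and F: "finite F" "F \<subseteq> I" "(\<Sum>\<iota>\<in>F. cscale (c \<iota>) (w \<iota>)) = 0" "\<iota> \<in> F"
  shows "c \<iota> = 0"
proof (rule ccontr)
  let ?F = "{\<iota> \<in> F. c \<iota> \<noteq> 0}"
  assume "c \<iota> \<noteq> 0"
  then have "finite (deg ` ?F)" "deg ` ?F \<noteq> {}" using F by auto
  from Max_in[OF this] obtain \<iota>0 where i0: "Max (deg ` ?F) = deg \<iota>0" "\<iota>0 \<in> ?F" by (rule imageE)
  have max: "deg \<kappa> \<le> deg \<iota>0" if "\<kappa> \<in> ?F" for \<kappa>
    unfolding i0(1)[symmetric] using that F(1) by (intro Max_ge) auto
  let ?J = "{\<kappa> \<in> I. deg \<kappa> \<le> deg \<iota>0} - {\<iota>0}"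
  let ?V = "fs.span (L ` ?J)"
  have J: "finite ?J" using fin by simp
  have low: "fs.span (L ` {\<kappa> \<in> I. deg \<kappa> < n}) \<subseteq> ?V" if "n \<le> deg \<iota>0" for n
    using that by (intro fs.span_mono image_mono) auto
  have wV: "w \<kappa> \<in> ?V" if \<kappa>: "\<kappa> \<in> ?F - {\<iota>0}" for \<kappa>
  proof -
    have "(w \<kappa> - L \<kappa>) + L \<kappa> \<in> ?V"
    proof (rule fs.span_add)
      show "w \<kappa> - L \<kappa> \<in> ?V" using tri[of \<kappa>] low[OF max, of \<kappa>] \<kappa> F(2) by blast
      show "L \<kappa> \<in> ?V" using max[of \<kappa>] \<kappa> F(2) by (intro fs.span_base imageI) auto
    qed
    then show ?thesis by simp
  qed
  have "(\<Sum>\<kappa>\<in>F. cscale (c \<kappa>) (w \<kappa>)) = (\<Sum>\<kappa>\<in>?F. cscale (c \<kappa>) (w \<kappa>))"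
    using F(1) by (intro sum.mono_neutral_right) auto
  also have "\<dots> = cscale (c \<iota>0) (w \<iota>0) + (\<Sum>\<kappa>\<in>?F - {\<iota>0}. cscale (c \<kappa>) (w \<kappa>))"
    using i0(2) F(1) by (intro sum.remove) auto
  finally have "cscale (c \<iota>0) (w \<iota>0) = - (\<Sum>\<kappa>\<in>?F - {\<iota>0}. cscale (c \<kappa>) (w \<kappa>))"
    unfolding F(3) by (simp only: eq_neg_iff_add_eq_0)
  also have "\<dots> \<in> ?V"
    using wV by (intro fs.span_neg fs.span_sum fs.span_scale)
  finally have "cscale (inverse (c \<iota>0)) (cscale (c \<iota>0) (w \<iota>0)) \<in> ?V" by (rule fs.span_scale)
  then have "w \<iota>0 \<in> ?V" using i0(2) by simp
  moreover have "w \<iota>0 - L \<iota>0 \<in> ?V" using tri[of \<iota>0] low[of "deg \<iota>0"] i0(2) F(2) by auto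
  ultimately have "w \<iota>0 - (w \<iota>0 - L \<iota>0) \<in> ?V" by (rule fs.span_diff)
  then have "L \<iota>0 \<in> ?V" by simp
  then obtain b where b: "L \<iota>0 = (\<Sum>\<kappa>\<in>?J. cscale (b \<kappa>) (L \<kappa>))"
    using span_image_family[OF J] by blast
  define b' where "b' \<kappa> = (if \<kappa> = \<iota>0 then - 1 else b \<kappa>)" for \<kappa>
  have "(\<Sum>\<kappa>\<in>insert \<iota>0 ?J. cscale (b' \<kappa>) (L \<kappa>)) = cscale (b' \<iota>0) (L \<iota>0) + (\<Sum>\<kappa>\<in>?J. cscale (b' \<kappa>) (L \<kappa>))"
    using J by (intro sum.insert) auto
  also have "(\<Sum>\<kappa>\<in>?J. cscale (b' \<kappa>) (L \<kappa>)) = L \<iota>0"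
    unfolding b by (intro sum.cong) (auto simp: b'_def)
  also have "cscale (b' \<iota>0) (L \<iota>0) + L \<iota>0 = 0" by (simp add: b'_def fs.scale_minus_left)
  finally have "b' \<iota>0 = 0"
    using i0(2) F(2) J by (intro indep[of "insert \<iota>0 ?J" b']) auto
  then show False by (simp add: b'_def)
qed

text \<open>Turns a sum over the points into one span over pairs of point and multi-index; used for
  the jet spaces and for the delta functionals alike.\<close>

lemma subspace_sum_span:
  fixes S :: "'i \<Rightarrow> ('a \<Rightarrow> complex) set"
  assumes "finite A"
  shows "subspace_sum A (\<lambda>i. fs.span (S i)) = fs.span (\<Union>i\<in>A. S i)" (is "?L = ?R")
proof
  show "?L \<subseteq> ?R"
  proof
    fix x assume "x \<in> ?L"
    then obtain v where x: "x = (\<Sum>i\<in>A. v i)" and v: "\<forall>i\<in>A. v i \<in> fs.span (S i)"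
      unfolding subspace_sum_def by blast
    have "v i \<in> ?R" if "i \<in> A" for i
      using v that fs.span_mono[of "S i" "\<Union>i\<in>A. S i"] by blast
    then show "x \<in> ?R" unfolding x by (rule fs.span_sum)
  qed
  show "?R \<subseteq> ?L"
  proof (rule fs.span_minimal)
    show "(\<Union>i\<in>A. S i) \<subseteq> ?L"
    proof
      fix x assume "x \<in> (\<Union>i\<in>A. S i)"
      then obtain j where j: "j \<in> A" "x \<in> S j" by blast
      have "x = (\<Sum>i\<in>A. if i = j then x else 0)" using j(1) assms by simp
      moreover have "\<forall>i\<in>A. (if i = j then x else 0) \<in> fs.span (S i)"
        using j(2) by (auto intro: fs.span_base fs.span_zero)
      ultimately show "x \<in> ?L"
        unfolding subspace_sum_def by blast
    qed
    show "fs.subspace (?L)"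
    proof (rule fs.subspaceI)
      show "0 \<in> ?L"
        unfolding subspace_sum_def by (intro CollectI exI[of _ "\<lambda>_. 0"]) (simp add: fs.span_zero)
    next
      fix x y assume "x \<in> ?L" "y \<in> ?L"
      then obtain v v' where "x = (\<Sum>i\<in>A. v i)" "\<forall>i\<in>A. v i \<in> fs.span (S i)"
        "y = (\<Sum>i\<in>A. v' i)" "\<forall>i\<in>A. v' i \<in> fs.span (S i)"
        unfolding subspace_sum_def by blast
      then have "x + y = (\<Sum>i\<in>A. v i + v' i)" "\<forall>i\<in>A. v i + v' i \<in> fs.span (S i)"
        by (simp_all only: sum.distrib) (blast intro: fs.span_add)
      then show "x + y \<in> ?L"
        unfolding subspace_sum_def by (intro CollectI exI[of _ "\<lambda>i. v i + v' i"]) blast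
    next
      fix x c assume "x \<in> ?L"
      then obtain v where "x = (\<Sum>i\<in>A. v i)" "\<forall>i\<in>A. v i \<in> fs.span (S i)"
        unfolding subspace_sum_def by blast
      then have "cscale c x = (\<Sum>i\<in>A. cscale c (v i))" "\<forall>i\<in>A. cscale c (v i) \<in> fs.span (S i)"
        by (simp_all only: fs.scale_sum_right) (blast intro: fs.span_scale)
      then show "cscale c x \<in> ?L"
        unfolding subspace_sum_def by (intro CollectI exI[of _ "\<lambda>i. cscale c (v i)"]) blast
    qed
  qed
qed

text \<open>One affine factor per point of P, raised to the power n + 1, vanishes there beyond order
  n and stays nonzero at p. The arbitrary smooth s in the claim absorbs the factors of the remaining
  points in the induction, and the test functions in the application.\<close>

lemma vanishing_factor:
  fixes p :: "real^'d::finite"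
  assumes "open \<Omega>" "finite P" "P \<subseteq> \<Omega>" "p \<notin> P"
  shows "\<exists>q :: real^'d \<Rightarrow> complex. smooth_on \<Omega> q \<and> q p \<noteq> 0 \<and>
    (\<forall>p'\<in>P. \<forall>s \<alpha>. smooth_on \<Omega> s \<longrightarrow> msize \<alpha> \<le> n \<longrightarrow> mderiv \<alpha> (\<lambda>x. s x * q x) p' = 0)"
  using assms(2-)
proof (induction P)
  case empty
  show ?case by (intro exI[of _ "\<lambda>_. 1"]) (simp add: smooth_on_const)
next
  case (insert p' P)
  then obtain q :: "real^'d \<Rightarrow> complex" where q: "smooth_on \<Omega> q" "q p \<noteq> 0"
    and vanish: "\<And>p' s \<alpha>. p' \<in> P \<Longrightarrow> smooth_on \<Omega> s \<Longrightarrow> msize \<alpha> \<le> n \<Longrightarrow> mderiv \<alpha> (\<lambda>x. s x * q x) p' = 0"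
    by auto
  \<comment> \<open>The affine function with value 0 at p' and |p - p'|^2 at p, written out so that
    its smoothness is evident.\<close>
  define t where "t x = complex_of_real (x \<bullet> (p - p')) + - complex_of_real (p' \<bullet> (p - p'))" for x
  have t: "t x = complex_of_real ((x - p') \<bullet> (p - p'))" for x
    by (simp add: t_def inner_diff_left)
  have st: "smooth_on \<Omega> t"
    unfolding t_def
    by (intro smooth_on_add smooth_on_const assms(1)
        smooth_on_bounded_linear[OF assms(1) bounded_linear_compose[OF bounded_linear_of_real bounded_linear_inner_left] smooth_on_ident])
  let ?q = "\<lambda>x. t x ^ Suc n * q x"
  have "smooth_on \<Omega> ?q" by (intro smooth_on_mult smooth_on_power st q assms(1))
  moreover have "?q p \<noteq> 0" using q(2) insert.prems by (auto simp: t)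
  moreover have "mderiv \<alpha> (\<lambda>x. s x * ?q x) p'' = 0"
    if p'': "p'' \<in> insert p' P" and s: "smooth_on \<Omega> s" and \<alpha>: "msize \<alpha> \<le> n" for p'' s \<alpha>
  proof (cases "p'' \<in> P")
    case True
    have "mderiv \<alpha> (\<lambda>x. (s x * t x ^ Suc n) * q x) p'' = 0"
      by (intro vanish True \<alpha> smooth_on_mult smooth_on_power st s assms(1))
    then show ?thesis by (simp only: mult.assoc)
  next
    case False
    then have eq: "p'' = p'" using p'' by blast
    have p': "p' \<in> \<Omega>" using insert.prems by blast
    have tO: "t \<in> O[nhds p'](\<lambda>x. rad p' x)"
    proof (rule landau_o.bigI)
      show "norm (p - p') > 0" using insert.prems by auto
      have "norm (t x) \<le> norm (p - p') * norm (rad p' x)" for x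
        unfolding t rad_def norm_of_real using Cauchy_Schwarz_ineq2[of "x - p'" "p - p'"] by (simp add: mult.commute)
      then show "eventually (\<lambda>x. norm (t x) \<le> norm (p - p') * norm (rad p' x)) (nhds p')"
        by (intro always_eventually allI)
    qed
    have small: "(\<lambda>x. rad p' x ^ Suc n) \<in> o[nhds p'](\<lambda>x. rad p' x ^ n)"
    proof (rule landau_o.smallI)
      fix e :: real assume "e > 0"
      then show "eventually (\<lambda>x. norm (rad p' x ^ Suc n) \<le> e * norm (rad p' x ^ n)) (nhds p')"
        unfolding eventually_nhds_metric
        by (intro exI[of _ e]) (auto simp: rad_def norm_mult norm_power dist_norm intro!: mult_right_mono)
    qed
    have ssq: "smooth_on \<Omega> (\<lambda>x. s x * q x)" by (intro smooth_on_mult s q assms(1))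
    have "isCont (\<lambda>x. s x * q x) p'"
      using smooth_on_differentiable[OF ssq assms(1) p'] differentiable_imp_continuous_within by blast
    then have "((\<lambda>x. s x * q x) \<longlongrightarrow> s p' * q p') (nhds p')"
      using tendsto_at_iff_tendsto_nhds[of "\<lambda>x. s x * q x" p'] by (simp add: isCont_def)
    then have "(\<lambda>x. s x * q x) \<in> O[nhds p'](\<lambda>x. 1)"
      by (intro bigoI_tendsto[where c = "s p' * q p'"]) auto
    then have "(\<lambda>x. (s x * q x) * t x ^ Suc n) \<in> o[nhds p'](\<lambda>x. 1 * rad p' x ^ n)"
      by (rule landau_o.big_small_mult) (rule landau_o.big_small_trans[OF landau_o.big_power[OF tO] small])
    then have "(\<lambda>x. s x * ?q x) \<in> o[nhds p'](\<lambda>x. rad p' x ^ n)"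
      by (simp add: mult_ac)
    moreover have "smooth_on \<Omega> (\<lambda>x. s x * ?q x)"
      by (intro smooth_on_mult smooth_on_power st s q assms(1))
    ultimately show ?thesis unfolding eq using mderiv_eq_0_if_smallo[OF assms(1) p' _ _ \<alpha>] by blast
  qed
  ultimately show ?case by blast
qed


section \<open>The adjoint Koopman operator on jets\<close>

locale koopman_rkhs = ip_space H ip
  for H :: "(real^'d::finite \<Rightarrow> complex) set" and ip +
  fixes \<Omega> :: "(real^'d) set" and k :: "real^'d \<Rightarrow> real^'d \<Rightarrow> complex" and f :: "real^'d \<Rightarrow> real^'d"
  assumes open_Omega: "open \<Omega>"
    and rkhs: "rkhs \<Omega> H ip k"
    and inclusion: "continuous_map (hilbert_topology H ip) (smooth_topology \<Omega>) (\<lambda>h. h)"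
    and dense: "hilbert_topology H ip closure_of koopman_dom \<Omega> H f = H"
begin

section \<open>Representers of derivatives at a point\<close>

lemma H_smooth_functions: "h \<in> H \<Longrightarrow> h \<in> smooth_functions \<Omega>"
proof -
  assume "h \<in> H"
  then have "h \<in> topspace (smooth_topology \<Omega>)"
    using continuous_map_funspace[OF inclusion] by auto
  then show ?thesis
    unfolding smooth_topology_def topology_generated_by_topspace by auto
qed

lemma H_smooth_on: "h \<in> H \<Longrightarrow> smooth_on \<Omega> h"
  using H_smooth_functions by (simp add: smooth_functions_def)

lemma kernel: "x \<in> \<Omega> \<Longrightarrow> k x \<in> H" "x \<in> \<Omega> \<Longrightarrow> h \<in> H \<Longrightarrow> ip h (k x) = h x"
  using rkhs unfolding rkhs_def by blast+

lemma complete: "ms.mcomplete"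
  using rkhs unfolding rkhs_def by blast

lemma mderiv_plus: "q \<in> \<Omega> \<Longrightarrow> smooth_on \<Omega> g \<Longrightarrow> smooth_on \<Omega> h \<Longrightarrow> mderiv \<alpha> (g + h) q = mderiv \<alpha> g q + mderiv \<alpha> h q"
  using mderiv_add[OF open_Omega] by (simp add: plus_fun_def)

lemma mderiv_cscale: "q \<in> \<Omega> \<Longrightarrow> smooth_on \<Omega> h \<Longrightarrow> mderiv \<alpha> (cscale c h) q = c * mderiv \<alpha> h q"
  unfolding cscale_def by (rule mderiv_bounded_linear[OF open_Omega bounded_linear_mult_right])

lemma mderiv_const_0: "q \<in> \<Omega> \<Longrightarrow> mderiv \<alpha> (\<lambda>_. 0) q = (0::complex)"
  using mderiv_cscale[OF _ smooth_on_const, of q \<alpha> 0 0] by (simp add: cscale_def)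

text \<open>Continuity of the inclusion at 0, tested on the subbasic neighbourhood with the
  one-point compact set {q} and the bound 1.\<close>

lemma mderiv_bounded:
  assumes "q \<in> \<Omega>"
  obtains C where "\<And>h. h \<in> H \<Longrightarrow> norm (mderiv \<alpha> h q) \<le> C * nrm h"
proof -
  let ?U = "{g \<in> smooth_functions \<Omega>. \<forall>x\<in>{q}. norm (mderiv \<alpha> g x - mderiv \<alpha> 0 x) < 1}"
  have 0: "mderiv \<alpha> 0 q = (0::complex)"
    using mderiv_const_0[OF assms] by (simp add: zero_fun_def)
  have "openin (smooth_topology \<Omega>) ?U"
    unfolding smooth_topology_def
    by (rule topology_generated_by_Basis)
       (intro CollectI exI[of _ 0] exI[of _ \<alpha>] exI[of _ "{q}"] exI[of _ 1],
        use assms H_smooth_functions[OF H_zero] in simp)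
  from openin_continuous_map_preimage[OF inclusion this]
  have op: "openin (hilbert_topology H ip) {h \<in> H. h \<in> ?U}" by simp
  show thesis
  proof (rule bounded_on_neighbourhood[OF op, of "\<lambda>h. mderiv \<alpha> h q"])
    show "0 \<in> {h \<in> H. h \<in> ?U}" using H_zero H_smooth_functions[OF H_zero] by simp
    show "norm (mderiv \<alpha> h q) < 1" if "h \<in> {h \<in> H. h \<in> ?U}" for h
      using that by (simp add: 0)
    show "mderiv \<alpha> (cscale c h) q = c * mderiv \<alpha> h q" if "h \<in> H" for c h
      using mderiv_cscale[OF assms H_smooth_on[OF that]] .
    fix C assume "\<And>h. h \<in> H \<Longrightarrow> norm (mderiv \<alpha> h q) \<le> C * nrm h"
    then show thesis by (rule that)
  qed
qed

definition jet_gen :: "real^'d \<Rightarrow> ('d \<Rightarrow> nat) \<Rightarrow> real^'d \<Rightarrow> complex" where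
  "jet_gen q \<alpha> = (\<lambda>y. mderiv \<alpha> (\<lambda>x. k x y) q)"

text \<open>The Riesz representer g of the derivative at q is identified by its values: g(y) is the
  product of g with k_y, thus the conjugate of the derivative of k_y at q. Hermitian symmetry of the
  kernel turns this into the derivative in the first argument.\<close>

lemma jet_gen:
  assumes q: "q \<in> \<Omega>"
  shows jet_gen_H: "jet_gen q \<alpha> \<in> H" and ip_jet_gen: "h \<in> H \<Longrightarrow> ip h (jet_gen q \<alpha>) = mderiv \<alpha> h q"
proof -
  obtain C where C: "\<And>h. h \<in> H \<Longrightarrow> norm (mderiv \<alpha> h q) \<le> C * nrm h"
    using mderiv_bounded[OF q, of \<alpha>] by blast
  obtain g where g: "g \<in> H" "\<And>h. h \<in> H \<Longrightarrow> mderiv \<alpha> h q = ip h g"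
    using riesz_representation[OF complete, of "\<lambda>h. mderiv \<alpha> h q" C]
      mderiv_plus[OF q H_smooth_on H_smooth_on] mderiv_cscale[OF q H_smooth_on] C by blast
  have "jet_gen q \<alpha> y = g y" for y
  proof (cases "y \<in> \<Omega>")
    case True
    have "k x y = cnj (k y x)" if "x \<in> \<Omega>" for x
    proof -
      have "k x y = ip (k x) (k y)" "k y x = ip (k y) (k x)"
        using kernel True that by simp_all
      then show ?thesis using ip_cnj[OF kernel(1)[OF True] kernel(1)[OF that]] by simp
    qed
    then have "mderiv \<alpha> (\<lambda>x. k x y) q = mderiv \<alpha> (\<lambda>x. cnj (k y x)) q"
      by (rule mderiv_cong[OF open_Omega _ q])
    also have "\<dots> = cnj (mderiv \<alpha> (k y) q)"
      by (rule mderiv_bounded_linear[OF open_Omega bounded_linear_cnj H_smooth_on[OF kernel(1)[OF True]] q])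
    also have "\<dots> = ip g (k y)"
      using g kernel(1)[OF True] by (simp add: ip_cnj)
    finally show ?thesis using kernel(2)[OF True g(1)] by (simp add: jet_gen_def)
  next
    case False
    \<comment> \<open>Off \<Omega> both sides vanish, because all elements of H do, among them every
      k_x.\<close>
    have zero: "h y = 0" if "h \<in> H" for h
      using rkhs False that unfolding rkhs_def by blast
    have "mderiv \<alpha> (\<lambda>x. k x y) q = mderiv \<alpha> (\<lambda>_. 0 :: complex) q"
      by (rule mderiv_cong[OF open_Omega _ q]) (rule zero[OF kernel(1)])
    then show ?thesis using zero[OF g(1)] mderiv_const_0[OF q] by (simp add: jet_gen_def)
  qed
  then have "jet_gen q \<alpha> = g" by blast
  with g show "jet_gen q \<alpha> \<in> H" "h \<in> H \<Longrightarrow> ip h (jet_gen q \<alpha>) = mderiv \<alpha> h q" by simp_all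
qed

lemma jet_space_eq: "jet_space k q n = fs.span (jet_gen q ` {\<alpha>. msize \<alpha> \<le> n})"
  unfolding jet_space_def jet_gen_def by (rule arg_cong[of _ _ fs.span]) blast

section \<open>The adjoint as a graph\<close>

lemma ip_eqI:
  assumes "g \<in> H" "g' \<in> H" "\<And>h. h \<in> H \<Longrightarrow> ip h g = ip h g'"
  shows "g = g'"
proof -
  have "ip (g - g') (g - g') = 0"
    using assms(3)[OF H_diff[OF assms(1,2)]] assms(1,2) by (simp add: ip_diff_right H_diff)
  from ip_eq_0D[OF H_diff[OF assms(1,2)] this] show ?thesis by simp
qed

text \<open>Kept as a relation that includes membership in the domain: it is closed under linear
  combinations without appeal to uniqueness of the values.\<close>

definition adj :: "(real^'d \<Rightarrow> complex) \<Rightarrow> (real^'d \<Rightarrow> complex) \<Rightarrow> bool" where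
  "adj g g' \<longleftrightarrow> g \<in> H \<and> g' \<in> H \<and> (\<forall>h\<in>koopman_dom \<Omega> H f. ip (koopman \<Omega> f h) g = ip h g')"

lemma koopman_domD: "h \<in> koopman_dom \<Omega> H f \<Longrightarrow> h \<in> H \<and> koopman \<Omega> f h \<in> H"
  by (simp add: koopman_dom_def)

lemma adj_add: "adj g g' \<Longrightarrow> adj h h' \<Longrightarrow> adj (g + h) (g' + h')"
  unfolding adj_def using koopman_domD by (auto simp only: ip_add_right intro!: H_add)

lemma adj_scale: "adj g g' \<Longrightarrow> adj (cscale c g) (cscale c g')"
  unfolding adj_def using koopman_domD by (auto simp only: ip_scale_right intro!: H_scale)

lemma adj_zero: "adj 0 0"
  unfolding adj_def using koopman_domD H_zero by simp

lemma adj_sum: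
  assumes "finite F" "\<And>\<iota>. \<iota> \<in> F \<Longrightarrow> adj (g \<iota>) (g' \<iota>)"
  shows "adj (\<Sum>\<iota>\<in>F. g \<iota>) (\<Sum>\<iota>\<in>F. g' \<iota>)"
  using assms
proof (induction F)
  case (insert \<iota> F)
  then show ?case
    unfolding sum.insert[OF insert.hyps] by (intro adj_add) auto
qed (simp add: adj_zero)

text \<open>The difference x of two values is orthogonal to the domain. By density some h in the
  domain is closer to x than the norm of x, and then |x|^2 = <x - h, x> would be less than
  |x|^2.\<close>

lemma adj_unique:
  assumes "adj g g1" "adj g g2"
  shows "g1 = g2"
proof (rule ccontr)
  assume "g1 \<noteq> g2"
  have gH: "g1 \<in> H" "g2 \<in> H" using assms by (auto simp: adj_def)
  define x where "x = g1 - g2"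
  have x: "x \<in> H" unfolding x_def using gH by (rule H_diff)
  have pos: "nrm x > 0"
    using nrm_nonneg[OF x] nrm_eq_0[OF x] \<open>g1 \<noteq> g2\<close> by (simp add: x_def)
  have "x \<in> ms.mtopology closure_of koopman_dom \<Omega> H f"
    using dense x by (simp add: hilbert_topology_eq)
  then obtain h where h: "h \<in> koopman_dom \<Omega> H f" "h \<in> ms.mball x (nrm x)"
    unfolding ms.metric_closure_of using pos by blast
  have hH: "h \<in> H" using koopman_domD[OF h(1)] by blast
  have "ip h g1 = ip h g2" using assms h(1) by (simp add: adj_def)
  then have "ip h x = 0" using gH hH by (simp add: x_def ip_diff_right)
  then have "ip x x = ip (x - h) x" using x hH by (simp add: ip_diff_left)
  then have "(nrm x)\<^sup>2 \<le> nrm (x - h) * nrm x"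
    using cauchy_schwarz[OF H_diff[OF x hH] x] complex_Re_le_cmod[of "ip x x"] nrm_power2[OF x] by simp
  moreover have "nrm (x - h) < nrm x"
    using h(2) x hH by (simp add: hdist_eq)
  ultimately show False using pos by (simp add: power2_eq_square)
qed

lemma adj_koopman_adj:
  assumes "adj g g'"
  shows "koopman_adj \<Omega> H ip f g = g'" "g \<in> koopman_adj_dom \<Omega> H ip f"
proof -
  have gH: "g \<in> H" using assms by (simp add: adj_def)
  then have eq: "(g' \<in> H \<and> (\<forall>h\<in>koopman_dom \<Omega> H f. ip (koopman \<Omega> f h) g = ip h g')) \<longleftrightarrow> adj g g'" for g'
    by (simp add: adj_def)
  show "koopman_adj \<Omega> H ip f g = g'"
    unfolding koopman_adj_def adjoint_op_def eq
    by (rule the_equality, rule assms, rule adj_unique[OF _ assms])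
  show "g \<in> koopman_adj_dom \<Omega> H ip f"
    unfolding koopman_adj_dom_def adjoint_dom_def using assms by (auto simp: adj_def)
qed

text \<open>The vector \<open>L \<gamma>\<close> represents the coefficient functional \<open>a \<gamma>\<close>, \<open>w \<gamma>\<close> is the eigenvector with leading
  term \<open>L \<gamma>\<close>, and the \<open>e \<beta>\<close> are the test functions \<open>\<ell>\<^sup>\<beta>\<close>.\<close>

definition eigen_data ::
  "real^'d \<Rightarrow> ('d \<Rightarrow> complex) \<Rightarrow> (('d \<Rightarrow> nat) \<Rightarrow> real^'d \<Rightarrow> complex) \<Rightarrow> (('d \<Rightarrow> nat) \<Rightarrow> real^'d \<Rightarrow> complex) \<Rightarrow>
   (('d \<Rightarrow> nat) \<Rightarrow> (real^'d \<Rightarrow> complex) \<Rightarrow> complex) \<Rightarrow> (('d \<Rightarrow> nat) \<Rightarrow> real^'d \<Rightarrow> complex) \<Rightarrow> bool" where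
  "eigen_data p l L w a e \<longleftrightarrow>
     (\<forall>\<gamma>. L \<gamma> \<in> H \<and> (\<forall>h\<in>H. ip h (L \<gamma>) = a \<gamma> h)) \<and>
     (\<forall>\<gamma>. (\<lambda>h. if h \<in> smooth_functions \<Omega> then a \<gamma> h else 0) \<in> delta_space \<Omega> p) \<and>
     (\<forall>\<beta>. smooth_on \<Omega> (e \<beta>)) \<and>
     (\<forall>q \<alpha> \<beta>. smooth_on \<Omega> q \<longrightarrow> msize \<alpha> \<le> msize \<beta> \<longrightarrow> a \<alpha> (\<lambda>x. e \<beta> x * q x) = (if \<alpha> = \<beta> then q p else 0)) \<and>
     (\<forall>g \<gamma>. (\<forall>\<alpha>. msize \<alpha> = msize \<gamma> \<longrightarrow> mderiv \<alpha> g p = 0) \<longrightarrow> a \<gamma> g = 0) \<and>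
     (\<forall>g h \<gamma>. (\<forall>x\<in>\<Omega>. g x = h x) \<longrightarrow> a \<gamma> g = a \<gamma> h) \<and>
     (\<forall>\<gamma>. adj (w \<gamma>) (cscale (cnj (mpow l \<gamma>)) (w \<gamma>))) \<and>
     (\<forall>\<gamma>. w \<gamma> - L \<gamma> \<in> fs.span (L ` {\<beta>. msize \<beta> < msize \<gamma>})) \<and>
     (\<forall>n. jet_space k p n = fs.span (L ` {\<beta>. msize \<beta> \<le> n}))"

theorem eigen_data_exists:
  assumes "p \<in> \<Omega>" "f p = p" "smooth_on \<Omega> f"
    and "eigenvalues_with_mult (matrix (frechet_derivative f (at p))) l" "inj (mpow l)"
  shows "\<exists>L w a e. eigen_data p l L w a e"
proof -
  note p = assms(1)
  obtain N P B e a where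
    a: "\<And>\<beta> h. a \<beta> h = (\<Sum>\<alpha> | msize \<alpha> = msize \<beta>. N \<beta> \<alpha> * mderiv \<alpha> h p)"
    and P: "\<And>\<alpha> h. smooth_on \<Omega> h \<Longrightarrow> mderiv \<alpha> h p = (\<Sum>\<beta> | msize \<beta> = msize \<alpha>. P \<alpha> \<beta> * a \<beta> h)"
    and B: "\<And>\<gamma> h g. smooth_on \<Omega> h \<Longrightarrow> smooth_on \<Omega> g \<Longrightarrow> (\<And>x. x \<in> \<Omega> \<Longrightarrow> g x = h (f x)) \<Longrightarrow>
      a \<gamma> g = mpow l \<gamma> * a \<gamma> h + (\<Sum>\<beta> | msize \<beta> < msize \<gamma>. B \<gamma> \<beta> * a \<beta> h)"
    and e: "\<And>\<beta>. smooth_on \<Omega> (e \<beta>)"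
    and ae: "\<And>\<alpha> \<beta> q. smooth_on \<Omega> q \<Longrightarrow> msize \<alpha> \<le> msize \<beta> \<Longrightarrow>
      a \<alpha> (\<lambda>x. e \<beta> x * q x) = (if \<alpha> = \<beta> then q p else 0)"
  proof (rule adapted_jets[OF open_Omega assms], goal_cases)
    case (1 N P B e a)
    show ?case by (rule that[of a N P B e]) (fact 1)+
  qed
  let ?G = "jet_gen p"
  \<comment> \<open>Passing from functionals to representers conjugates all scalars, here those of N
    and further down those of P, B and the eigenvalues.\<close>
  define L where "L \<gamma> = (\<Sum>\<alpha> | msize \<alpha> = msize \<gamma>. cscale (cnj (N \<gamma> \<alpha>)) (?G \<alpha>))" for \<gamma>
  have LH: "L \<gamma> \<in> H" for \<gamma>
    unfolding L_def by (intro H_sum H_scale jet_gen_H p)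
  have ip_sum: "ip h (\<Sum>\<beta>\<in>S. cscale (cnj (c \<beta>)) (x \<beta>)) = (\<Sum>\<beta>\<in>S. c \<beta> * ip h (x \<beta>))"
    if "h \<in> H" "\<And>\<beta>. x \<beta> \<in> H" for h and S :: "('d \<Rightarrow> nat) set" and c x
  proof -
    have "ip h (\<Sum>\<beta>\<in>S. cscale (cnj (c \<beta>)) (x \<beta>)) = (\<Sum>\<beta>\<in>S. ip h (cscale (cnj (c \<beta>)) (x \<beta>)))"
      by (rule ip_sum_right[OF H_scale[OF that(2)] that(1)])
    then show ?thesis by (simp only: ip_scale_right[OF that(2,1)] complex_cnj_cnj)
  qed
  have ipL: "ip h (L \<gamma>) = a \<gamma> h" if "h \<in> H" for h \<gamma>
    unfolding L_def by (simp only: ip_sum[OF that jet_gen_H[OF p]] ip_jet_gen[OF p that] a)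
  \<comment> \<open>P inverts the passage to the representers of the same order, so both families
    span the jet space on every level.\<close>
  have GL: "?G \<alpha> = (\<Sum>\<beta> | msize \<beta> = msize \<alpha>. cscale (cnj (P \<alpha> \<beta>)) (L \<beta>))" for \<alpha>
  proof (rule ip_eqI[OF jet_gen_H[OF p]])
    show "(\<Sum>\<beta> | msize \<beta> = msize \<alpha>. cscale (cnj (P \<alpha> \<beta>)) (L \<beta>)) \<in> H"
      by (intro H_sum H_scale LH)
    show "ip h (?G \<alpha>) = ip h (\<Sum>\<beta> | msize \<beta> = msize \<alpha>. cscale (cnj (P \<alpha> \<beta>)) (L \<beta>))" if "h \<in> H" for h
      by (simp only: ip_sum[OF that LH] ipL[OF that] ip_jet_gen[OF p that] P[OF H_smooth_on[OF that], symmetric])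
  qed
  have span: "jet_space k p n = fs.span (L ` {\<beta>. msize \<beta> \<le> n})" for n
    unfolding jet_space_eq
  proof (rule fs.span_eq[THEN iffD2], intro conjI subsetI)
    fix x assume "x \<in> ?G ` {\<alpha>. msize \<alpha> \<le> n}"
    then obtain \<alpha> where \<alpha>: "msize \<alpha> \<le> n" "x = ?G \<alpha>" by blast
    show "x \<in> fs.span (L ` {\<beta>. msize \<beta> \<le> n})"
      unfolding \<alpha>(2) GL using \<alpha>(1) by (intro fs.span_sum fs.span_scale fs.span_base imageI) auto
  next
    fix x assume "x \<in> L ` {\<beta>. msize \<beta> \<le> n}"
    then obtain \<gamma> where \<gamma>: "msize \<gamma> \<le> n" "x = L \<gamma>" by blast
    show "x \<in> fs.span (?G ` {\<alpha>. msize \<alpha> \<le> n})"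
      unfolding \<gamma>(2) L_def using \<gamma>(1) by (intro fs.span_sum fs.span_scale fs.span_base imageI) auto
  qed
  have adjL: "adj (L \<gamma>) (cscale (cnj (mpow l \<gamma>)) (L \<gamma>) + (\<Sum>\<beta> | msize \<beta> < msize \<gamma>. cscale (cnj (B \<gamma> \<beta>)) (L \<beta>)))"
    (is "adj _ ?K") for \<gamma>
    unfolding adj_def
  proof (intro conjI ballI LH H_add H_scale H_sum)
    fix h assume h: "h \<in> koopman_dom \<Omega> H f"
    let ?Ch = "koopman \<Omega> f h"
    have hH: "h \<in> H" "?Ch \<in> H" using koopman_domD[OF h] by auto
    have "ip ?Ch (L \<gamma>) = a \<gamma> ?Ch" by (rule ipL[OF hH(2)])
    also have "\<dots> = mpow l \<gamma> * a \<gamma> h + (\<Sum>\<beta> | msize \<beta> < msize \<gamma>. B \<gamma> \<beta> * a \<beta> h)"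
      by (rule B[OF H_smooth_on[OF hH(1)] H_smooth_on[OF hH(2)]]) (simp add: koopman_def)
    also have "\<dots> = ip h ?K"
      by (simp only: ip_add_right[OF H_scale[OF LH] H_sum[OF H_scale[OF LH]] hH(1)]
          ip_scale_right[OF LH hH(1)] complex_cnj_cnj ip_sum[OF hH(1) LH] ipL[OF hH(1)])
    finally show "ip ?Ch (L \<gamma>) = ip h ?K" .
  qed
  have distinct: "cnj (mpow l \<beta>) \<noteq> cnj (mpow l \<gamma>)" if "msize \<beta> < msize \<gamma>" for \<beta> \<gamma>
    using injD[OF assms(5), of \<beta> \<gamma>] that by auto
  have "\<forall>\<gamma>. \<exists>x. adj x (cscale (cnj (mpow l \<gamma>)) x) \<and> x - L \<gamma> \<in> fs.span (L ` {\<beta>. msize \<beta> < msize \<gamma>})"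
    by (intro allI triangular_eigenvectors[where R = adj and deg = msize, OF finite_msize_less adj_add adj_scale adj_zero adjL distinct])
  from choice[OF this] obtain w where
    w: "\<And>\<gamma>. adj (w \<gamma>) (cscale (cnj (mpow l \<gamma>)) (w \<gamma>))" "\<And>\<gamma>. w \<gamma> - L \<gamma> \<in> fs.span (L ` {\<beta>. msize \<beta> < msize \<gamma>})"
    by blast
  have delta: "(\<lambda>h. if h \<in> smooth_functions \<Omega> then a \<gamma> h else 0) \<in> delta_space \<Omega> p" for \<gamma>
  proof -
    have "(\<lambda>h. if h \<in> smooth_functions \<Omega> then a \<gamma> h else 0)
      = (\<Sum>\<alpha> | msize \<alpha> = msize \<gamma>. cscale (N \<gamma> \<alpha>) (delta \<Omega> p \<alpha>))"
      by (simp add: fun_eq_iff sum_fun_apply cscale_def delta_def a)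
    also have "\<dots> \<in> delta_space \<Omega> p"
      unfolding delta_space_def by (intro fs.span_sum fs.span_scale fs.span_base rangeI)
    finally show ?thesis .
  qed
  have vanish: "a \<gamma> g = 0" if "\<And>\<alpha>. msize \<alpha> = msize \<gamma> \<Longrightarrow> mderiv \<alpha> g p = 0" for g \<gamma>
    unfolding a using that by (intro sum.neutral) auto
  have cong: "a \<gamma> g = a \<gamma> h" if "\<And>x. x \<in> \<Omega> \<Longrightarrow> g x = h x" for g h \<gamma>
    unfolding a by (rule sum.cong[OF refl]) (simp only: mderiv_cong[OF open_Omega that p])
  have "eigen_data p l L w a e"
    unfolding eigen_data_def
    by (intro conjI allI impI ballI LH ipL delta e ae vanish cong w span) blast+
  then show ?thesis by blast
qed

text \<open>A relation among representers says that a functional vanishes on H; injectivity of the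
  dual inclusion makes it vanish on all smooth functions. The test function is the monomial of an
  index of highest order, times a factor that suppresses the jets at the other points up to that
  order, so that this one coefficient survives.\<close>

theorem jets_independent:
  fixes p :: "nat \<Rightarrow> real^'d"
  assumes p: "inj_on p {1..r}" "\<And>i. i \<in> {1..r} \<Longrightarrow> p i \<in> \<Omega>"
    and data: "\<And>i. i \<in> {1..r} \<Longrightarrow> eigen_data (p i) (l i) (L i) (w i) (a i) (e i)"
    and inj: "inj_on (dual_inclusion H) (subspace_sum {1..r} (\<lambda>i. delta_space \<Omega> (p i)))"
    and F: "finite F" "F \<subseteq> {1..r} \<times> UNIV" "(\<Sum>\<iota>\<in>F. cscale (c \<iota>) (L (fst \<iota>) (snd \<iota>))) = 0" "\<iota> \<in> F"
  shows "c \<iota> = 0"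
proof (rule ccontr)
  let ?F = "{\<iota> \<in> F. c \<iota> \<noteq> 0}" and ?d = "\<lambda>\<iota>. msize (snd \<iota>)"
  assume "c \<iota> \<noteq> 0"
  with F(4) have "\<iota> \<in> ?F" by simp
  then have "finite (?d ` ?F)" "?d ` ?F \<noteq> {}"
    using F(1) by (simp, blast)
  from Max_in[OF this] obtain \<iota>0 where
    i0: "Max (?d ` ?F) = msize (snd \<iota>0)" "\<iota>0 \<in> ?F" by (rule imageE)
  have max: "msize (snd \<kappa>) \<le> msize (snd \<iota>0)" if "\<kappa> \<in> ?F" for \<kappa>
    unfolding i0(1)[symmetric] using that F(1) by (intro Max_ge) auto
  obtain j \<beta> where j\<beta>: "\<iota>0 = (j, \<beta>)" by (cases \<iota>0)
  have j: "j \<in> {1..r}" using i0(2) F(2) j\<beta> by auto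
  define A where "A i \<gamma> h = (if h \<in> smooth_functions \<Omega> then a i \<gamma> h else 0)" for i \<gamma> h
  \<comment> \<open>The coefficients sit in the second argument of \<open>ip\<close>, so the
    functional carries their conjugates.\<close>
  define \<psi> where "\<psi> = (\<Sum>\<iota>\<in>F. cscale (cnj (c \<iota>)) (A (fst \<iota>) (snd \<iota>)))"
  let ?D = "subspace_sum {1..r} (\<lambda>i. delta_space \<Omega> (p i))"
  have D: "?D = fs.span (\<Union>i\<in>{1..r}. range (delta \<Omega> (p i)))"
    unfolding delta_space_def by (rule subspace_sum_span) simp
  have A_D: "A i \<gamma> \<in> ?D" if i: "i \<in> {1..r}" for i \<gamma>
  proof -
    have "A i \<gamma> \<in> delta_space \<Omega> (p i)"
      using data[OF i] unfolding eigen_data_def A_def[abs_def] by blast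
    moreover have "delta_space \<Omega> (p i) \<subseteq> ?D"
      unfolding D unfolding delta_space_def using i by (intro fs.span_mono) blast
    ultimately show ?thesis by blast
  qed
  have "\<psi> \<in> ?D"
  proof -
    have "A (fst \<iota>) (snd \<iota>) \<in> ?D" if "\<iota> \<in> F" for \<iota>
      using that F(2) by (intro A_D) auto
    then show ?thesis
      unfolding \<psi>_def D by (intro fs.span_sum fs.span_scale)
  qed
  moreover have "0 \<in> ?D" unfolding D by (rule fs.span_zero)
  moreover have "dual_inclusion H \<psi> = dual_inclusion H 0"
  proof -
    have "\<psi> h = 0" if h: "h \<in> H" for h
    proof -
      have L: "L (fst \<iota>) (snd \<iota>) \<in> H" "ip h (L (fst \<iota>) (snd \<iota>)) = a (fst \<iota>) (snd \<iota>) h" if "\<iota> \<in> F" for \<iota>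
      proof -
        have "fst \<iota> \<in> {1..r}" using that F(2) by auto
        from data[OF this] show "L (fst \<iota>) (snd \<iota>) \<in> H" "ip h (L (fst \<iota>) (snd \<iota>)) = a (fst \<iota>) (snd \<iota>) h"
          unfolding eigen_data_def using h by blast+
      qed
      have "\<psi> h = (\<Sum>\<iota>\<in>F. cnj (c \<iota>) * a (fst \<iota>) (snd \<iota>) h)"
        by (simp add: \<psi>_def sum_fun_apply cscale_def A_def H_smooth_functions[OF h])
      also have "\<dots> = (\<Sum>\<iota>\<in>F. ip h (cscale (c \<iota>) (L (fst \<iota>) (snd \<iota>))))"
        using L h by (intro sum.cong) (simp_all add: ip_scale_right)
      also have "\<dots> = ip h (\<Sum>\<iota>\<in>F. cscale (c \<iota>) (L (fst \<iota>) (snd \<iota>)))"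
        using L h by (intro ip_sum_right[symmetric] H_scale) auto
      finally show ?thesis using F(3) h by simp
    qed
    then show ?thesis by (simp add: dual_inclusion_def restrict_def fun_eq_iff)
  qed
  ultimately have \<psi>0: "\<psi> = 0" using inj_onD[OF inj] by blast
  let ?P = "p ` ({1..r} - {j})"
  have P: "?P \<subseteq> \<Omega>" "p j \<notin> ?P"
  proof -
    show "?P \<subseteq> \<Omega>" using p(2) by blast
    show "p j \<notin> ?P"
    proof
      assume "p j \<in> ?P"
      then obtain i where "i \<in> {1..r}" "i \<noteq> j" "p j = p i" by blast
      then show False using inj_onD[OF p(1), of j i] j by blast
    qed
  qed
  have "finite ?P" by simp
  \<comment> \<open>Vanishing up to the order of \<beta> is enough, since no index with nonzero
    coefficient has a higher order.\<close>
  from vanishing_factor[OF open_Omega this P, of "msize \<beta>"] obtain q :: "real^'d \<Rightarrow> complex" where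
    q: "smooth_on \<Omega> q" "q (p j) \<noteq> 0"
    "\<And>p' s \<alpha>. p' \<in> ?P \<Longrightarrow> smooth_on \<Omega> s \<Longrightarrow> msize \<alpha> \<le> msize \<beta> \<Longrightarrow> mderiv \<alpha> (\<lambda>x. s x * q x) p' = 0"
    by blast
  define h0 where "h0 x = e j \<beta> x * q x" for x
  \<comment> \<open>Set to 0 off \<Omega> to belong to \<open>smooth_functions\<close>; the jets at
    points of \<Omega> are unaffected.\<close>
  define h where "h x = (if x \<in> \<Omega> then h0 x else 0)" for x
  have se: "smooth_on \<Omega> (e j \<beta>)" using data[OF j] unfolding eigen_data_def by blast
  have "h \<in> smooth_functions \<Omega>"
    unfolding h_def[abs_def] h0_def
    by (intro smooth_functions_restrict open_Omega smooth_on_mult se q(1))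
  then have "\<psi> h = (\<Sum>\<iota>\<in>F. cnj (c \<iota>) * a (fst \<iota>) (snd \<iota>) h)"
    by (simp add: \<psi>_def sum_fun_apply cscale_def A_def)
  also have "\<dots> = (\<Sum>\<iota>\<in>F. if \<iota> = \<iota>0 then cnj (c \<iota>0) * q (p j) else 0)"
  proof (rule sum.cong[OF refl])
    fix \<iota> assume \<iota>: "\<iota> \<in> F"
    obtain i \<gamma> where i\<gamma>: "\<iota> = (i, \<gamma>)" by (cases \<iota>)
    have i: "i \<in> {1..r}" using \<iota> F(2) i\<gamma> by auto
    have ah: "a i \<gamma> h = a i \<gamma> h0"
      using data[OF i] unfolding eigen_data_def by (simp add: h_def)
    have main: "a i \<gamma> h0 = (if (i, \<gamma>) = (j, \<beta>) then q (p j) else 0)" if le: "msize \<gamma> \<le> msize \<beta>"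
    proof (cases "i = j")
      case True
      have "a j \<gamma> (\<lambda>x. e j \<beta> x * q x) = (if \<gamma> = \<beta> then q (p j) else 0)"
        using data[OF j] q(1) le unfolding eigen_data_def by blast
      then show ?thesis using True by (simp add: h0_def[abs_def])
    next
      case False
      have "mderiv \<alpha> h0 (p i) = 0" if "msize \<alpha> = msize \<gamma>" for \<alpha>
        unfolding h0_def[abs_def] using False i le that by (intro q(3) se) auto
      then have "a i \<gamma> h0 = 0"
        using data[OF i] unfolding eigen_data_def by blast
      then show ?thesis using False by simp
    qed
    show "cnj (c \<iota>) * a (fst \<iota>) (snd \<iota>) h = (if \<iota> = \<iota>0 then cnj (c \<iota>0) * q (p j) else 0)"
    proof (cases "c \<iota> = 0")
      case True
      then show ?thesis using i0(2) by auto
    next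
      case False
      then have "msize \<gamma> \<le> msize \<beta>" using max[of \<iota>] \<iota> by (simp add: i\<gamma> j\<beta>)
      from main[OF this] show ?thesis by (simp add: i\<gamma> j\<beta> ah)
    qed
  qed
  also have "\<dots> = cnj (c \<iota>0) * q (p j)"
    using i0(2) F(1) by simp
  finally show False using \<psi>0 i0(2) q(2) by simp
qed

end

theorem corollary4p10:
  fixes \<Omega> :: "(real^'d::finite) set"
    and H :: "(real^'d \<Rightarrow> complex) set"
    and ip :: "(real^'d \<Rightarrow> complex) \<Rightarrow> (real^'d \<Rightarrow> complex) \<Rightarrow> complex"
    and k :: "real^'d \<Rightarrow> real^'d \<Rightarrow> complex"
    and f :: "real^'d \<Rightarrow> real^'d"
    and r :: nat
    and p :: "nat \<Rightarrow> real^'d"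
    and lam :: "nat \<Rightarrow> 'd \<Rightarrow> complex"
  assumes "open \<Omega>" and "connected \<Omega>"
    and "rkhs \<Omega> H ip k"
    and "continuous_map (hilbert_topology H ip) (smooth_topology \<Omega>) (\<lambda>h. h)"
    and "\<forall>h\<in>H. real_analytic_on \<Omega> h"
    and "f \<in> \<Omega> \<rightarrow> \<Omega>" and "smooth_on \<Omega> f"
    and "hilbert_topology H ip closure_of koopman_dom \<Omega> H f = H"
    and "1 \<le> r" and "inj_on p {1..r}"
    and "\<forall>i\<in>{1..r}. p i \<in> \<Omega> \<and> f (p i) = p i"
    and "\<forall>i\<in>{1..r}.
           eigenvalues_with_mult (matrix (frechet_derivative f (at (p i)))) (lam i)"
    and "inj_on (dual_inclusion H) (subspace_sum {1..r} (\<lambda>i. delta_space \<Omega> (p i)))"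
    and "\<forall>i\<in>{1..r}. \<forall>\<alpha> \<beta>. \<alpha> \<noteq> \<beta> \<longrightarrow> mpow (lam i) \<alpha> \<noteq> mpow (lam i) \<beta>"
  shows "\<exists>(w :: nat \<Rightarrow> ('d \<Rightarrow> nat) \<Rightarrow> real^'d \<Rightarrow> complex)
          (u :: nat \<Rightarrow> ('d \<Rightarrow> nat) \<Rightarrow> nat \<Rightarrow> real^'d \<Rightarrow> complex).
    (\<forall>i\<in>{1..r}. \<forall>\<alpha>. w i \<alpha> \<in> Phi (jet_sum k p r) \<and> u i \<alpha> \<in> Phi_star ip (jet_sum k p r)) \<and>
    (\<forall>i\<in>{1..r}. \<forall>\<alpha>.
       ext_koopman \<Omega> H ip f (jet_sum k p r) (u i \<alpha>) = pscale (mpow (lam i) \<alpha>) (u i \<alpha>)) \<and>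
    (\<forall>i\<in>{1..r}. \<forall>\<alpha>. w i \<alpha> \<in> koopman_adj_dom \<Omega> H ip f \<and>
       koopman_adj \<Omega> H ip f (w i \<alpha>) = cscale (cnj (mpow (lam i) \<alpha>)) (w i \<alpha>)) \<and>
    (\<forall>i\<in>{1..r}. \<forall>j\<in>{1..r}. \<forall>\<alpha> \<beta>.
       pairing ip (w j \<beta>) (u i \<alpha>) = (if (i, \<alpha>) = (j, \<beta>) then 1 else 0)) \<and>
    (\<forall>v\<in>Phi_star ip (jet_sum k p r).
       limitin (Phi_star_topology H ip (jet_sum k p r))
         (\<lambda>F. \<Sum>(i, \<alpha>)\<in>F. pscale (mpow (lam i) \<alpha> * cnj (pairing ip (w i \<alpha>) v)) (u i \<alpha>))
         (ext_koopman \<Omega> H ip f (jet_sum k p r) v)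
         (finite_subsets_at_top ({1..r} \<times> UNIV))) \<and>
    (\<forall>v\<in>Phi (jet_sum k p r). v \<in> koopman_adj_dom \<Omega> H ip f \<and>
       limitin (Phi_topology H ip (jet_sum k p r))
         (\<lambda>F. \<Sum>(i, \<alpha>)\<in>F. cscale (cnj (mpow (lam i) \<alpha>) * pairing ip v (u i \<alpha>)) (w i \<alpha>))
         (koopman_adj \<Omega> H ip f v)
         (finite_subsets_at_top ({1..r} \<times> UNIV)))"
proof -
  have "inner_product_on H ip" using assms(3) unfolding rkhs_def by blast
  then interpret K: koopman_rkhs H ip \<Omega> k f
    using assms(1,3,4,8) by (intro koopman_rkhs.intro ip_space.intro koopman_rkhs_axioms.intro)
  let ?I = "{1..r} \<times> (UNIV :: ('d \<Rightarrow> nat) set)"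
  let ?W = "jet_sum k p r"
  \<comment> \<open>The four families at a point are packed into one tuple, so that a single choice
    over the points suffices.\<close>
  let ?data = "\<lambda>i z. K.eigen_data (p i) (lam i) (fst z) (fst (snd z)) (fst (snd (snd z))) (snd (snd (snd z)))"
  let ?adj = "koopman_adj \<Omega> H ip f"
  have ex: "\<exists>z. ?data i z"
    if i: "i \<in> {1..r}" for i
  proof -
    have "inj (mpow (lam i))" using assms(14) i unfolding inj_def by blast
    then obtain L w a e where "K.eigen_data (p i) (lam i) L w a e"
      using K.eigen_data_exists[of "p i" "lam i"] assms(7,11,12) i by blast
    then show ?thesis by (intro exI[of _ "(L, w, a, e)"]) simp
  qed
  then have "\<forall>i\<in>{1..r}. \<exists>z. ?data i z"
    by blast
  from bchoice[OF this] obtain z where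
    z: "\<And>i. i \<in> {1..r} \<Longrightarrow> ?data i (z i)"
    by blast
  define L w where "L i = fst (z i)" and "w i = fst (snd (z i))" for i
  \<comment> \<open>From here on pairs of point and multi-index form one index set, graded by the
    order of the multi-index at all points simultaneously.\<close>
  define L' w' where "L' \<iota> = L (fst \<iota>) (snd \<iota>)" and "w' \<iota> = w (fst \<iota>) (snd \<iota>)" for \<iota>
  define lam' where "lam' \<iota> = mpow (lam (fst \<iota>)) (snd \<iota>)" for \<iota>
  define deg :: "nat \<times> ('d \<Rightarrow> nat) \<Rightarrow> nat" where "deg \<iota> = msize (snd \<iota>)" for \<iota>
  note data = z[unfolded K.eigen_data_def]
  have adj: "K.adj (w' \<iota>) (cscale (cnj (lam' \<iota>)) (w' \<iota>))" if "\<iota> \<in> ?I" for \<iota>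
    using data[of "fst \<iota>"] that unfolding w'_def w_def lam'_def by auto
  have span: "jet_space k (p i) n = fs.span (L i ` {\<beta>. msize \<beta> \<le> n})" if "i \<in> {1..r}" for i n
    using data[OF that] unfolding L_def by blast
  have tri: "w' \<iota> - L' \<iota> \<in> fs.span (L' ` {\<kappa> \<in> ?I. deg \<kappa> < deg \<iota>})" if "\<iota> \<in> ?I" for \<iota>
  proof -
    have i: "fst \<iota> \<in> {1..r}" using that by auto
    have "w' \<iota> - L' \<iota> \<in> fs.span (L (fst \<iota>) ` {\<beta>. msize \<beta> < msize (snd \<iota>)})"
      using data[OF i] unfolding L_def w_def L'_def w'_def by blast
    moreover have "L (fst \<iota>) ` {\<beta>. msize \<beta> < msize (snd \<iota>)} \<subseteq> L' ` {\<kappa> \<in> ?I. deg \<kappa> < deg \<iota>}"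
    proof
      fix x assume "x \<in> L (fst \<iota>) ` {\<beta>. msize \<beta> < msize (snd \<iota>)}"
      then obtain \<beta> where "msize \<beta> < msize (snd \<iota>)" "x = L (fst \<iota>) \<beta>" by blast
      then show "x \<in> L' ` {\<kappa> \<in> ?I. deg \<kappa> < deg \<iota>}"
        using i by (intro image_eqI[of _ _ "(fst \<iota>, \<beta>)"]) (auto simp: L'_def deg_def)
    qed
    ultimately show ?thesis using fs.span_mono by blast
  qed
  have level: "{\<iota> \<in> ?I. deg \<iota> \<le> n} = {1..r} \<times> {\<beta>. msize \<beta> \<le> n}" for n
    by (auto simp: deg_def)
  have fin: "finite {\<iota> \<in> ?I. deg \<iota> \<le> n}" for n
    unfolding level by (intro finite_cartesian_product finite_atLeastAtMost finite_msize_le)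
  have L_indep: "c \<iota> = 0" if "finite F" "F \<subseteq> ?I" "(\<Sum>\<iota>\<in>F. cscale (c \<iota>) (L' \<iota>)) = 0" "\<iota> \<in> F" for F c \<iota>
    using K.jets_independent[OF assms(10) _ z assms(13) that(1,2) _ that(4)] assms(11) that(3)
    unfolding L'_def L_def by blast
  have W: "?W n = fs.span (w' ` {\<iota> \<in> ?I. deg \<iota> \<le> n})" for n
  proof -
    have "?W n = subspace_sum {1..r} (\<lambda>i. fs.span (L i ` {\<beta>. msize \<beta> \<le> n}))"
      unfolding jet_sum_def subspace_sum_def using span by (intro Collect_cong) simp
    also have "\<dots> = fs.span (\<Union>i\<in>{1..r}. L i ` {\<beta>. msize \<beta> \<le> n})"
      by (rule subspace_sum_span) simp
    also have "(\<Union>i\<in>{1..r}. L i ` {\<beta>. msize \<beta> \<le> n}) = L' ` {\<iota> \<in> ?I. deg \<iota> \<le> n}"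
      unfolding level by (force simp: L'_def)
    also have "fs.span \<dots> = fs.span (w' ` {\<iota> \<in> ?I. deg \<iota> \<le> n})"
    proof (rule triangular_span_eq[where deg = deg, symmetric])
      fix \<iota> assume \<iota>: "\<iota> \<in> {\<iota> \<in> ?I. deg \<iota> \<le> n}"
      \<comment> \<open>A level is closed under passing to smaller degrees, so triangularity
        restricts to it.\<close>
      then have "{\<beta> \<in> {\<iota> \<in> ?I. deg \<iota> \<le> n}. deg \<beta> < deg \<iota>} = {\<kappa> \<in> ?I. deg \<kappa> < deg \<iota>}" by auto
      then show "w' \<iota> - L' \<iota> \<in> fs.span (L' ` {\<beta> \<in> {\<iota> \<in> ?I. deg \<iota> \<le> n}. deg \<beta> < deg \<iota>})"
        using tri \<iota> by simp
    qed
    finally show ?thesis .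
  qed
  \<comment> \<open>Serves twice: for the action of the adjoint on finite combinations and for the
    inclusion of \<open>Phi\<close> in its domain.\<close>
  have adj_comb: "K.adj (\<Sum>\<iota>\<in>F. cscale (c \<iota>) (w' \<iota>)) (\<Sum>\<iota>\<in>F. cscale (cnj (lam' \<iota>) * c \<iota>) (w' \<iota>))"
    if "finite F" "F \<subseteq> ?I" for F c
  proof (rule K.adj_sum[OF that(1)])
    fix \<iota> assume "\<iota> \<in> F"
    then have "K.adj (cscale (c \<iota>) (w' \<iota>)) (cscale (c \<iota>) (cscale (cnj (lam' \<iota>)) (w' \<iota>)))"
      using that(2) by (intro K.adj_scale adj) blast
    then show "K.adj (cscale (c \<iota>) (w' \<iota>)) (cscale (cnj (lam' \<iota>) * c \<iota>) (w' \<iota>))"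
      by (simp only: fs.scale_scale mult.commute)
  qed
  interpret E: rigged_eigenbasis H ip ?I deg w' lam' ?W ?adj
  proof
    show "w' \<iota> \<in> H" if "\<iota> \<in> ?I" for \<iota>
      using adj[OF that] by (simp add: K.adj_def)
    show "c \<iota> = 0" if "finite F" "F \<subseteq> ?I" "(\<Sum>\<iota>\<in>F. cscale (c \<iota>) (w' \<iota>)) = 0" "\<iota> \<in> F" for F c \<iota>
      by (rule triangular_independent[where deg = deg and I = ?I and L = L' and w = w' and c = c, OF fin _ tri that])
        (rule L_indep)
    show "?adj (\<Sum>\<iota>\<in>F. cscale (c \<iota>) (w' \<iota>)) = (\<Sum>\<iota>\<in>F. cscale (cnj (lam' \<iota>) * c \<iota>) (w' \<iota>))"
      if "finite F" "F \<subseteq> ?I" for F c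
      by (rule K.adj_koopman_adj(1)[OF adj_comb[OF that]])
  qed (fact fin W)+
  have ext: "ext_koopman \<Omega> H ip f ?W = E.ext_op"
    unfolding ext_koopman_def by (rule E.ext_op_unique)
  have inI: "(i, \<alpha>) \<in> ?I" if "i \<in> {1..r}" for i \<alpha> using that by simp
  have w': "w i \<alpha> = w' (i, \<alpha>)" and lam': "mpow (lam i) \<alpha> = lam' (i, \<alpha>)" for i \<alpha>
    by (simp_all add: w'_def lam'_def)
  have dom: "v \<in> koopman_adj_dom \<Omega> H ip f" if v: "v \<in> Phi ?W" for v
  proof -
    obtain n c where "v = (\<Sum>\<iota>\<in>E.level n. cscale (c \<iota>) (w' \<iota>))" using v by (rule E.PhiE)
    then show ?thesis using K.adj_koopman_adj(2)[OF adj_comb[OF E.level]] by simp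
  qed
  have wPhi: "w' \<iota> \<in> Phi ?W" if "\<iota> \<in> ?I" for \<iota>
    using E.w_in_W[OF E.in_level[OF that]] by (auto simp: Phi_def)
  show ?thesis
  proof (rule exI[of _ w], rule exI[of _ "\<lambda>i \<alpha>. E.u (i, \<alpha>)"], intro conjI ballI allI)
    fix i \<alpha> assume i: "i \<in> {1..r}"
    show "w i \<alpha> \<in> Phi ?W" unfolding w' by (rule wPhi[OF inI[OF i]])
    show "E.u (i, \<alpha>) \<in> Phi_star ip ?W" by (rule E.u_Phi_star)
    show "ext_koopman \<Omega> H ip f ?W (E.u (i, \<alpha>)) = pscale (mpow (lam i) \<alpha>) (E.u (i, \<alpha>))"
      unfolding ext lam' by (rule E.ext_op_u[OF inI[OF i]])
    show "w i \<alpha> \<in> koopman_adj_dom \<Omega> H ip f"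
      unfolding w' by (rule dom[OF wPhi[OF inI[OF i]]])
    show "?adj (w i \<alpha>) = cscale (cnj (mpow (lam i) \<alpha>)) (w i \<alpha>)"
      unfolding w' lam' by (rule E.K_w[OF inI[OF i]])
  next
    fix i j \<alpha> \<beta> assume "i \<in> {1..r}" and j: "j \<in> {1..r}"
    show "pairing ip (w j \<beta>) (E.u (i, \<alpha>)) = (if (i, \<alpha>) = (j, \<beta>) then 1 else 0)"
      unfolding w' E.pairing_w_u[OF inI[OF j]] by auto
  next
    fix v assume "v \<in> Phi_star ip ?W"
    from E.limitin_ext_op[OF this]
    show "limitin (Phi_star_topology H ip ?W)
         (\<lambda>F. \<Sum>(i, \<alpha>)\<in>F. pscale (mpow (lam i) \<alpha> * cnj (pairing ip (w i \<alpha>) v)) (E.u (i, \<alpha>)))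
         (ext_koopman \<Omega> H ip f ?W v) (finite_subsets_at_top ?I)"
      unfolding ext w' lam' by (simp only: case_prod_unfold prod.collapse)
  next
    fix v assume v: "v \<in> Phi ?W"
    show "v \<in> koopman_adj_dom \<Omega> H ip f" by (rule dom[OF v])
    from E.limitin_K[OF v]
    show "limitin (Phi_topology H ip ?W)
         (\<lambda>F. \<Sum>(i, \<alpha>)\<in>F. cscale (cnj (mpow (lam i) \<alpha>) * pairing ip v (E.u (i, \<alpha>))) (w i \<alpha>))
         (?adj v) (finite_subsets_at_top ?I)"
      unfolding w' lam' by (simp only: case_prod_unfold prod.collapse)
  qed
qed

end
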